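(* (a) Let $n>k\ge 2$. Then \[ \binom{n}{2}-\left\lceil\frac{kn}{2}\right\rceil+1\le mc_k(K_n)\le\binom{n}{2}-\left\lceil\frac{(k-1)n(n-1)}{2(n-2)}\right\rceil+1. \] (b) Let $n>k$, where $k\in\{2,3,4,5\}$. Then \[ mc_k(K_n)=\binom{n}{2}-\left\lceil\frac{kn}{2}\right\rceil+1. \]
   Context: $K_n$ is the complete graph on $n$ vertices. Paths are called disjoint if they are internally vertex-disjoint. An edge-coloured path is monochromatic if all its edges have the same colour. For a $k$-connected graph $G$, an edge-colouring is monochromatic $k$-connected if any two vertices are connected by $k$ disjoint monochromatic paths; $mc_k(G)$ is the maximum number of colours in a monochromatic $k$-connected colouring of $G$. *)

theory Defs
  imports Complex_Main
begin

text \<open>A simple graph is given by a vertex set V and a set E of 2-element edges.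
  An edge-colouring is a function c from edges to colours (natural numbers);
  only its values on E matter.\<close>

definition complete_edges :: "'a set \<Rightarrow> 'a set set" where
  "complete_edges V = {e. \<exists>x\<in>V. \<exists>y\<in>V. x \<noteq> y \<and> e = {x, y}}"

definition Kn_V :: "nat \<Rightarrow> nat set" where "Kn_V n = {0..<n}"
definition Kn_E :: "nat \<Rightarrow> nat set set" where "Kn_E n = complete_edges {0..<n}"

definition is_path :: "'a set \<Rightarrow> 'a set set \<Rightarrow> 'a \<Rightarrow> 'a \<Rightarrow> 'a list \<Rightarrow> bool" where
  "is_path V E u v p \<longleftrightarrow> 2 \<le> length p \<and> distinct p \<and> set p \<subseteq> V \<and>
     hd p = u \<and> last p = v \<and> (\<forall>i. Suc i < length p \<longrightarrow> {p ! i, p ! Suc i} \<in> E)"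

definition monochromatic :: "('a set \<Rightarrow> 'c) \<Rightarrow> 'a list \<Rightarrow> bool" where
  "monochromatic c p \<longleftrightarrow> (\<exists>col. \<forall>i. Suc i < length p \<longrightarrow> c {p ! i, p ! Suc i} = col)"

definition interior :: "'a list \<Rightarrow> 'a set" where
  "interior p = set (butlast (tl p))"

definition mono_k_connected :: "nat \<Rightarrow> 'a set \<Rightarrow> 'a set set \<Rightarrow> ('a set \<Rightarrow> nat) \<Rightarrow> bool" where
  "mono_k_connected k V E c \<longleftrightarrow>
     (\<forall>u\<in>V. \<forall>v\<in>V. u \<noteq> v \<longrightarrow>
        (\<exists>P. finite P \<and> card P = k \<and>
             (\<forall>p\<in>P. is_path V E u v p \<and> monochromatic c p) \<and>
             (\<forall>p\<in>P. \<forall>q\<in>P. p \<noteq> q \<longrightarrow> interior p \<inter> interior q = {})))"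

definition mc :: "nat \<Rightarrow> 'a set \<Rightarrow> 'a set set \<Rightarrow> nat" where
  "mc k V E = Max {card (c ` E) | c. mono_k_connected k V E c}"

end

theory Submission
  imports Defs
begin

text \<open>
  Lower bound: colour a \<open>k\<close>-connected Harary graph with one colour and all remaining edges with
  pairwise distinct colours.

  Upper bound: refine the colouring so that every colour class (here called a hue) is connected, and
  keep only the hues \<open>h\<close> with \<open>e(h) \<ge> 2\<close> edges. The number of colours is at most
  \<open>n(n-1)/2 - cost\<close> with \<open>cost = \<Sum>h. (e(h) - 1)\<close>. Any two vertices \<open>v, u\<close> are joined by
  \<open>k - 1\<close> disjoint monochromatic paths with at least two edges, each of which uses its own edge at \<open>v\<close>
  and must stay in a hue that contains \<open>u\<close>. So the excess \<open>d(v) - k\<close> bounds the number of edges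
  at \<open>v\<close> that are useless for reaching \<open>u\<close>. Fix a vertex \<open>w\<close>. For most vertices \<open>v\<close> take
  the target \<open>u = w\<close>, but for the vertices that have a neighbour outside all hues through \<open>v\<close> that miss
  \<open>w\<close> take this neighbour as target. Summation over \<open>v\<close> gives
  \<open>2 cost \<ge> k(n - 1) + \<Sum>h. slack(h, w)\<close> with nonnegative slacks, for every \<open>w\<close>.

  If the bound of part (a) failed, then all slacks would be so small that there are too few monochromatic
  paths with two edges for the interiors of \<open>k - 1\<close> disjoint paths to fit into \<open>n - 2\<close> vertices.
  If the bound of part (b) failed, then the slacks at every \<open>w\<close> would sum up to at most
  \<open>k - 3 \<le> 2\<close>, which forces all hues to be spanning and leaves exactly two hues; these are
  excluded by looking at the vertices of degree \<open>k\<close>.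
\<close>

section \<open>Menger's theorem\<close>

text \<open>Splitting a colour into connected hues is harmless: the number of colours can only grow,
  and a monochromatic path stays in one component. Single-edge hues are free, as such an edge can
  only serve as the direct path between its ends; hence only \<open>k - 1\<close> paths are ever
  counted.

  The obstacle is one unit. If \<open>vu\<close> lies in a hue, the useless edges at
  \<open>v\<close> number at most the excess of \<open>v\<close>; otherwise the direct path occupies
  no counted edge and the bound is weaker by one. Aiming every vertex at \<open>w\<close> could lose
  this unit almost everywhere, so neighbours serve as targets where possible. The vertices that
  still lose a unit lie in hues that miss \<open>w\<close> and are reachable there from good
  vertices, so such a hue pays for at most all but one of its vertices. It can afford this, because
  its degree sum exceeds its number of vertices.

  The vertex \<open>w\<close> is left out of the sum, which yields \<open>k(n - 1)\<close>, whereas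
  (b) asks for \<open>kn - 2\<close>. If (b) fails, \<open>2 cost \<le> kn - 3\<close>, so the room
  for slack is \<open>k - 3\<close>; this is why the argument stops at \<open>k = 5\<close>.\<close>

definition separates :: "('a \<times> 'a) set \<Rightarrow> 'a set \<Rightarrow> 'a set \<Rightarrow> 'a set \<Rightarrow> bool" where
  "separates R A B S \<longleftrightarrow> (\<forall>a\<in>A - S. \<forall>b\<in>B - S. (a, b) \<notin> (R \<inter> (- S) \<times> (- S))\<^sup>*)"

definition dpath :: "('a \<times> 'a) set \<Rightarrow> 'a set \<Rightarrow> 'a set \<Rightarrow> 'a list \<Rightarrow> bool" where
  "dpath R A B p \<longleftrightarrow> p \<noteq> [] \<and> distinct p \<and> hd p \<in> A \<and> last p \<in> B \<and>
     successively (\<lambda>x y. (x, y) \<in> R) p"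

definition disjoint_paths :: "'a list set \<Rightarrow> bool" where
  "disjoint_paths P \<longleftrightarrow> (\<forall>p\<in>P. \<forall>q\<in>P. p \<noteq> q \<longrightarrow> set p \<inter> set q = {})"

lemma successively_imp_rtrancl:
  assumes "successively (\<lambda>x y. (x, y) \<in> R) p" "p \<noteq> []" "set p \<inter> S = {}"
  shows "(hd p, last p) \<in> (R \<inter> (- S) \<times> (- S))\<^sup>*"
  using assms
proof (induction p)
  case Nil
  then show ?case by simp
next
  case (Cons a p)
  show ?case
  proof (cases "p = []")
    case True
    then show ?thesis by simp
  next
    case False
    then have "(hd p, last p) \<in> (R \<inter> (- S) \<times> (- S))\<^sup>*" and "(a, hd p) \<in> R"
      using Cons by (auto simp: successively_Cons)
    moreover have "a \<notin> S" using Cons.prems(3) by simp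
    moreover have "hd p \<notin> S" using Cons.prems(3) hd_in_set[OF False] by auto
    ultimately have "(a, last p) \<in> (R \<inter> (- S) \<times> (- S))\<^sup>*"
      by (intro converse_rtrancl_into_rtrancl[of a "hd p"]) auto
    then show ?thesis using False by simp
  qed
qed

lemma separates_mono:
  assumes "separates R A B S" "R' \<inter> (- S') \<times> (- S') \<subseteq> R \<inter> (- S) \<times> (- S)" "S \<subseteq> S'"
  shows "separates R' A B S'"
proof -
  have "(R' \<inter> (- S') \<times> (- S'))\<^sup>* \<subseteq> (R \<inter> (- S) \<times> (- S))\<^sup>*"
    by (rule rtrancl_mono[OF assms(2)])
  then show ?thesis using assms(1,3) unfolding separates_def by blast
qed

text \<open>A walk from \<open>A\<close> avoiding \<open>T\<close> can use the new edge only after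
  reaching its tail \<open>x\<close>, which lies in \<open>X\<close>. Until it meets
  \<open>X\<close> it therefore runs in \<open>R\<close>, where \<open>T\<close> blocks it; so it
  never enters \<open>X\<close>, and \<open>X\<close> keeps it away from \<open>B\<close>.\<close>

lemma separates_left:
  assumes X: "separates (insert (x, y) R) A B X" and "x \<in> X" and T: "separates R A X T"
  shows "separates (insert (x, y) R) A B T"
  unfolding separates_def
proof (intro ballI notI)
  fix a b
  assume a: "a \<in> A - T" and b: "b \<in> B - T"
    and ab: "(a, b) \<in> (insert (x, y) R \<inter> (- T) \<times> (- T))\<^sup>*"
  have *: "z \<notin> X \<and> (a, z) \<in> (R \<inter> (- T) \<times> (- T) \<inter> (- X) \<times> (- X))\<^sup>*"
    if "(a, z) \<in> (insert (x, y) R \<inter> (- T) \<times> (- T))\<^sup>*" for z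
    using that
  proof (induction rule: rtrancl_induct)
    case base
    have "a \<notin> X" using T a unfolding separates_def by blast
    then show ?case by simp
  next
    case (step u v)
    then have uv: "(u, v) \<in> R \<inter> (- T) \<times> (- T)" using \<open>x \<in> X\<close> by auto
    have "(a, u) \<in> (R \<inter> (- T) \<times> (- T))\<^sup>*"
      using step.IH rtrancl_mono[of "R \<inter> (- T) \<times> (- T) \<inter> (- X) \<times> (- X)" "R \<inter> (- T) \<times> (- T)"] by blast
    then have "(a, v) \<in> (R \<inter> (- T) \<times> (- T))\<^sup>*" using uv by (rule rtrancl_into_rtrancl)
    then have "v \<notin> X" using T a uv unfolding separates_def by blast
    then show ?case using step.IH uv by (auto intro: rtrancl_into_rtrancl)
  qed
  have "a \<notin> X" using *[of a] by simp
  moreover have "(a, b) \<in> (insert (x, y) R \<inter> (- X) \<times> (- X))\<^sup>*" "b \<notin> X"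
    using *[OF ab] rtrancl_mono[of "R \<inter> (- T) \<times> (- T) \<inter> (- X) \<times> (- X)" "insert (x, y) R \<inter> (- X) \<times> (- X)"]
    by blast+
  ultimately show False using X a b unfolding separates_def by blast
qed

lemma separates_converse: "separates (R\<inverse>) B A S \<longleftrightarrow> separates R A B S"
proof -
  have "(R\<inverse> \<inter> (- S) \<times> (- S)) = (R \<inter> (- S) \<times> (- S))\<inverse>" by auto
  then show ?thesis unfolding separates_def by (auto simp: rtrancl_converse)
qed

lemma separates_right:
  assumes X: "separates (insert (x, y) R) A B Y" and "y \<in> Y" and T: "separates R Y B T"
  shows "separates (insert (x, y) R) A B T"
proof -
  have eq: "(insert (x, y) R)\<inverse> = insert (y, x) (R\<inverse>)" by auto
  have "separates (insert (y, x) (R\<inverse>)) B A T"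
    by (rule separates_left[of _ _ _ _ _ Y])
      (use assms separates_converse[of "insert (x, y) R" B A Y] separates_converse[of R B Y T] eq in auto)
  then show ?thesis using separates_converse[of "insert (x, y) R" B A T] eq by simp
qed

text \<open>The counts match, so \<open>e\<close> is a bijection from the paths onto
  \<open>X\<close>; a path meeting a second element of \<open>X\<close> would share it with the path
  that ends there. It is used with \<open>e = last\<close> and \<open>e = hd\<close>.\<close>

lemma disjoint_paths_ends:
  assumes P: "finite P" "disjoint_paths P" "\<And>p. p \<in> P \<Longrightarrow> p \<noteq> [] \<and> e p \<in> X \<inter> set p"
    and X: "finite X" "card X = card P"
  shows "\<exists>g. \<forall>s\<in>X. g s \<in> P \<and> e (g s) = s \<and> set (g s) \<inter> X = {s}"
proof -
  have inj: "inj_on e P"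
    using P unfolding inj_on_def disjoint_paths_def by (metis IntE disjoint_iff)
  have im: "e ` P = X"
    by (rule card_subset_eq) (use P X inj card_image in \<open>auto simp: card_image\<close>)
  have "\<exists>p. p \<in> P \<and> e p = s \<and> set p \<inter> X = {s}" if "s \<in> X" for s
  proof -
    obtain p where p: "p \<in> P" "e p = s" using im \<open>s \<in> X\<close> by blast
    have "t = s" if "t \<in> set p \<inter> X" for t
    proof -
      have "t \<in> e ` P" using im that by blast
      then obtain q where q: "q \<in> P" "e q = t" by blast
      then have "q = p" using p that P unfolding disjoint_paths_def by (metis IntE disjoint_iff)
      then show ?thesis using p q by simp
    qed
    then show ?thesis using p P(3)[of p] by auto
  qed
  then show ?thesis by (intro bchoice) blast
qed

text \<open>Otherwise \<open>p\<close> up to \<open>z\<close> followed by \<open>q\<close> from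
  \<open>z\<close> on avoids \<open>S\<close>: \<open>p\<close> can meet \<open>S\<close> only at
  its last vertex, \<open>q\<close> only at its first.\<close>

lemma separated_paths_meet:
  assumes S: "separates R A B S"
    and p: "dpath R A X p" "set p \<inter> S \<subseteq> {last p}"
    and q: "dpath R Y B q" "set q \<inter> S \<subseteq> {hd q}"
    and z: "z \<in> set p \<inter> set q"
  shows "z \<in> S"
proof (rule ccontr)
  assume "z \<notin> S"
  obtain p1 p2 where p12: "p = p1 @ z # p2" using z by (metis IntD1 split_list)
  obtain q1 q2 where q12: "q = q1 @ z # q2" using z by (metis IntD2 split_list)
  have "last p \<in> set (z # p2)" using p12 by auto
  then have "set (p1 @ [z]) \<inter> S = {}"
    using p p12 \<open>z \<notin> S\<close> unfolding dpath_def by (auto split: if_splits)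
  moreover have "successively (\<lambda>x y. (x, y) \<in> R) (p1 @ [z])"
    using p p12 unfolding dpath_def by (auto simp: successively_append_iff)
  ultimately have "(hd (p1 @ [z]), last (p1 @ [z])) \<in> (R \<inter> (- S) \<times> (- S))\<^sup>*"
    by (intro successively_imp_rtrancl) auto
  moreover have "hd (p1 @ [z]) = hd p" using p12 by (cases p1) auto
  ultimately have 1: "(hd p, z) \<in> (R \<inter> (- S) \<times> (- S))\<^sup>*" by simp
  have a: "hd p \<notin> S" using \<open>set (p1 @ [z]) \<inter> S = {}\<close> p12 by (cases p1) auto
  have "hd q \<in> set (q1 @ [z])" using q12 by (cases q1) auto
  have dq: "distinct q" using q(1) unfolding dpath_def by auto
  have no: "set (z # q2) \<inter> S = {}"
  proof (rule ccontr)
    assume "set (z # q2) \<inter> S \<noteq> {}"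
    then obtain t where t: "t \<in> set q2" "t \<in> S" using \<open>z \<notin> S\<close> by auto
    then have "t = hd q" using q(2) q12 by auto
    then show False using \<open>hd q \<in> set (q1 @ [z])\<close> t dq q12 by auto
  qed
  have "successively (\<lambda>x y. (x, y) \<in> R) (z # q2)"
    using q q12 unfolding dpath_def by (auto simp: successively_append_iff)
  then have "(z, last q) \<in> (R \<inter> (- S) \<times> (- S))\<^sup>*"
    using successively_imp_rtrancl[of R "z # q2" S] no q12 by simp
  then have 2: "(hd p, last q) \<in> (R \<inter> (- S) \<times> (- S))\<^sup>*" using 1 by simp
  have "last q \<in> set (z # q2)" using q12 by auto
  then have "last q \<notin> S" using no by blast
  then show False using S 2 a p q unfolding separates_def dpath_def by blast
qed

text \<open>
  Induction on the number of edges, after Goering: if deleting \<open>(x, y)\<close> lowers the connectivity, then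
  there is a small separator \<open>S\<close> of the rest, and paths into \<open>S \<union> {x}\<close> and out of \<open>S \<union> {y}\<close>
  can be glued along \<open>S\<close> and the edge \<open>(x, y)\<close>.
\<close>

theorem menger:
  assumes "finite R" "finite A" "finite B"
    and "\<And>S. finite S \<Longrightarrow> separates R A B S \<Longrightarrow> m \<le> card S"
  shows "\<exists>P. finite P \<and> card P = m \<and> (\<forall>p\<in>P. dpath R A B p) \<and> disjoint_paths P"
  using assms
proof (induction R arbitrary: A B rule: finite_induct)
  case empty
  have "separates {} A B (A \<inter> B)" unfolding separates_def by auto
  then have "m \<le> card (A \<inter> B)" using empty by simp
  then obtain D where D: "D \<subseteq> A \<inter> B" "card D = m" "finite D"
    by (metis obtain_subset_with_card_n)
  have "finite ((\<lambda>a. [a]) ` D) \<and> card ((\<lambda>a. [a]) ` D) = m \<and>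
    (\<forall>p\<in>(\<lambda>a. [a]) ` D. dpath {} A B p) \<and> disjoint_paths ((\<lambda>a. [a]) ` D)"
    using D by (auto simp: dpath_def disjoint_paths_def card_image inj_on_def)
  then show ?case by blast
next
  case (insert e R)
  obtain x y where e: "e = (x, y)" by force
  show ?case
  proof (cases "\<forall>S. finite S \<longrightarrow> separates R A B S \<longrightarrow> m \<le> card S")
    case True
    then obtain P where P: "finite P" "card P = m" "\<forall>p\<in>P. dpath R A B p" "disjoint_paths P"
      using insert.IH[OF insert.prems(1,2)] by blast
    have "dpath (insert e R) A B p" if "p \<in> P" for p
      using P(3) that unfolding dpath_def by (auto elim: successively_mono)
    then show ?thesis using P by blast
  next
    case False
    then obtain S where S: "finite S" "separates R A B S" "card S < m" by auto
    have sep: "separates (insert (x, y) R) A B (insert x S)" "separates (insert (x, y) R) A B (insert y S)"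
      by (rule separates_mono[OF S(2)]; auto)+
    then have "m \<le> card (insert x S)" "m \<le> card (insert y S)"
      using insert.prems(3) S(1) e by auto
    then have xy: "x \<notin> S" "y \<notin> S" "card (insert x S) = m" "card (insert y S) = m"
      using S(1,3) by (auto simp: card_insert_if split: if_splits)
    have "\<exists>P. finite P \<and> card P = m \<and> (\<forall>p\<in>P. dpath R A (insert x S) p) \<and> disjoint_paths P"
      by (rule insert.IH) (use insert.prems S separates_left[OF sep(1)] e in auto)
    then obtain P where P: "finite P" "card P = m" "\<And>p. p \<in> P \<Longrightarrow> dpath R A (insert x S) p" "disjoint_paths P"
      by blast
    have "\<exists>P. finite P \<and> card P = m \<and> (\<forall>p\<in>P. dpath R (insert y S) B p) \<and> disjoint_paths P"
      by (rule insert.IH) (use insert.prems S separates_right[OF sep(2)] e in auto)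
    then obtain Q where Q: "finite Q" "card Q = m" "\<And>p. p \<in> Q \<Longrightarrow> dpath R (insert y S) B p" "disjoint_paths Q"
      by blast
    have "\<exists>g. \<forall>s\<in>insert x S. g s \<in> P \<and> last (g s) = s \<and> set (g s) \<inter> insert x S = {s}"
      by (rule disjoint_paths_ends) (use P S xy in \<open>auto simp: dpath_def\<close>)
    then obtain g where g: "\<And>s. s \<in> insert x S \<Longrightarrow> g s \<in> P \<and> last (g s) = s \<and> set (g s) \<inter> insert x S = {s}"
      by blast
    have "\<exists>g. \<forall>s\<in>insert y S. g s \<in> Q \<and> hd (g s) = s \<and> set (g s) \<inter> insert y S = {s}"
      by (rule disjoint_paths_ends) (use Q S xy in \<open>auto simp: dpath_def\<close>)
    then obtain h where h: "\<And>s. s \<in> insert y S \<Longrightarrow> h s \<in> Q \<and> hd (h s) = s \<and> set (h s) \<inter> insert y S = {s}"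
      by blast
    define \<sigma> where "\<sigma> s = (if s = x then y else s)" for s
    have \<sigma>: "\<sigma> s \<in> insert y S" if "s \<in> insert x S" for s using that by (auto simp: \<sigma>_def)
    have meet: "z \<in> S \<and> z = s \<and> z = t"
      if "s \<in> insert x S" "t \<in> insert y S" "z \<in> set (g s) \<inter> set (h t)" for s t z
    proof -
      have "z \<in> S"
        by (rule separated_paths_meet[OF S(2), of "insert x S" "g s" "insert y S" "h t"])
          (use g[OF that(1)] h[OF that(2)] P(3) Q(3) that in auto)
      then show ?thesis using g[OF that(1)] h[OF that(2)] that by auto
    qed
    \<comment> \<open>A path into \<open>s \<in> S\<close> continues with the path out of
      \<open>s\<close>, whose first vertex is dropped as a duplicate; the path into \<open>x\<close>
      crosses the new edge to \<open>y\<close>.\<close>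
    define r where "r s = g s @ (if s = x then h y else tl (h s))" for s
    have hs: "h t \<noteq> [] \<and> distinct (h t) \<and> successively (\<lambda>a b. (a, b) \<in> R) (h t) \<and> last (h t) \<in> B"
      if "t \<in> insert y S" for t using h[OF that] Q(3)[of "h t"] unfolding dpath_def by auto
    have gs: "g t \<noteq> [] \<and> distinct (g t) \<and> successively (\<lambda>a b. (a, b) \<in> R) (g t) \<and> hd (g t) \<in> A"
      if "t \<in> insert x S" for t using g[OF that] P(3)[of "g t"] unfolding dpath_def by auto
    have path: "dpath (insert (x, y) R) A B (r s)" if s: "s \<in> insert x S" for s
    proof (cases "s = x")
      case True
      have "set (g x) \<inter> set (h y) = {}" using meet[of x y] xy by auto
      moreover have "successively (\<lambda>a b. (a, b) \<in> insert (x, y) R) (g x @ h y)"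
        unfolding successively_append_iff using gs[of x] hs[of y] g[of x] h[of y]
        by (auto elim: successively_mono)
      ultimately show ?thesis using True gs[of x] hs[of y] unfolding dpath_def r_def by auto
    next
      case False
      then have sS: "s \<in> S" using s by auto
      obtain l where l: "h s = s # l" using h[of s] hs[of s] sS by (cases "h s") auto
      have "set (g s) \<inter> set l = {}" using meet[of s s] hs[of s] l sS by auto
      moreover have "successively (\<lambda>a b. (a, b) \<in> insert (x, y) R) (g s @ l)"
        unfolding successively_append_iff using gs[of s] hs[of s] g[of s] h[of s] sS l
        by (auto elim: successively_mono simp: successively_Cons)
      moreover have "last (g s @ l) \<in> B" using hs[of s] g[of s] l sS by (auto split: if_splits)
      ultimately show ?thesis using False sS l gs[of s] hs[of s] unfolding dpath_def r_def by auto
    qed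
    have disj: "set (r s) \<inter> set (r t) = {}" if s: "s \<in> insert x S" and t: "t \<in> insert x S" and "s \<noteq> t" for s t
    proof -
      have sub: "set (r s) \<subseteq> set (g s) \<union> set (h (\<sigma> s))" for s
        unfolding r_def \<sigma>_def by (cases "h s") auto
      have g0: "set (g s) \<inter> set (g t) = {}"
        using P(4) g[OF s] g[OF t] \<open>s \<noteq> t\<close> unfolding disjoint_paths_def by metis
      have "\<sigma> s \<noteq> \<sigma> t" using \<open>s \<noteq> t\<close> s t xy by (auto simp: \<sigma>_def)
      then have h0: "set (h (\<sigma> s)) \<inter> set (h (\<sigma> t)) = {}"
        using Q(4) h[OF \<sigma>[OF s]] h[OF \<sigma>[OF t]] unfolding disjoint_paths_def by metis
      have c: "set (g s) \<inter> set (h (\<sigma> t)) = {}" if "s \<in> insert x S" "t \<in> insert x S" "s \<noteq> t" for s t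
      proof (rule ccontr)
        assume "set (g s) \<inter> set (h (\<sigma> t)) \<noteq> {}"
        then obtain z where "z \<in> set (g s) \<inter> set (h (\<sigma> t))" by blast
        then have "z \<in> S" "z = s" "z = \<sigma> t" using meet[OF that(1) \<sigma>[OF that(2)], of z] by auto
        then show False using xy that by (auto simp: \<sigma>_def split: if_splits)
      qed
      show ?thesis using sub[of s] sub[of t] g0 h0 c[OF s t \<open>s \<noteq> t\<close>] c[OF t s] \<open>s \<noteq> t\<close> by blast
    qed
    have "inj_on r (insert x S)"
    proof (rule inj_onI, rule ccontr)
      fix s t assume "s \<in> insert x S" "t \<in> insert x S" "r s = r t" "s \<noteq> t"
      then show False using disj[of s t] path[of s] unfolding dpath_def by auto
    qed
    then have "card (r ` insert x S) = m" using xy(3) card_image by metis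
    moreover have "disjoint_paths (r ` insert x S)" unfolding disjoint_paths_def using disj by blast
    moreover have "finite (r ` insert x S)" using S by simp
    ultimately show ?thesis using path e by blast
  qed
qed

section \<open>Harary graphs\<close>

text \<open>A circulant, with near-diameters added for odd \<open>k\<close>. These start only in the
  first half of the cycle; for odd \<open>n\<close> the last of them ends at 0, so that 0 gets two
  and no vertex is left without one.\<close>

definition harary :: "nat \<Rightarrow> nat \<Rightarrow> nat set set" where
  "harary n k =
     (\<lambda>(i, d). {i, (i + d) mod n}) ` ({..<n} \<times> {1..k div 2}) \<union>
     (if odd k then (\<lambda>i. {i, (i + (n + 1) div 2) mod n}) ` {..<(n + 1) div 2} else {})"

lemma harary_subset:
  assumes "k < n"
  shows "harary n k \<subseteq> complete_edges {0..<n}"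
proof -
  have *: "i \<noteq> (i + d) mod n" if "i < n" "0 < d" "d < n" for i d
  proof (cases "i + d < n")
    case False
    then have "(i + d) mod n = i + d - n" using that by (simp add: le_mod_geq)
    then show ?thesis using that False by linarith
  qed (use that in auto)
  have **: "{i, (i + d) mod n} \<in> complete_edges {0..<n}" if "i < n" "0 < d" "d < n" for i d
  proof -
    have "(i + d) mod n \<in> {0..<n}" "i \<in> {0..<n}" using that by auto
    then show ?thesis using *[OF that] unfolding complete_edges_def by blast
  qed
  show ?thesis
  proof (cases "k = 0")
    case True
    then show ?thesis by (auto simp: harary_def)
  next
    case False
    then have "(n + 1) div 2 < n" "k div 2 < n" using assms by linarith+
    then show ?thesis unfolding harary_def using ** by auto
  qed
qed

lemma card_harary: "2 * card (harary n k) \<le> k * n + 1"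
proof -
  have fin: "finite (harary n k)" unfolding harary_def by auto
  have c1: "card ((\<lambda>(i, d). {i, (i + d) mod n}) ` ({..<n} \<times> {1..k div 2})) \<le> n * (k div 2)"
    by (rule card_image_le[THEN le_trans]) auto
  have c2: "card ((\<lambda>i. {i, (i + (n + 1) div 2) mod n}) ` {..<(n + 1) div 2}) \<le> (n + 1) div 2"
    by (rule card_image_le[THEN le_trans]) auto
  have c: "card (harary n k) \<le> n * (k div 2) + (if odd k then (n + 1) div 2 else 0)"
    unfolding harary_def by (rule card_Un_le[THEN le_trans]) (use c1 c2 in auto)
  have kk: "k * n = 2 * (n * (k div 2)) + (if odd k then n else 0)"
  proof (cases "odd k")
    case True
    then obtain l where "k = 2 * l + 1" by (rule oddE)
    then show ?thesis by (simp add: algebra_simps)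
  next
    case False
    then obtain l where "k = 2 * l" by auto
    then show ?thesis by (simp add: algebra_simps)
  qed
  show "2 * card (harary n k) \<le> k * n + 1" using c kk by (auto split: if_splits)
qed

lemma harary_cycle_edge:
  assumes "0 < d" "d \<le> k div 2" "0 < n"
  shows "{i mod n, (i + d) mod n} \<in> harary n k"
proof -
  have "(i + d) mod n = (i mod n + d) mod n" by (simp add: mod_add_left_eq)
  then show ?thesis unfolding harary_def using assms by auto
qed

text \<open>A vertex of the second half is the far end of a near-diameter, so the offset seen from
  it is the complementary one. For odd \<open>n\<close> the two offsets differ by one.\<close>

lemma harary_antipode:
  assumes "odd k" "y < n"
  shows "\<exists>e\<in>{(n + 1) div 2, n - (n + 1) div 2}. {y, (y + e) mod n} \<in> harary n k"
proof (cases "y < (n + 1) div 2")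
  case True
  then show ?thesis using assms unfolding harary_def by auto
next
  case False
  define h where "h = (n + 1) div 2"
  have "(y + (n - h)) mod n = y - h"
  proof -
    have "y + (n - h) = y - h + n" "y - h < n" using False assms h_def by linarith+
    then show ?thesis by simp
  qed
  moreover have "{y - h, (y - h + h) mod n} \<in> harary n k"
    using assms False h_def unfolding harary_def by auto
  moreover have "(y - h + h) mod n = y" using False assms h_def by simp
  ultimately show ?thesis using h_def by (auto simp: insert_commute)
qed

lemma mod_add_cancel_nat: "(a + i) mod n = (b + i) mod n \<Longrightarrow> a mod n = b mod n" for a b i n :: nat
  unfolding nat_mod_eq_iff by (metis add.commute add.left_commute add_left_cancel)

text \<open>Take the least forward distance \<open>m\<close> from \<open>C\<close> to
  \<open>D\<close>: a vertex of \<open>C\<close> or \<open>D\<close> strictly in between would give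
  a smaller one.\<close>

lemma cyclic_gap:
  fixes n :: nat
  assumes "C \<inter> D = {}" "C \<subseteq> {..<n}" "D \<subseteq> {..<n}" "C \<noteq> {}" "D \<noteq> {}"
  obtains c m where "c \<in> C" "0 < m" "m < n" "(c + m) mod n \<in> D"
    "\<And>i. 0 < i \<Longrightarrow> i < m \<Longrightarrow> (c + i) mod n \<in> {..<n} - C - D"
proof -
  define Q where "Q m \<longleftrightarrow> (\<exists>c\<in>C. (c + m) mod n \<in> D)" for m
  obtain c d where cd: "c \<in> C" "d \<in> D" using assms by blast
  then have "c < n" "d < n" using assms by auto
  then have "(c + (n - c + d)) mod n = d" by simp
  then have "Q (n - c + d)" unfolding Q_def using cd by metis
  then have Qm: "Q (Least Q)" by (rule LeastI)
  define m where "m = Least Q"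
  have least: "\<not> Q i" if "i < m" for i using that not_less_Least unfolding m_def by blast
  obtain c where c: "c \<in> C" "(c + m) mod n \<in> D" using Qm unfolding Q_def m_def by blast
  have cn: "c < n" using c assms by auto
  have m0: "0 < m" using c cn assms by (cases m) auto
  have mn: "m < n"
  proof (rule ccontr)
    assume "\<not> m < n"
    then have "(c + (m - n) + n) mod n = (c + m) mod n" by simp
    then have "(c + (m - n)) mod n \<in> D" using c by simp
    then have "Q (m - n)" unfolding Q_def using c(1) by blast
    then show False using least[of "m - n"] cn \<open>\<not> m < n\<close> by auto
  qed
  have "(c + i) mod n \<in> {..<n} - C - D" if i: "0 < i" "i < m" for i
  proof -
    have "(c + i) mod n \<notin> D" using least[OF i(2)] c unfolding Q_def by auto
    moreover have "(c + i) mod n \<notin> C"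
    proof
      assume "(c + i) mod n \<in> C"
      moreover have "((c + i) mod n + (m - i)) mod n = (c + m) mod n"
        using i by (metis add.assoc le_add_diff_inverse less_imp_le mod_add_left_eq)
      ultimately have "Q (m - i)" unfolding Q_def using c by metis
      then show False using least[of "m - i"] i by auto
    qed
    ultimately show ?thesis using cn by auto
  qed
  then show ?thesis using that c m0 mn by blast
qed

lemma card_arc:
  fixes n :: nat
  assumes "m \<le> n"
  shows "card ((\<lambda>i. (c + i) mod n) ` {0<..<m}) = m - 1"
    and "inj_on (\<lambda>i. (c + i) mod n) {0<..<m}"
proof -
  have *: "(c + i) mod n \<noteq> (c + j) mod n" if "i < j" "j < n" for i j
  proof
    assume "(c + i) mod n = (c + j) mod n"
    then have "n dvd (c + j) - (c + i)" by (metis mod_eq_dvd_iff_nat add_le_cancel_left less_imp_le that(1))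
    then show False using that by (auto dest: dvd_imp_le)
  qed
  show "inj_on (\<lambda>i. (c + i) mod n) {0<..<m}"
  proof (rule inj_onI)
    fix i j assume "i \<in> {0<..<m}" "j \<in> {0<..<m}" "(c + i) mod n = (c + j) mod n"
    then show "i = j" using *[of i j] *[of j i] assms by (cases i j rule: linorder_cases) auto
  qed
  then show "card ((\<lambda>i. (c + i) mod n) ` {0<..<m}) = m - 1" by (simp add: card_image)
qed

text \<open>
  A component \<open>C\<close> and its complement are separated by two arcs of at least \<open>k div 2\<close> removed
  vertices each. This is too much for even \<open>k\<close>; for odd \<open>k\<close> nothing else is removed, and then
  an antipodal edge joins the two remaining arcs.
\<close>

lemma harary_connected:
  assumes k: "2 \<le> k" "k < n" and S: "S \<subseteq> {..<n}" "card S < k"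
    and C: "C \<subseteq> {..<n} - S" "C \<noteq> {}"
    and closed: "\<And>x y. x \<in> C \<Longrightarrow> y \<in> {..<n} - S \<Longrightarrow> {x, y} \<in> harary n k \<Longrightarrow> y \<in> C"
  shows "C = {..<n} - S"
proof (rule ccontr)
  assume neq: "C \<noteq> {..<n} - S"
  define D where "D = {..<n} - S - C"
  define r where "r = k div 2"
  have r: "0 < r" using k r_def by auto
  have D: "D \<noteq> {}" "D \<subseteq> {..<n}" "C \<inter> D = {}" "D \<inter> C = {}" "C \<subseteq> {..<n}"
    using C neq unfolding D_def by auto
  have no: "{x, y} \<notin> harary n k" if "x \<in> C" "y \<in> D" for x y
    using closed[of x y] that D unfolding D_def by auto
  have no': "{x, y} \<notin> harary n k" if "x \<in> D" "y \<in> C" for x y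
    using no[of y x] that by (simp add: insert_commute)
  obtain c m where c: "c \<in> C" "0 < m" "m < n" "(c + m) mod n \<in> D"
    and cS: "\<And>i. 0 < i \<Longrightarrow> i < m \<Longrightarrow> (c + i) mod n \<in> {..<n} - C - D"
    using cyclic_gap[OF D(3) D(5,2) C(2) D(1)] by blast
  obtain d m' where d: "d \<in> D" "0 < m'" "m' < n" "(d + m') mod n \<in> C"
    and dS: "\<And>i. 0 < i \<Longrightarrow> i < m' \<Longrightarrow> (d + i) mod n \<in> {..<n} - D - C"
    using cyclic_gap[OF D(4) D(2,5) D(1) C(2)] by blast
  have cdn: "c < n" "d < n" using c d D by auto
  have rm: "r < m"
  proof (rule ccontr)
    assume "\<not> r < m"
    then show False using harary_cycle_edge[of m k n c] c cdn no r_def by auto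
  qed
  have rm': "r < m'"
  proof (rule ccontr)
    assume "\<not> r < m'"
    then show False using harary_cycle_edge[of m' k n d] d cdn no' r_def by auto
  qed
  define G1 where "G1 = (\<lambda>i. (c + i) mod n) ` {0<..<m}"
  define G2 where "G2 = (\<lambda>i. (d + i) mod n) ` {0<..<m'}"
  have CDS: "{..<n} - C - D \<subseteq> S" "{..<n} - D - C \<subseteq> S" unfolding D_def by auto
  have G: "G1 \<subseteq> S" "G2 \<subseteq> S"
    using cS dS CDS unfolding G1_def G2_def by (meson greaterThanLessThan_iff image_subsetI subsetD)+
  have cG: "card G1 = m - 1" "card G2 = m' - 1"
    unfolding G1_def G2_def using card_arc c d by auto
  have shift: "a = (b + (j - i)) mod n" if "(a + i) mod n = (b + j) mod n" "a < n" "i \<le> j" for a b i j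
  proof -
    have "(a + i) mod n = (b + (j - i) + i) mod n" using that by simp
    then have "a mod n = (b + (j - i)) mod n" by (rule mod_add_cancel_nat)
    then show ?thesis using that by simp
  qed
  have "G1 \<inter> G2 = {}"
  proof (rule ccontr)
    assume "G1 \<inter> G2 \<noteq> {}"
    then obtain i j where ij: "0 < i" "i < m" "0 < j" "j < m'" "(c + i) mod n = (d + j) mod n"
      unfolding G1_def G2_def by auto
    show False
    proof (cases "i \<le> j")
      case True
      have 1: "c = (d + (j - i)) mod n" using shift[OF ij(5) cdn(1) True] .
      show ?thesis
      proof (cases "i = j")
        case True
        then show ?thesis using 1 c d D cdn by auto
      next
        case False
        then show ?thesis using dS[of "j - i"] 1 c ij True by auto
      qed
    next
      case False
      then have "d = (c + (i - j)) mod n" using shift[OF ij(5)[symmetric] cdn(2)] by auto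
      then show ?thesis using cS[of "i - j"] d ij False by auto
    qed
  qed
  then have card12: "card (G1 \<union> G2) = (m - 1) + (m' - 1)"
    using cG by (subst card_Un_disjoint) (auto simp: G1_def G2_def)
  have finS: "finite S" using S finite_subset by auto
  have "(m - 1) + (m' - 1) \<le> card S" using card12 card_mono[OF finS, of "G1 \<union> G2"] G by simp
  moreover have "k = 2 * r \<or> k = 2 * r + 1" unfolding r_def by presburger
  ultimately have k2: "k = 2 * r + 1" and m: "m = r + 1" "m' = r + 1" and "card S = 2 * r"
    using rm rm' S(2) by linarith+
  have odd: "odd k" using k2 by simp
  then have Seq: "S = G1 \<union> G2" using card12 G finS \<open>card S = 2 * r\<close> m by (intro card_subset_eq[symmetric]) auto
  \<comment> \<open>Coordinates along the cycle starting after \<open>c = x n\<close>. The removed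
    arcs occupy the indices \<open>1..r\<close> and \<open>q + 1..q + r\<close>, so \<open>D\<close>
    gets the block \<open>r + 1..q\<close> and \<open>C\<close> the block
    \<open>q + r + 1..n\<close>.\<close>
  define x where "x i = (c + i) mod n" for i
  have xlt: "x i < n" for i using k unfolding x_def by auto
  have xinj: "i = j" if "x i = x j" "0 < i" "i \<le> n" "0 < j" "j \<le> n" for i j
  proof -
    have "(i + c) mod n = (j + c) mod n" using that(1) unfolding x_def by (simp add: add.commute)
    then have "i mod n = j mod n" by (rule mod_add_cancel_nat)
    then show ?thesis using that by (cases "i = n"; cases "j = n") auto
  qed
  have xn: "x n = c" unfolding x_def using cdn by simp
  obtain q where q: "0 < q" "q < n" "d = x q"
  proof -
    define q where "q = (if c < d then d - c else n - c + d)"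
    have "x q = d" unfolding x_def q_def using cdn by auto
    moreover have "c \<noteq> d" using c d D by blast
    then have "q < n" "0 < q" unfolding q_def using cdn by auto
    ultimately show ?thesis using that by auto
  qed
  have G1x: "x i \<in> G1" if "0 < i" "i \<le> r" for i using that m unfolding G1_def x_def by auto
  have xqi: "(d + i) mod n = x (q + i)" for i
    unfolding q(3) x_def by (simp add: mod_add_left_eq add.assoc)
  have G2x: "x (q + i) \<in> G2" if "0 < i" "i \<le> r" for i
    using that m unfolding G2_def xqi by auto
  have dnS: "d \<notin> S" "c \<notin> S" using d c C unfolding D_def by auto
  have qr: "r < q" using G1x[of q] q dnS Seq by (cases "r < q") auto
  have qrn: "q + r < n"
  proof (rule ccontr)
    assume "\<not> q + r < n"
    then have "x (q + (n - q)) \<in> G2" using q by (intro G2x) auto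
    then show False using q xn dnS Seq by simp
  qed
  have notS: "x i \<notin> S" if "r < i \<and> i \<le> q \<or> q + r < i \<and> i \<le> n" for i
  proof
    assume "x i \<in> S"
    then consider j where "0 < j" "j \<le> r" "x i = x j" | j where "0 < j" "j \<le> r" "x i = x (q + j)"
      using Seq m unfolding G1_def G2_def xqi by (auto simp: x_def)
    then show False
    proof cases
      case 1
      then have "i = j" using xinj[of i j] that qr qrn by auto
      then show ?thesis using 1 that qr by auto
    next
      case 2
      then have "i = q + j" using xinj[of i "q + j"] that qr qrn by auto
      then show ?thesis using 2 that qr by auto
    qed
  qed
  have edge: "{x i, x (Suc i)} \<in> harary n k" for i
    using harary_cycle_edge[of 1 k n "c + i"] k unfolding x_def by auto
  have inD: "x i \<in> D" if "r + 1 \<le> i" "i \<le> q" for i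
    using that
  proof (induction i rule: dec_induct)
    case base
    then show ?case using c m unfolding x_def by auto
  next
    case (step i)
    then have "x (Suc i) \<notin> S" "x i \<in> D" using notS[of "Suc i"] by auto
    then show ?case using no'[of "x i" "x (Suc i)"] edge[of i] xlt unfolding D_def by auto
  qed
  have inC: "x i \<in> C" if "q + r + 1 \<le> i" "i \<le> n" for i
    using that
  proof (induction i rule: dec_induct)
    case base
    then show ?case using d m unfolding xqi by (auto simp: add.assoc)
  next
    case (step i)
    then have "x (Suc i) \<notin> S" "x i \<in> C" using notS[of "Suc i"] by auto
    then show ?case using no[of "x i" "x (Suc i)"] edge[of i] xlt unfolding D_def by auto
  qed
  define h where "h = (n + 1) div 2"
  have h: "2 * h \<le> n + 1" "n \<le> 2 * h" unfolding h_def by auto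
  have xe: "(x i + e) mod n = x (i + e)" for i e unfolding x_def by (simp add: mod_add_left_eq add.assoc)
  show False
  \<comment> \<open>Here the \<open>C\<close> block is the single index \<open>n\<close> and the
    offsets \<open>h\<close>, \<open>n - h\<close> differ, so they cannot both lead from one index
    to \<open>n\<close>. The antipodal edge is then taken at \<open>c\<close> instead.\<close>
  proof (cases "q + r + 1 = n \<and> odd n")
    case True
    obtain e where e: "e \<in> {h, n - h}" "{c, (c + e) mod n} \<in> harary n k"
      using harary_antipode[OF odd cdn(1)] h_def by blast
    have "odd n" using True by blast
    then have "2 * h = n + 1" unfolding h_def by simp
    then have "r + 1 \<le> e" "e \<le> q" using e True k2 k by auto
    then show False using inD[of e] no[OF c(1)] e(2) unfolding x_def by blast
  next
    case False
    \<comment> \<open>The least index in the \<open>D\<close> block from which both offsets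
      \<open>h\<close> and \<open>n - h\<close> land in the \<open>C\<close> block; whichever of
      them is an edge joins the two blocks.\<close>
    define i where "i = max (r + 1) (q + r + 1 + h - n)"
    have "q + r + 2 \<le> n \<or> 2 * h = n" using False qrn unfolding h_def by auto
    then have i: "r + 1 \<le> i" "i \<le> q" "i + h \<le> n" "q + r + 1 \<le> i + (n - h)"
      using qr qrn h k2 k(2) unfolding i_def by linarith+
    obtain e where e: "e \<in> {h, n - h}" "{x i, (x i + e) mod n} \<in> harary n k"
      using harary_antipode[OF odd xlt] h_def by blast
    have "q + r + 1 \<le> i + e" "i + e \<le> n" using e i h by auto
    then show False using inC[of "i + e"] inD[OF i(1,2)] no'[of "x i"] e(2) unfolding xe by blast
  qed
qed

section \<open>The lower bound\<close>

lemma complete_edges_altdef: "complete_edges V = {e. e \<subseteq> V \<and> card e = 2}"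
  unfolding complete_edges_def by (auto simp: card_2_iff)

lemma card_complete_edges: "finite V \<Longrightarrow> card (complete_edges V) = card V choose 2"
  unfolding complete_edges_altdef by (rule n_subsets)

lemma finite_complete_edges: "finite V \<Longrightarrow> finite (complete_edges V)"
  unfolding complete_edges_altdef by auto

text \<open>The edge \<open>uv\<close> of the complete graph will be the missing path. By
  \<open>menger\<close> only separators with at most \<open>k - 2\<close> vertices have to be
  refuted; such a set together with one terminal is still smaller than \<open>k\<close>, so
  \<open>harary_connected\<close> applies.\<close>

lemma harary_linked:
  assumes k: "2 \<le> k" "k < n" and uv: "u < n" "v < n" "u \<noteq> v"
  defines "W \<equiv> {..<n} - {u, v}"
  shows "\<exists>P. finite P \<and> card P = k - 1 \<and> disjoint_paths P \<and>
    (\<forall>p\<in>P. dpath {(x, y). x \<in> W \<and> y \<in> W \<and> {x, y} \<in> harary n k}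
      {x \<in> W. {u, x} \<in> harary n k} {x \<in> W. {x, v} \<in> harary n k} p)"
proof -
  define R where "R = {(x, y). x \<in> W \<and> y \<in> W \<and> {x, y} \<in> harary n k}"
  define A where "A = {x \<in> W. {u, x} \<in> harary n k}"
  define B where "B = {x \<in> W. {x, v} \<in> harary n k}"
  have fin: "finite W" unfolding W_def by auto
  have "finite R" by (rule finite_subset[of _ "W \<times> W"]) (use fin in \<open>auto simp: R_def\<close>)
  moreover have "finite A" "finite B" using fin unfolding A_def B_def by auto
  moreover have "k - 1 \<le> card S" if "finite S" and sep: "separates R A B S" for S
  proof (rule ccontr)
    assume "\<not> k - 1 \<le> card S"
    define S' where "S' = S \<inter> W"
    have "card S' \<le> card S" unfolding S'_def using \<open>finite S\<close> by (auto intro: card_mono)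
    then have cS: "card S' + 2 \<le> k" using \<open>\<not> k - 1 \<le> card S\<close> by linarith
    have finS': "finite S'" unfolding S'_def using fin by auto
    have "card W = n - 2" unfolding W_def using uv by (subst card_Diff_subset) auto
    then have "card S' < card W" using cS k by linarith
    then have "S' \<noteq> W" by auto
    then obtain z where z: "z \<in> W" "z \<notin> S" unfolding S'_def by blast
    define Q where "Q = R \<inter> (- S) \<times> (- S)"
    define C where "C = {x. (z, x) \<in> Q\<^sup>*}"
    have CW: "C \<subseteq> W - S"
    proof
      fix x assume "x \<in> C"
      then have "(z, x) \<in> Q\<^sup>*" unfolding C_def by auto
      then show "x \<in> W - S" by (induction rule: rtrancl_induct) (use z in \<open>auto simp: Q_def R_def\<close>)
    qed
    have stepC: "y \<in> C" if "x \<in> C" "y \<in> W" "y \<notin> S" "{x, y} \<in> harary n k" for x y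
    proof -
      have "(x, y) \<in> Q" using CW that unfolding Q_def R_def by auto
      then show ?thesis using that(1) unfolding C_def by (auto intro: rtrancl_into_rtrancl)
    qed
    \<comment> \<open>Without an edge to the terminal \<open>s\<close>, the component
      \<open>C\<close> would be closed after deletion of \<open>S'\<close> and \<open>t\<close>,
      hence equal to all the rest, which contains \<open>s\<close>.\<close>
    have meets: "\<exists>x\<in>C. {s, x} \<in> harary n k" if st: "{s, t} = {u, v}" "s \<noteq> t" for s t
    proof (rule ccontr)
      assume no: "\<not> (\<exists>x\<in>C. {s, x} \<in> harary n k)"
      have W': "W = {..<n} - {s, t}" unfolding W_def using st by simp
      have lt: "s < n" "t < n" using st uv by (auto simp: doubleton_eq_iff)
      have "C = {..<n} - insert t S'"
      proof (rule harary_connected[OF k])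
        show "insert t S' \<subseteq> {..<n}" using lt unfolding S'_def W_def by auto
        show "card (insert t S') < k" using cS finS' by (auto simp: card_insert_if)
        show "C \<subseteq> {..<n} - insert t S'" using CW unfolding S'_def W' by auto
        show "C \<noteq> {}" unfolding C_def by auto
        fix x y assume xy: "x \<in> C" "y \<in> {..<n} - insert t S'" "{x, y} \<in> harary n k"
        then have "y \<noteq> s" using no by (auto simp: insert_commute)
        then have "y \<in> W" "y \<notin> S" using xy unfolding W' S'_def by auto
        then show "y \<in> C" using stepC xy by blast
      qed
      moreover have "s \<notin> S'" unfolding S'_def W' by simp
      ultimately have "s \<in> C" using lt st by auto
      then show False using CW unfolding W' by auto
    qed
    obtain a where a: "a \<in> C" "a \<in> A" using meets[of u v] uv CW unfolding A_def by auto
    obtain b where b: "b \<in> C" "b \<in> B"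
      using meets[of v u] uv CW unfolding B_def by (auto simp: insert_commute)
    have "sym Q" unfolding Q_def R_def sym_def by (auto simp: insert_commute)
    then have "(a, z) \<in> Q\<^sup>*" using a sym_rtrancl[of Q] unfolding C_def sym_def by blast
    then have "(a, b) \<in> Q\<^sup>*" using b unfolding C_def by auto
    moreover have "a \<notin> S" "b \<notin> S" using a b CW by auto
    ultimately show False using sep a b unfolding separates_def Q_def by blast
  qed
  ultimately have "\<exists>P. finite P \<and> card P = k - 1 \<and> (\<forall>p\<in>P. dpath R A B p) \<and> disjoint_paths P"
    by (intro menger) auto
  then show ?thesis unfolding R_def A_def B_def by blast
qed

lemma successively_nth: "successively P q \<Longrightarrow> Suc i < length q \<Longrightarrow> P (q ! i) (q ! Suc i)"
proof (induction q arbitrary: i)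
  case (Cons a q)
  then show ?case by (cases i) (auto simp: successively_Cons hd_conv_nth split: if_splits)
qed simp

lemma is_path_extend:
  assumes p: "dpath {(x, y). x \<in> W \<and> y \<in> W \<and> {x, y} \<in> H} {x \<in> W. {u, x} \<in> H} {x \<in> W. {x, v} \<in> H} p"
    and W: "W = V - {u, v}" and uv: "u \<in> V" "v \<in> V" "u \<noteq> v"
  shows "is_path V H u v (u # p @ [v])" "interior (u # p @ [v]) = set p" "p \<noteq> []"
proof -
  show ne: "p \<noteq> []" using p unfolding dpath_def by auto
  have suc: "successively (\<lambda>x y. x \<in> W \<and> y \<in> W \<and> {x, y} \<in> H) p" using p unfolding dpath_def by auto
  have sub: "set p \<subseteq> W"
  proof
    fix x assume "x \<in> set p"
    then obtain i where i: "i < length p" "x = p ! i" by (auto simp: in_set_conv_nth)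
    show "x \<in> W"
    proof (cases i)
      case 0
      then show ?thesis using p i ne unfolding dpath_def by (auto simp: hd_conv_nth)
    next
      case (Suc j)
      then show ?thesis using successively_nth[OF suc, of j] i by simp
    qed
  qed
  have "successively (\<lambda>x y. {x, y} \<in> H) p" by (rule successively_mono[OF suc]) auto
  then have "successively (\<lambda>x y. {x, y} \<in> H) (u # p @ [v])"
    using p ne unfolding dpath_def by (auto simp: successively_Cons successively_append_iff)
  then show "is_path V H u v (u # p @ [v])"
    unfolding is_path_def using successively_nth[of _ "u # p @ [v]"] p sub uv unfolding dpath_def W by auto
  show "interior (u # p @ [v]) = set p" unfolding interior_def by simp
qed

lemma is_path_mono: "is_path V E u v p \<Longrightarrow> E \<subseteq> E' \<Longrightarrow> is_path V E' u v p"
  unfolding is_path_def by blast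

lemma harary_mono_k_connected:
  assumes k: "2 \<le> k" "k < n" and c: "\<And>e. e \<in> harary n k \<Longrightarrow> c e = col"
  shows "mono_k_connected k (Kn_V n) (Kn_E n) c"
  unfolding mono_k_connected_def
proof (intro ballI impI)
  fix u v assume "u \<in> Kn_V n" "v \<in> Kn_V n" "u \<noteq> v"
  then have uv: "u < n" "v < n" "u \<noteq> v" unfolding Kn_V_def by auto
  define W where "W = {..<n} - {u, v}"
  obtain P where P: "finite P" "card P = k - 1" "disjoint_paths P"
    and dp: "\<And>p. p \<in> P \<Longrightarrow> dpath {(x, y). x \<in> W \<and> y \<in> W \<and> {x, y} \<in> harary n k}
      {x \<in> W. {u, x} \<in> harary n k} {x \<in> W. {x, v} \<in> harary n k} p"
    using harary_linked[OF k uv] unfolding W_def by blast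
  have W: "W = Kn_V n - {u, v}" unfolding W_def Kn_V_def by auto
  have uvK: "u \<in> Kn_V n" "v \<in> Kn_V n" using uv unfolding Kn_V_def by auto
  define f where "f p = u # p @ [v]" for p
  note ext = is_path_extend[OF dp W uvK uv(3), folded f_def]
  \<comment> \<open>\<open>[u, v]\<close> may lie outside the Harary graph, but a single edge is
    monochromatic in any colour.\<close>
  define P' where "P' = insert [u, v] (f ` P)"
  have "inj f" unfolding f_def inj_def by auto
  then have "card (f ` P) = k - 1" using P by (simp add: card_image inj_on_def inj_def)
  moreover have "[u, v] \<notin> f ` P" using ext(3) unfolding f_def by auto
  ultimately have card: "card P' = k" "finite P'" using P k unfolding P'_def by auto
  have good: "is_path (Kn_V n) (Kn_E n) u v p \<and> monochromatic c p" if "p \<in> P'" for p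
  proof (cases "p = [u, v]")
    case True
    moreover have "{u, v} \<in> Kn_E n" using uv unfolding Kn_E_def complete_edges_altdef by auto
    ultimately show ?thesis using uv uvK unfolding is_path_def monochromatic_def by auto
  next
    case False
    then have path: "is_path (Kn_V n) (harary n k) u v p" using that ext(1) unfolding P'_def by auto
    then have "monochromatic c p"
      unfolding monochromatic_def is_path_def using c by (intro exI[of _ col]) simp
    moreover have "harary n k \<subseteq> Kn_E n" using harary_subset[OF k(2)] unfolding Kn_E_def .
    ultimately show ?thesis using is_path_mono[OF path] by blast
  qed
  have disj: "interior p \<inter> interior q = {}" if "p \<in> P'" "q \<in> P'" "p \<noteq> q" for p q
  proof (cases "p = [u, v] \<or> q = [u, v]")
    case True
    then show ?thesis by (auto simp: interior_def)
  next
    case False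
    then obtain p' q' where "p = f p'" "p' \<in> P" "q = f q'" "q' \<in> P" using \<open>p \<in> P'\<close> \<open>q \<in> P'\<close> unfolding P'_def by blast
    then show ?thesis using ext(2) P(3) \<open>p \<noteq> q\<close> unfolding disjoint_paths_def by metis
  qed
  show "\<exists>P. finite P \<and> card P = k \<and>
      (\<forall>p\<in>P. is_path (Kn_V n) (Kn_E n) u v p \<and> monochromatic c p) \<and>
      (\<forall>p\<in>P. \<forall>q\<in>P. p \<noteq> q \<longrightarrow> interior p \<inter> interior q = {})"
    using card good disj by blast
qed

text \<open>\<open>Max\<close> is informative only on a finite nonempty set: the counts are at most
  \<open>card E\<close>, and \<open>c\<close> provides one of them.\<close>

lemma mc_bounds:
  assumes "finite E" "mono_k_connected k V E c"
  shows "card (c ` E) \<le> mc k V E" and "\<exists>c'. mono_k_connected k V E c' \<and> mc k V E = card (c' ` E)"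
proof -
  define M where "M = {card (c ` E) | c. mono_k_connected k V E c}"
  have "M \<subseteq> {..card E}" using assms(1) unfolding M_def by (auto intro: card_image_le)
  then have fin: "finite M" by (rule finite_subset) simp
  have mem: "card (c ` E) \<in> M" using assms unfolding M_def by blast
  show "card (c ` E) \<le> mc k V E" unfolding mc_def M_def[symmetric] using fin mem by simp
  have "Max M \<in> M" using fin mem by (intro Max_in) auto
  then show "\<exists>c'. mono_k_connected k V E c' \<and> mc k V E = card (c' ` E)"
    unfolding mc_def M_def[symmetric] unfolding M_def by auto
qed

lemma mc_Kn_lower:
  assumes k: "2 \<le> k" "k < n"
  shows "(n choose 2) + 1 \<le> mc k (Kn_V n) (Kn_E n) + card (harary n k)"
    and "\<exists>c. mono_k_connected k (Kn_V n) (Kn_E n) c"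
proof -
  have fin: "finite (Kn_E n)" unfolding Kn_E_def by (simp add: finite_complete_edges)
  obtain g :: "nat set \<Rightarrow> nat" where g: "inj_on g (Kn_E n)" using finite_imp_inj_to_nat_seg[OF fin] by blast
  define c where "c e = (if e \<in> harary n k then 0 else Suc (g e))" for e
  have con: "mono_k_connected k (Kn_V n) (Kn_E n) c"
    by (rule harary_mono_k_connected[OF k]) (auto simp: c_def)
  then show "\<exists>c. mono_k_connected k (Kn_V n) (Kn_E n) c" by blast
  have sub: "harary n k \<subseteq> Kn_E n" using harary_subset[OF k(2)] unfolding Kn_E_def .
  have "{0 mod n, (0 + 1) mod n} \<in> harary n k" by (rule harary_cycle_edge) (use k in auto)
  then obtain e where e: "e \<in> harary n k" by blast
  have "inj_on c (Kn_E n - harary n k)" using g unfolding c_def inj_on_def by auto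
  then have "card (c ` (Kn_E n - harary n k)) = card (Kn_E n) - card (harary n k)"
    using sub fin by (simp add: card_image card_Diff_subset finite_subset)
  moreover have "0 \<notin> c ` (Kn_E n - harary n k)" unfolding c_def by auto
  moreover have "insert 0 (c ` (Kn_E n - harary n k)) \<subseteq> c ` Kn_E n"
    using e sub unfolding c_def by force
  ultimately have "card (Kn_E n) - card (harary n k) + 1 \<le> card (c ` Kn_E n)"
    using card_mono[of "c ` Kn_E n" "insert 0 (c ` (Kn_E n - harary n k))"] fin by simp
  also have "\<dots> \<le> mc k (Kn_V n) (Kn_E n)" by (rule mc_bounds[OF fin con])
  finally show "(n choose 2) + 1 \<le> mc k (Kn_V n) (Kn_E n) + card (harary n k)"
    using card_complete_edges[of "{0..<n}"] unfolding Kn_E_def by simp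
qed

section \<open>Unused edges in a monochromatically linked colouring\<close>

lemma bfs_layers:
  assumes "\<And>v. v \<in> X \<Longrightarrow> \<exists>r0\<in>R. (r0, v) \<in> r\<^sup>*"
  obtains dist :: "'a \<Rightarrow> nat" where "\<And>v. v \<in> X - R \<Longrightarrow> \<exists>u. (u, v) \<in> r \<and> dist u < dist v"
proof -
  define Q where "Q v m \<longleftrightarrow> (\<exists>r0\<in>R. (r0, v) \<in> r ^^ m)" for v m
  have "\<exists>u. (u, v) \<in> r \<and> (LEAST m. Q u m) < (LEAST m. Q v m)" if v: "v \<in> X - R" for v
  proof -
    have "\<exists>m. Q v m" using assms[of v] v rtrancl_imp_relpow unfolding Q_def by fast
    then have Qv: "Q v (LEAST m. Q v m)" by (rule LeastI_ex)
    then obtain r0 where r0: "r0 \<in> R" "(r0, v) \<in> r ^^ (LEAST m. Q v m)" unfolding Q_def by blast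
    show ?thesis
    proof (cases "LEAST m. Q v m")
      case 0
      then show ?thesis using r0 v by auto
    next
      case (Suc m)
      then obtain u where u: "(r0, u) \<in> r ^^ m" "(u, v) \<in> r" using r0 by auto
      then have "Q u m" using r0 unfolding Q_def by blast
      then have "(LEAST m. Q u m) \<le> m" by (rule Least_le)
      then show ?thesis using u Suc by auto
    qed
  qed
  then show ?thesis using that[of "\<lambda>v. LEAST m. Q v m"] by blast
qed

text \<open>
  In the following locale \<open>hues\<close> are the colours with at least two edges, \<open>nbrs h\<close> and \<open>hdeg h\<close>
  are neighbourhood and degree within colour \<open>h\<close>, whereas \<open>nbhd\<close> collects the neighbours in all
  \<open>hues\<close>. Of the edges of hue \<open>h\<close> at \<open>v\<close>, at least \<open>waste h v\<close> are useless for every target: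
  a path with at least two edges cannot pass through a leaf, and only the direct edge enters a leaf
  adjacent to \<open>v\<close>.

  A \<open>linkage v u U I\<close> records what is needed of \<open>k - 1\<close> disjoint monochromatic paths from \<open>v\<close>
  to \<open>u\<close>: the set \<open>U\<close> of their second vertices, and the interior \<open>I y\<close> of the path through
  \<open>y \<in> U\<close>.
\<close>

locale colouring =
  fixes V :: "'a set" and f :: "'a set \<Rightarrow> 'h" and k :: nat
begin

definition edges_of :: "'h \<Rightarrow> 'a set set" where
  "edges_of h = {e \<in> complete_edges V. f e = h}"

definition hues :: "'h set" where
  "hues = {h. 2 \<le> card (edges_of h)}"

definition nbrs :: "'h \<Rightarrow> 'a \<Rightarrow> 'a set" where
  "nbrs h v = {y. v \<in> V \<and> y \<in> V \<and> y \<noteq> v \<and> f {v, y} = h}"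

definition verts_of :: "'h \<Rightarrow> 'a set" where
  "verts_of h = {v. nbrs h v \<noteq> {}}"

definition nbhd :: "'a \<Rightarrow> 'a set" where
  "nbhd v = (\<Union>h\<in>hues. nbrs h v)"

definition hdeg :: "'h \<Rightarrow> 'a \<Rightarrow> nat" where
  "hdeg h v = card (nbrs h v)"

definition leaves_at :: "'h \<Rightarrow> 'a \<Rightarrow> 'a set" where
  "leaves_at h v = {y \<in> nbrs h v. hdeg h y = 1}"

definition waste :: "'h \<Rightarrow> 'a \<Rightarrow> nat" where
  "waste h v = min (card (leaves_at h v)) (hdeg h v - 1)"

definition excess :: "'a \<Rightarrow> int" where
  "excess v = int (card (nbhd v)) - int k"

definition cost :: nat where
  "cost = (\<Sum>h\<in>hues. card (edges_of h) - 1)"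

text \<open>Paths are not kept as lists. The last three clauses retain what is used of them: a path
  arrives at \<open>u\<close> within its hue, its inner vertices have two neighbours on it, and it
  crosses the border of every set \<open>X\<close> containing \<open>v\<close> but not
  \<open>u\<close>.\<close>

definition linkage :: "'a \<Rightarrow> 'a \<Rightarrow> 'a set \<Rightarrow> ('a \<Rightarrow> 'a set) \<Rightarrow> bool" where
  "linkage v u U I \<longleftrightarrow> U \<subseteq> V \<and> k - 1 \<le> card U \<and>
     (\<forall>y\<in>U. y \<in> I y \<and> I y \<subseteq> V - {u, v}) \<and>
     (\<forall>y\<in>U. \<forall>z\<in>U. y \<noteq> z \<longrightarrow> I y \<inter> I z = {}) \<and>
     (\<forall>y\<in>U. I y \<inter> nbrs (f {v, y}) u \<noteq> {}) \<and>
     (\<forall>y\<in>U. \<forall>x\<in>I y. 2 \<le> card (nbrs (f {v, y}) x \<inter> insert u (insert v (I y)))) \<and>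
     (\<forall>y\<in>U. \<forall>X. v \<in> X \<longrightarrow> u \<notin> X \<longrightarrow> (\<exists>z\<in>X \<inter> insert v (I y). nbrs (f {v, y}) z \<inter> insert u (I y) - X \<noteq> {}))"

end

locale linked_colouring = colouring V f k for V :: "'a set" and f :: "'a set \<Rightarrow> 'h" and k +
  assumes finV: "finite V" and k2: "2 \<le> k" and kV: "k < card V"
    and connected: "h \<in> hues \<Longrightarrow> x \<in> X \<Longrightarrow> x \<in> verts_of h \<Longrightarrow> (\<And>z. z \<in> X \<Longrightarrow> nbrs h z \<subseteq> X) \<Longrightarrow> verts_of h \<subseteq> X"
    and links: "v \<in> V \<Longrightarrow> u \<in> V \<Longrightarrow> u \<noteq> v \<Longrightarrow> \<exists>U I. linkage v u U I"
begin

lemma nbrs_sym: "y \<in> nbrs h v \<longleftrightarrow> v \<in> nbrs h y"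
  unfolding nbrs_def by (auto simp: insert_commute)

lemma nbrs_subset: "nbrs h v \<subseteq> V - {v}"
  unfolding nbrs_def by auto

lemma finite_nbrs [simp]: "finite (nbrs h v)"
  using nbrs_subset finV by (meson finite_Diff finite_subset)

lemma nbrs_hue_unique: "y \<in> nbrs h v \<Longrightarrow> y \<in> nbrs h' v \<Longrightarrow> h = h'"
  unfolding nbrs_def by auto

lemma verts_of_subset: "verts_of h \<subseteq> V"
  unfolding verts_of_def nbrs_def by auto

lemma finite_verts_of [simp]: "finite (verts_of h)"
  using verts_of_subset finV finite_subset by blast

lemma nbrs_verts_of: "y \<in> nbrs h v \<Longrightarrow> y \<in> verts_of h" "y \<in> nbrs h v \<Longrightarrow> v \<in> verts_of h"
  using nbrs_sym[of y h v] unfolding verts_of_def by auto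

lemma hdeg_pos_iff: "0 < hdeg h v \<longleftrightarrow> v \<in> verts_of h"
  unfolding hdeg_def verts_of_def by (simp add: card_gt_0_iff)

lemma finite_edges: "finite (complete_edges V)"
proof -
  have "complete_edges V \<subseteq> Pow V" unfolding complete_edges_def by auto
  then show ?thesis using finV finite_subset by auto
qed

lemma finite_edges_of [simp]: "finite (edges_of h)"
  unfolding edges_of_def using finite_edges by auto

lemma finite_hues [simp]: "finite hues"
proof -
  have "h \<in> f ` complete_edges V" if "h \<in> hues" for h
  proof -
    have "edges_of h \<noteq> {}" using that unfolding hues_def by auto
    then show ?thesis unfolding edges_of_def by auto
  qed
  then have "hues \<subseteq> f ` complete_edges V" by blast
  then show ?thesis using finite_edges finite_subset by auto
qed

lemma edges_of_doubleton: "v \<in> V \<Longrightarrow> {v, y} \<in> edges_of h \<longleftrightarrow> y \<in> nbrs h v"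
  unfolding edges_of_def nbrs_def complete_edges_def by (auto simp: doubleton_eq_iff)

lemma edges_of_elem: "e \<in> edges_of h \<Longrightarrow> \<exists>x y. e = {x, y} \<and> x \<in> V \<and> y \<in> nbrs h x"
  unfolding edges_of_def nbrs_def complete_edges_def by blast

lemma hdeg_eq_card_edges: "v \<in> V \<Longrightarrow> hdeg h v = card {e \<in> edges_of h. v \<in> e}"
proof -
  assume v: "v \<in> V"
  have "{e \<in> edges_of h. v \<in> e} = (\<lambda>y. {v, y}) ` nbrs h v"
  proof (intro equalityI subsetI)
    fix e assume e: "e \<in> {e \<in> edges_of h. v \<in> e}"
    then obtain x y where xy: "e = {x, y}" "x \<in> V" "y \<in> nbrs h x" using edges_of_elem by blast
    then have "v = x \<or> v = y" using e by auto
    then show "e \<in> (\<lambda>y. {v, y}) ` nbrs h v" using xy nbrs_sym[of y h x] by (auto simp: insert_commute)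
  next
    fix e assume "e \<in> (\<lambda>y. {v, y}) ` nbrs h v"
    then show "e \<in> {e \<in> edges_of h. v \<in> e}" using edges_of_doubleton[OF v] by auto
  qed
  moreover have "inj_on (\<lambda>y. {v, y}) (nbrs h v)" by (auto simp: inj_on_def doubleton_eq_iff)
  ultimately show ?thesis unfolding hdeg_def by (simp add: card_image)
qed

lemma handshake: "(\<Sum>v\<in>V. hdeg h v) = 2 * card (edges_of h)"
proof -
  have "(\<Sum>v\<in>V. card {e \<in> edges_of h. v \<in> e}) = 2 * card (edges_of h)"
  proof (rule sum_multicount[OF finV finite_edges_of], intro ballI)
    fix e assume e: "e \<in> edges_of h"
    then have "{v \<in> V. v \<in> e} = e" unfolding edges_of_def complete_edges_def by auto
    moreover have "card e = 2" using e unfolding edges_of_def complete_edges_def by auto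
    ultimately show "card {v \<in> V. v \<in> e} = 2" by simp
  qed
  then show ?thesis using hdeg_eq_card_edges by simp
qed

lemma handshake_verts_of: "(\<Sum>v\<in>verts_of h. hdeg h v) = 2 * card (edges_of h)"
proof -
  have "(\<Sum>v\<in>verts_of h. hdeg h v) = (\<Sum>v\<in>V. hdeg h v)"
    by (rule sum.mono_neutral_left) (use finV verts_of_subset hdeg_pos_iff in auto)
  then show ?thesis using handshake by simp
qed

lemma hues_if_hdeg: "2 \<le> hdeg h v \<Longrightarrow> h \<in> hues"
proof -
  assume d: "2 \<le> hdeg h v"
  then have "v \<in> V" using hdeg_pos_iff[of h v] verts_of_subset by auto
  then have "hdeg h v \<le> card (edges_of h)" using hdeg_eq_card_edges by (auto intro: card_mono)
  then show ?thesis using d unfolding hues_def by auto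
qed

lemma nbrs_eq_singleton: "hdeg h y = 1 \<Longrightarrow> x \<in> nbrs h y \<Longrightarrow> nbrs h y = {x}"
  unfolding hdeg_def by (auto simp: card_1_singleton_iff)

text \<open>With all degrees one, a connected hue would be a single edge.\<close>

lemma exists_hub: "h \<in> hues \<Longrightarrow> \<exists>v. 2 \<le> hdeg h v"
proof (rule ccontr)
  assume h: "h \<in> hues" and no: "\<not> (\<exists>v. 2 \<le> hdeg h v)"
  have "edges_of h \<noteq> {}" using h unfolding hues_def by auto
  then obtain x y where xy: "x \<in> V" "y \<in> nbrs h x" using edges_of_elem by blast
  have one: "hdeg h z = 1" if "z \<in> verts_of h" for z
    using no that hdeg_pos_iff[of h z] by (metis One_nat_def Suc_leI le_antisym not_less_eq_eq numeral_2_eq_2)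
  have nx: "nbrs h x = {y}" "nbrs h y = {x}"
    using one nbrs_verts_of[OF xy(2)] xy nbrs_sym[of y h x] nbrs_eq_singleton by auto
  have "verts_of h \<subseteq> {x, y}"
    by (rule connected[OF h, of x]) (use nbrs_verts_of[OF xy(2)] nx in auto)
  then have "card (verts_of h) \<le> card {x, y}" by (intro card_mono) auto
  also have "card {x, y} \<le> 2" by (simp add: card_insert_if)
  finally have "card (verts_of h) \<le> 2" .
  moreover have "(\<Sum>v\<in>verts_of h. hdeg h v) = card (verts_of h)" using one by simp
  ultimately show False using handshake_verts_of[of h] h unfolding hues_def by auto
qed

lemma card_verts_of_ge: "h \<in> hues \<Longrightarrow> 3 \<le> card (verts_of h)"
proof -
  assume "h \<in> hues"
  then obtain v where v: "2 \<le> hdeg h v" using exists_hub by blast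
  then have "insert v (nbrs h v) \<subseteq> verts_of h" using nbrs_verts_of hdeg_pos_iff[of h v] by auto
  then have "card (insert v (nbrs h v)) \<le> card (verts_of h)" by (intro card_mono) auto
  moreover have "v \<notin> nbrs h v" using nbrs_subset by auto
  ultimately show ?thesis using v unfolding hdeg_def by simp
qed

lemma leaf_support: "h \<in> hues \<Longrightarrow> y \<in> leaves_at h v \<Longrightarrow> 2 \<le> hdeg h v"
proof (rule ccontr)
  assume h: "h \<in> hues" and y: "y \<in> leaves_at h v" and "\<not> 2 \<le> hdeg h v"
  then have y': "y \<in> nbrs h v" "hdeg h y = 1" "v \<in> nbrs h y" using nbrs_sym[of y h v] unfolding leaves_at_def by auto
  then have "hdeg h v = 1" using \<open>\<not> 2 \<le> hdeg h v\<close> hdeg_pos_iff[of h v] nbrs_verts_of[OF y'(1)] by linarith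
  then have "nbrs h v = {y}" "nbrs h y = {v}" using nbrs_eq_singleton y' by auto
  then have "verts_of h \<subseteq> {v, y}"
    by (intro connected[OF h, of v]) (use nbrs_verts_of[OF y'(1)] in auto)
  then have "card (verts_of h) \<le> card {v, y}" by (intro card_mono) auto
  also have "card {v, y} \<le> 2" by (simp add: card_insert_if)
  finally show False using card_verts_of_ge[OF h] by simp
qed

lemma waste_pos: "h \<in> hues \<Longrightarrow> y \<in> leaves_at h v \<Longrightarrow> 1 \<le> waste h v"
proof -
  assume "h \<in> hues" "y \<in> leaves_at h v"
  moreover have "finite (leaves_at h v)" unfolding leaves_at_def by auto
  ultimately have "0 < card (leaves_at h v)" "2 \<le> hdeg h v" using leaf_support by (auto simp: card_gt_0_iff)
  then show ?thesis unfolding waste_def by simp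
qed

lemma waste_le: "waste h v \<le> hdeg h v - 1"
  unfolding waste_def by simp

lemma nbhd_subset: "nbhd v \<subseteq> V - {v}"
  unfolding nbhd_def using nbrs_subset by blast

lemma finite_nbhd [simp]: "finite (nbhd v)"
  unfolding nbhd_def by auto

lemma card_nbhd: "card (nbhd v) = (\<Sum>h\<in>hues. hdeg h v)"
  unfolding nbhd_def hdeg_def by (rule card_UN_disjoint) (use nbrs_hue_unique in auto)

lemma card_nbhd_less: "v \<in> V \<Longrightarrow> card (nbhd v) \<le> card V - 1"
  using card_mono[OF _ nbhd_subset[of v]] finV by simp

lemma linkageD:
  assumes "linkage v u U I" "y \<in> U"
  shows "y \<in> I y" "I y \<subseteq> V - {u, v}" "I y \<inter> nbrs (f {v, y}) u \<noteq> {}"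
    "2 \<le> hdeg (f {v, y}) y" "f {v, y} \<in> hues" "u \<in> verts_of (f {v, y})"
    "x \<in> I y \<Longrightarrow> 2 \<le> card (nbrs (f {v, y}) x \<inter> insert u (insert v (I y)))"
    "v \<in> X \<Longrightarrow> u \<notin> X \<Longrightarrow> \<exists>z\<in>X \<inter> insert v (I y). nbrs (f {v, y}) z \<inter> insert u (I y) - X \<noteq> {}"
proof -
  have 2: "2 \<le> card (nbrs (f {v, y}) x \<inter> insert u (insert v (I y)))" if "x \<in> I y" for x
    using assms that unfolding linkage_def by auto
  show "x \<in> I y \<Longrightarrow> 2 \<le> card (nbrs (f {v, y}) x \<inter> insert u (insert v (I y)))" by (rule 2)
  show "v \<in> X \<Longrightarrow> u \<notin> X \<Longrightarrow> \<exists>z\<in>X \<inter> insert v (I y). nbrs (f {v, y}) z \<inter> insert u (I y) - X \<noteq> {}"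
    using assms unfolding linkage_def by blast
  have yI: "y \<in> I y" using assms unfolding linkage_def by auto
  have "card (nbrs (f {v, y}) y \<inter> insert u (insert v (I y))) \<le> hdeg (f {v, y}) y"
    unfolding hdeg_def by (intro card_mono) auto
  then show "2 \<le> hdeg (f {v, y}) y" using 2[OF yI] by linarith
  then show "f {v, y} \<in> hues" by (rule hues_if_hdeg)
  have "nbrs (f {v, y}) u \<noteq> {}" using assms unfolding linkage_def by auto
  then show "u \<in> verts_of (f {v, y})" unfolding verts_of_def by simp
  show "y \<in> I y" "I y \<subseteq> V - {u, v}" "I y \<inter> nbrs (f {v, y}) u \<noteq> {}"
    using assms unfolding linkage_def by auto
qed

lemma linkage_used:
  assumes "linkage v u U I" "v \<in> V" "y \<in> U"
  shows "y \<in> nbrs (f {v, y}) v" "y \<in> nbhd v" "y \<noteq> u"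
  using linkageD[OF assms(1,3)] assms(2) unfolding nbhd_def nbrs_def by auto

lemma linkage_card: "linkage v u U I \<Longrightarrow> k - 1 \<le> card U" "linkage v u U I \<Longrightarrow> finite U"
  unfolding linkage_def using finite_subset[OF _ finV, of U] by blast+

lemma linkage_disjoint:
  "linkage v u U I \<Longrightarrow> y \<in> U \<Longrightarrow> z \<in> U \<Longrightarrow> x \<in> I y \<Longrightarrow> x \<in> I z \<Longrightarrow> y = z"
  unfolding linkage_def by (metis IntI empty_iff)

lemma unused:
  assumes L: "linkage v u U I" "v \<in> V" and Z: "Z \<subseteq> nbhd v - {u} - U"
  shows "int (card Z) \<le> excess v + (if u \<in> nbhd v then 0 else 1)"
proof -
  have "U \<subseteq> nbhd v - {u}" using linkage_used[OF L] by auto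
  then have "Z \<union> U \<subseteq> nbhd v - {u}" "Z \<inter> U = {}" using Z by auto
  then have "card Z + card U \<le> card (nbhd v - {u})"
    using card_mono[of "nbhd v - {u}" "Z \<union> U"] linkage_card(2)[OF L(1)] finite_subset[OF Z]
    by (subst card_Un_disjoint[symmetric]) auto
  moreover have "card (nbhd v - {u}) = card (nbhd v) - (if u \<in> nbhd v then 1 else 0)" by simp
  moreover have "u \<in> nbhd v \<Longrightarrow> 0 < card (nbhd v)" by (auto simp: card_gt_0_iff)
  ultimately show ?thesis using linkage_card(1)[OF L(1)] k2 unfolding excess_def by (auto split: if_splits)
qed

text \<open>Disjoint paths of hue \<open>h\<close> arrive at \<open>u\<close> through distinct
  edges, none of which is the direct one.\<close>

lemma used_le:
  assumes L: "linkage v u U I"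
  shows "card {y \<in> U. f {v, y} = h} \<le> card (nbrs h u - {v})"
proof -
  have "\<exists>x. x \<in> I y \<inter> nbrs h u" if "y \<in> {y \<in> U. f {v, y} = h}" for y
    using linkageD(3)[OF L, of y] that by auto
  then obtain g where g: "\<And>y. y \<in> {y \<in> U. f {v, y} = h} \<Longrightarrow> g y \<in> I y \<inter> nbrs h u" by metis
  have "inj_on g {y \<in> U. f {v, y} = h}"
  proof (rule inj_onI)
    fix y z assume yz: "y \<in> {y \<in> U. f {v, y} = h}" "z \<in> {y \<in> U. f {v, y} = h}" "g y = g z"
    then show "y = z" using g[OF yz(1)] g[OF yz(2)] linkage_disjoint[OF L, of y z "g y"] by auto
  qed
  moreover have "g ` {y \<in> U. f {v, y} = h} \<subseteq> nbrs h u - {v}"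
    using g linkageD(2)[OF L] by fastforce
  ultimately show ?thesis by (intro card_inj_on_le) auto
qed

lemma excess_ge:
  assumes vu: "v \<in> V" "u \<in> V" "u \<noteq> v" and J: "J \<subseteq> hues" "\<And>h. h \<in> J \<Longrightarrow> u \<notin> verts_of h"
  shows "int ((\<Sum>h\<in>J. hdeg h v) + (\<Sum>h\<in>hues - J. waste h v)) \<le> excess v + (if u \<in> nbhd v then 0 else 1)"
proof -
  obtain U I where L: "linkage v u U I" using links vu by blast
  \<comment> \<open>If \<open>u\<close> is itself a leaf at \<open>v\<close>, its only edge of hue
    \<open>h\<close> is the direct one, so all other edges of \<open>h\<close> at \<open>v\<close>
    are useless. The minimum in \<open>waste\<close> makes one number serve for this case and for
    the case of other leaves.\<close>
  define Z where "Z h = (if h \<in> J then nbrs h v else if u \<in> leaves_at h v then nbrs h v - {u} else leaves_at h v)" for h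
  have Znb: "Z h \<subseteq> nbrs h v" for h unfolding Z_def leaves_at_def by auto
  have unusedZ: "Z h \<subseteq> nbhd v - {u} - U" if h: "h \<in> hues" for h
  proof
    fix y assume y: "y \<in> Z h"
    then have yn: "y \<in> nbrs h v" "y \<in> nbhd v" using Znb h unfolding nbhd_def by blast+
    then have hy: "f {v, y} = h" unfolding nbrs_def by auto
    have "y \<noteq> u" using y yn J(2) nbrs_verts_of unfolding Z_def by (auto split: if_splits)
    moreover have "y \<notin> U"
    proof
      assume yU: "y \<in> U"
      note D = linkageD[OF L yU, unfolded hy]
      have "h \<notin> J" using D(6) J(2) by auto
      show False
      proof (cases "u \<in> leaves_at h v")
        case True
        then have "nbrs h u = {v}" using nbrs_eq_singleton[of h u v] nbrs_sym[of u h v] unfolding leaves_at_def by auto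
        then show ?thesis using D(2,3) by auto
      next
        case False
        then show ?thesis using y D(4) \<open>h \<notin> J\<close> unfolding Z_def leaves_at_def by auto
      qed
    qed
    ultimately show "y \<in> nbhd v - {u} - U" using yn by auto
  qed
  have "(\<Sum>h\<in>J. hdeg h v) + (\<Sum>h\<in>hues - J. waste h v) = (\<Sum>h\<in>hues. if h \<in> J then hdeg h v else waste h v)"
    using J(1) sum.union_disjoint[of J "hues - J" "\<lambda>h. if h \<in> J then hdeg h v else waste h v"]
      finite_subset[OF J(1)] by (simp add: Un_absorb1 Un_Diff_cancel)
  also have "\<dots> \<le> (\<Sum>h\<in>hues. card (Z h))"
    by (rule sum_mono) (auto simp: Z_def hdeg_def waste_def leaves_at_def)
  also have "\<dots> = card (\<Union>h\<in>hues. Z h)"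
  proof (rule card_UN_disjoint[symmetric])
    show "\<forall>h\<in>hues. finite (Z h)" using finite_subset[OF Znb] by simp
    show "\<forall>h\<in>hues. \<forall>h'\<in>hues. h \<noteq> h' \<longrightarrow> Z h \<inter> Z h' = {}" using Znb nbrs_hue_unique by blast
  qed simp
  finally have "int ((\<Sum>h\<in>J. hdeg h v) + (\<Sum>h\<in>hues - J. waste h v)) \<le> int (card (\<Union>h\<in>hues. Z h))" by linarith
  also have "\<dots> \<le> excess v + (if u \<in> nbhd v then 0 else 1)"
    by (rule unused[OF L vu(1)]) (use unusedZ in blast)
  finally show ?thesis .
qed

lemma nbhd_nonempty: "v \<in> V \<Longrightarrow> nbhd v \<noteq> {}"
proof -
  assume v: "v \<in> V"
  have "\<not> V \<subseteq> {v}" using kV k2 card_mono[of "{v}" V] by auto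
  then obtain u where u: "u \<in> V" "u \<noteq> v" by auto
  then obtain U I where L: "linkage v u U I" using links v by blast
  then have "0 < card U" using linkage_card(1)[OF L] k2 by linarith
  then obtain y where "y \<in> U" by (auto simp: card_gt_0_iff)
  then show ?thesis using linkage_used[OF L v] by auto
qed

lemma excess_ge_nbhd:
  assumes "v \<in> V" "u \<in> nbhd v" "J \<subseteq> hues" "\<And>h. h \<in> J \<Longrightarrow> u \<notin> verts_of h"
  shows "int ((\<Sum>h\<in>J. hdeg h v) + (\<Sum>h\<in>hues - J. waste h v)) \<le> excess v"
  using excess_ge[of v u J] assms nbhd_subset[of v] by auto

lemma excess_ge_waste: "v \<in> V \<Longrightarrow> int (\<Sum>h\<in>hues. waste h v) \<le> excess v"
  using excess_ge_nbhd[of v _ "{}"] nbhd_nonempty[of v] by auto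

lemma excess_nonneg: "v \<in> V \<Longrightarrow> 0 \<le> excess v"
  using excess_ge_waste[of v] by linarith

section \<open>Clusters of missed hues and the lower bound for the cost\<close>

definition link :: "'h set \<Rightarrow> ('a \<times> 'a) set" where
  "link J = {(x, y). \<exists>h\<in>J. y \<in> nbrs h x}"

lemma sym_link: "sym (link J)"
  unfolding link_def sym_def using nbrs_sym by blast

lemma link_rtrancl_sym: "(x, y) \<in> (link J)\<^sup>* \<Longrightarrow> (y, x) \<in> (link J)\<^sup>*"
  using sym_rtrancl[OF sym_link] by (meson symE)

text \<open>
  In the order of distance from \<open>R\<close>, every reachable vertex outside \<open>R\<close> is a non-first vertex of
  some hue.
\<close>

lemma card_reachable:
  assumes J: "J \<subseteq> hues" and R: "\<And>v. v \<in> (\<Union>h\<in>J. verts_of h) \<Longrightarrow> \<exists>r\<in>R. (r, v) \<in> (link J)\<^sup>*"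
  shows "card ((\<Union>h\<in>J. verts_of h) - R) \<le> (\<Sum>h\<in>J. card (verts_of h) - 1)"
proof -
  obtain dist :: "'a \<Rightarrow> nat" where dist: "\<And>v. v \<in> (\<Union>h\<in>J. verts_of h) - R \<Longrightarrow> \<exists>u. (u, v) \<in> link J \<and> dist u < dist v"
    using bfs_layers[of "\<Union>h\<in>J. verts_of h" R "link J"] R by blast
  have "\<exists>x. x \<in> verts_of h \<and> (\<forall>y\<in>verts_of h. dist x \<le> dist y)" if "h \<in> J" for h
  proof -
    have "verts_of h \<noteq> {}" using card_verts_of_ge[of h] that J by auto
    then show ?thesis using ex_has_least_nat[of "\<lambda>x. x \<in> verts_of h" _ dist] by blast
  qed
  then obtain r where r: "\<And>h. h \<in> J \<Longrightarrow> r h \<in> verts_of h \<and> (\<forall>y\<in>verts_of h. dist (r h) \<le> dist y)" by metis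
  have "\<exists>h. h \<in> J \<and> v \<in> verts_of h - {r h}" if v: "v \<in> (\<Union>h\<in>J. verts_of h) - R" for v
  proof -
    obtain u where u: "(u, v) \<in> link J" "dist u < dist v" using dist[OF v] by blast
    then obtain h where h: "h \<in> J" "v \<in> nbrs h u" unfolding link_def by blast
    then show ?thesis using r[OF h(1)] nbrs_verts_of[OF h(2)] u by fastforce
  qed
  then obtain g where g: "\<And>v. v \<in> (\<Union>h\<in>J. verts_of h) - R \<Longrightarrow> g v \<in> J \<and> v \<in> verts_of (g v) - {r (g v)}" by metis
  have fin: "finite J" by (rule finite_subset[OF J finite_hues])
  have "card ((\<Union>h\<in>J. verts_of h) - R) \<le> card (SIGMA h:J. verts_of h - {r h})"
    by (rule card_inj_on_le[of "\<lambda>v. (g v, v)"]) (use g fin in \<open>auto simp: inj_on_def\<close>)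
  also have "\<dots> = (\<Sum>h\<in>J. card (verts_of h - {r h}))" using fin by simp
  also have "\<dots> = (\<Sum>h\<in>J. card (verts_of h) - 1)" using r by (intro sum.cong) auto
  finally show ?thesis .
qed

text \<open>
  A good vertex has a neighbour that lies in none of the hues through the vertex that miss \<open>w\<close>. The
  clusters are the components of the union of the hues that miss \<open>w\<close>.
\<close>

definition missing :: "'a \<Rightarrow> 'h set" where
  "missing w = {h \<in> hues. w \<notin> verts_of h}"

definition good :: "'a \<Rightarrow> 'a set" where
  "good w = {v \<in> (\<Union>h\<in>missing w. verts_of h). \<exists>u\<in>nbhd v. \<forall>h\<in>missing w. v \<in> verts_of h \<longrightarrow> u \<notin> verts_of h}"

definition cluster :: "'a \<Rightarrow> 'a \<Rightarrow> 'a set" where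
  "cluster w v = {x. (v, x) \<in> (link (missing w))\<^sup>*}"

text \<open>The share of one hue in \<open>cost_lower_bound\<close>, where a hue with
  \<open>e\<close> edges enters \<open>2 * cost\<close> with \<open>2 * e - 2\<close>. If it misses
  \<open>w\<close>, all its edges are useless for \<open>w\<close>, and
  \<open>card (verts_of h) - 1\<close> is paid for the vertices that lose a unit. If it contains
  \<open>w\<close>, only its degree at \<open>w\<close> and its waste elsewhere are gained in place
  of \<open>2 * e\<close>.\<close>

definition slack :: "'h \<Rightarrow> 'a \<Rightarrow> int" where
  "slack h w = (if w \<in> verts_of h then int (hdeg h w) + (\<Sum>v\<in>V - {w}. int (waste h v)) - 2
     else 2 * int (card (edges_of h)) - int (card (verts_of h)) - 1)"

lemma missing_subset: "missing w \<subseteq> hues"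
  unfolding missing_def by auto

lemma finite_missing [simp]: "finite (missing w)"
  by (rule finite_subset[OF missing_subset finite_hues])

text \<open>A hue missing \<open>w\<close> has a vertex of degree two, so its degree sum exceeds its
  number of vertices. In a hue through \<open>w\<close>, either \<open>w\<close> has degree at least
  two, or \<open>w\<close> is a leaf and its neighbour wastes an edge.\<close>

lemma slack_nonneg: "h \<in> hues \<Longrightarrow> w \<in> V \<Longrightarrow> 0 \<le> slack h w"
proof (cases "w \<in> verts_of h")
  case False
  assume h: "h \<in> hues"
  obtain v where v: "2 \<le> hdeg h v" using exists_hub h by blast
  then have vv: "v \<in> verts_of h" using hdeg_pos_iff[of h v] by auto
  have "(\<Sum>x\<in>verts_of h - {v}. 1) \<le> (\<Sum>x\<in>verts_of h - {v}. hdeg h x)"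
    using hdeg_pos_iff[of h] by (intro sum_mono) (auto simp: Suc_le_eq)
  then have "card (verts_of h) - 1 + 2 \<le> (\<Sum>x\<in>verts_of h. hdeg h x)" using v vv by (simp add: sum.remove[of _ v])
  then have "card (verts_of h) + 1 \<le> 2 * card (edges_of h)" using handshake_verts_of[of h] by linarith
  then show ?thesis using False unfolding slack_def by simp
next
  case True
  assume h: "h \<in> hues" and w: "w \<in> V"
  show ?thesis
  proof (cases "2 \<le> hdeg h w")
    case True
    moreover have "0 \<le> (\<Sum>v\<in>V - {w}. int (waste h v))" by (simp add: sum_nonneg)
    ultimately show ?thesis using \<open>w \<in> verts_of h\<close> unfolding slack_def by simp
  next
    case False
    then have d: "hdeg h w = 1" using hdeg_pos_iff[of h w] True by linarith
    then obtain x where x: "nbrs h w = {x}" unfolding hdeg_def by (auto simp: card_1_singleton_iff)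
    then have "w \<in> leaves_at h x" using nbrs_sym[of x h w] d unfolding leaves_at_def by auto
    then have "1 \<le> waste h x" using waste_pos h by blast
    moreover have "x \<in> V - {w}" using x nbrs_subset by blast
    ultimately have "1 \<le> (\<Sum>v\<in>V - {w}. int (waste h v))"
      using member_le_sum[of x "V - {w}" "\<lambda>v. int (waste h v)"] finV by simp
    then show ?thesis using True d unfolding slack_def by simp
  qed
qed

lemma cluster_missing:
  assumes "v \<in> (\<Union>h\<in>missing w. verts_of h)"
  shows "cluster w v \<subseteq> (\<Union>h\<in>missing w. verts_of h)" "v \<in> cluster w v" "w \<notin> cluster w v"
proof -
  show sub: "cluster w v \<subseteq> (\<Union>h\<in>missing w. verts_of h)"
  proof
    fix x assume "x \<in> cluster w v"
    then have "(v, x) \<in> (link (missing w))\<^sup>*" unfolding cluster_def by simp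
    then show "x \<in> (\<Union>h\<in>missing w. verts_of h)"
      by (cases rule: rtranclE) (use assms nbrs_verts_of in \<open>auto simp: link_def\<close>)
  qed
  show "v \<in> cluster w v" unfolding cluster_def by simp
  show "w \<notin> cluster w v" using sub unfolding missing_def by auto
qed

lemma cluster_closed:
  assumes "h \<in> missing w" "x \<in> cluster w v" "x \<in> verts_of h"
  shows "verts_of h \<subseteq> cluster w v"
proof (rule connected[of _ x])
  show "nbrs h z \<subseteq> cluster w v" if "z \<in> cluster w v" for z
  proof
    fix y assume "y \<in> nbrs h z"
    then have "(z, y) \<in> link (missing w)" using assms(1) unfolding link_def by auto
    then show "y \<in> cluster w v" using that unfolding cluster_def by (auto intro: rtrancl_into_rtrancl)
  qed
qed (use assms missing_subset in auto)

text \<open>By \<open>cluster_closed\<close> every missed hue through \<open>z\<close> stays inside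
  the cluster, so none of them contains \<open>z'\<close>.\<close>

lemma cluster_border_good:
  assumes "v \<in> (\<Union>h\<in>missing w. verts_of h)" "z \<in> cluster w v" "z' \<in> nbhd z" "z' \<notin> cluster w v"
  shows "z \<in> good w"
  using assms cluster_missing[OF assms(1)] cluster_closed[of _ w z v] unfolding good_def by blast

text \<open>Either all vertices of the cluster have a neighbour outside and are good, or some vertex
  \<open>x\<close> has none, and its \<open>k - 1\<close> disjoint paths to \<open>w\<close> leave
  the cluster at distinct good vertices.\<close>

lemma cluster_good_card:
  assumes v: "v \<in> (\<Union>h\<in>missing w. verts_of h)" and w: "w \<in> V"
  shows "min (k - 1) (card (cluster w v)) \<le> card (good w \<inter> cluster w v)"
proof -
  note c = cluster_missing[OF v]
  define bd where "bd = {z \<in> cluster w v. \<exists>z'\<in>nbhd z. z' \<notin> cluster w v}"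
  have clV: "cluster w v \<subseteq> V" using c(1) verts_of_subset by blast
  have bdg: "bd \<subseteq> good w \<inter> cluster w v" using cluster_border_good[OF v] unfolding bd_def by blast
  have fin: "finite (good w \<inter> cluster w v)" using clV finV by (meson finite_Int finite_subset)
  show ?thesis
  proof (cases "cluster w v \<subseteq> bd")
    case True
    then have "card (cluster w v) \<le> card (good w \<inter> cluster w v)" using bdg fin by (intro card_mono) auto
    then show ?thesis by simp
  next
    case False
    then obtain x where x: "x \<in> cluster w v" "x \<notin> bd" by blast
    then have "x \<in> V" "w \<noteq> x" using clV c(3) by auto
    then obtain U I where L: "linkage x w U I" using links w by blast
    have "\<exists>z. z \<in> I y \<inter> bd" if y: "y \<in> U" for y
    proof -
      obtain z z' where z: "z \<in> cluster w v" "z \<in> insert x (I y)" "z' \<in> nbrs (f {x, y}) z" "z' \<notin> cluster w v"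
        using linkageD(8)[OF L y x(1) c(3)] by blast
      then have "z' \<in> nbhd z" using linkageD(5)[OF L y] unfolding nbhd_def by auto
      then have "z \<in> bd" using z unfolding bd_def by auto
      then show ?thesis using z x by auto
    qed
    then obtain g where g: "\<And>y. y \<in> U \<Longrightarrow> g y \<in> I y \<inter> bd" by metis
    have "inj_on g U"
    proof (rule inj_onI)
      fix y z assume yz: "y \<in> U" "z \<in> U" "g y = g z"
      then show "y = z" using g[OF yz(1)] g[OF yz(2)] linkage_disjoint[OF L, of y z "g y"] by auto
    qed
    then have "card U \<le> card (good w \<inter> cluster w v)"
      by (rule card_inj_on_le) (use g bdg fin in auto)
    then show ?thesis using linkage_card(1)[OF L] by simp
  qed
qed

lemma good_reaches:
  assumes v: "v \<in> (\<Union>h\<in>missing w. verts_of h)" and w: "w \<in> V"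
  shows "\<exists>g\<in>good w. (g, v) \<in> (link (missing w))\<^sup>*"
proof -
  have "finite (cluster w v)" using cluster_missing(1)[OF v] verts_of_subset finV by (meson finite_UN_I finite_missing finite_subset finite_verts_of)
  then have "0 < card (cluster w v)" using cluster_missing(2)[OF v] by (auto simp: card_gt_0_iff)
  then have "0 < card (good w \<inter> cluster w v)" using cluster_good_card[OF v w] k2 by (simp add: min_def split: if_splits)
  then obtain g where "g \<in> good w" "g \<in> cluster w v" by (auto simp: card_gt_0_iff)
  then show ?thesis using link_rtrancl_sym unfolding cluster_def by blast
qed

text \<open>Only the first of the three cases has to aim at \<open>w\<close>. In the other two a
  neighbour is the target; a vertex in no missed hue needs only its waste, since the first sum
  vanishes there.\<close>

lemma excess_loss:
  assumes w: "w \<in> V" and v: "v \<in> V" "v \<noteq> w"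
  shows "int ((\<Sum>h\<in>missing w. hdeg h v) + (\<Sum>h\<in>hues - missing w. waste h v)) \<le>
    excess v + (if v \<in> (\<Union>h\<in>missing w. verts_of h) - good w then 1 else 0)"
proof -
  consider "v \<in> (\<Union>h\<in>missing w. verts_of h) - good w" | "v \<notin> (\<Union>h\<in>missing w. verts_of h)" | "v \<in> good w" by blast
  then show ?thesis
  proof cases
    case 1
    have "int ((\<Sum>h\<in>missing w. hdeg h v) + (\<Sum>h\<in>hues - missing w. waste h v)) \<le> excess v + (if w \<in> nbhd v then 0 else 1)"
      by (rule excess_ge) (use w v in \<open>auto simp: missing_def\<close>)
    then show ?thesis using 1 by (auto split: if_splits)
  next
    case 2
    then have "hdeg h v = 0" if "h \<in> missing w" for h using that hdeg_pos_iff[of h v] by auto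
    then have "(\<Sum>h\<in>missing w. hdeg h v) = 0" by simp
    moreover have "(\<Sum>h\<in>hues - missing w. waste h v) \<le> (\<Sum>h\<in>hues. waste h v)" by (rule sum_mono2) auto
    ultimately have "int ((\<Sum>h\<in>missing w. hdeg h v) + (\<Sum>h\<in>hues - missing w. waste h v)) \<le> excess v"
      using excess_ge_waste[OF v(1)] by linarith
    then show ?thesis using 2 by auto
  next
    case 3
    then obtain u where u: "u \<in> nbhd v" "\<And>h. h \<in> missing w \<Longrightarrow> v \<in> verts_of h \<Longrightarrow> u \<notin> verts_of h"
      unfolding good_def by blast
    define J where "J = {h \<in> missing w. v \<in> verts_of h}"
    have z: "hdeg h v = 0" "waste h v = 0" if "h \<in> missing w - J" for h
      using that hdeg_pos_iff[of h v] waste_le[of h v] unfolding J_def by auto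
    have "(\<Sum>h\<in>missing w. hdeg h v) = (\<Sum>h\<in>J. hdeg h v)"
      by (rule sum.mono_neutral_right) (use z in \<open>auto simp: J_def\<close>)
    moreover have "(\<Sum>h\<in>hues - missing w. waste h v) \<le> (\<Sum>h\<in>hues - J. waste h v)"
      by (rule sum_mono2) (auto simp: J_def)
    moreover have "int ((\<Sum>h\<in>J. hdeg h v) + (\<Sum>h\<in>hues - J. waste h v)) \<le> excess v"
      by (rule excess_ge_nbhd[OF v(1) u(1)]) (use u missing_subset in \<open>auto simp: J_def\<close>)
    ultimately have "int ((\<Sum>h\<in>missing w. hdeg h v) + (\<Sum>h\<in>hues - missing w. waste h v)) \<le> excess v" by linarith
    then show ?thesis using 3 by auto
  qed
qed

lemma cost_eq: "2 * int cost = (\<Sum>h\<in>hues. 2 * int (card (edges_of h)) - 2)"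
proof -
  have "int cost = (\<Sum>h\<in>hues. int (card (edges_of h)) - 1)"
    unfolding cost_def of_nat_sum by (intro sum.cong) (auto simp: hues_def of_nat_diff)
  then show ?thesis by (simp add: sum_distrib_left algebra_simps)
qed

lemma sum_excess: "(\<Sum>v\<in>V. excess v) = (\<Sum>h\<in>hues. 2 * int (card (edges_of h))) - int k * int (card V)"
proof -
  have "(\<Sum>v\<in>V. int (card (nbhd v))) = (\<Sum>h\<in>hues. \<Sum>v\<in>V. int (hdeg h v))"
    unfolding card_nbhd of_nat_sum by (rule sum.swap)
  also have "\<dots> = (\<Sum>h\<in>hues. 2 * int (card (edges_of h)))"
    using handshake by (intro sum.cong) (auto simp flip: of_nat_sum)
  finally show ?thesis unfolding excess_def by (simp add: sum_subtractf mult.commute)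
qed

text \<open>\<open>R\<close> is any set of good vertices from which the missed hues can be reached.
  \<open>card_reachable\<close> pays one unit for each vertex outside \<open>R\<close>, but a good
  vertex loses none, so good vertices outside \<open>R\<close> are a net gain. The term
  \<open>- k\<close> comes from the excess of \<open>w\<close>, which is absent from the sum over
  \<open>v \<noteq> w\<close>.\<close>

theorem cost_lower_bound:
  assumes w: "w \<in> V" and R: "R \<subseteq> good w"
    and reach: "\<And>v. v \<in> (\<Union>h\<in>missing w. verts_of h) \<Longrightarrow> \<exists>r\<in>R. (r, v) \<in> (link (missing w))\<^sup>*"
  shows "int k * (int (card V) - 1) + (\<Sum>h\<in>hues. slack h w) + int (card (good w - R)) \<le> 2 * int cost"
proof -
  define J where "J = missing w"
  define VJ where "VJ = (\<Union>h\<in>J. verts_of h)"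
  have Jhs: "J \<subseteq> hues" "finite J" unfolding J_def by (simp_all add: missing_subset)
  have finVJ: "finite VJ" unfolding VJ_def using Jhs by auto
  have goodVJ: "good w \<subseteq> VJ" unfolding good_def VJ_def J_def by auto
  have wVJ: "w \<notin> VJ" unfolding VJ_def J_def missing_def by auto
  have VJV: "VJ \<subseteq> V" unfolding VJ_def using verts_of_subset by blast
  have "card (VJ - R) \<le> (\<Sum>h\<in>J. card (verts_of h) - 1)"
    unfolding VJ_def by (rule card_reachable[OF Jhs(1)]) (use reach in \<open>auto simp: J_def\<close>)
  moreover have "card (VJ - R) = card (VJ - good w) + card (good w - R)"
  proof -
    have "VJ - R = (VJ - good w) \<union> (good w - R)" using goodVJ R by auto
    moreover have "finite (good w)" by (rule finite_subset[OF goodVJ finVJ])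
    ultimately show ?thesis using finVJ R by (subst card_Un_disjoint[symmetric]) auto
  qed
  moreover have "int (\<Sum>h\<in>J. card (verts_of h) - 1) = (\<Sum>h\<in>J. int (card (verts_of h)) - 1)"
    unfolding of_nat_sum
  proof (rule sum.cong)
    fix h assume "h \<in> J"
    then have "3 \<le> card (verts_of h)" using card_verts_of_ge Jhs(1) by blast
    then show "int (card (verts_of h) - 1) = int (card (verts_of h)) - 1" by simp
  qed simp
  ultimately have loss: "int (card (VJ - good w)) + int (card (good w - R)) \<le> (\<Sum>h\<in>J. int (card (verts_of h)) - 1)"
    by linarith
  have "(\<Sum>v\<in>V - {w}. int ((\<Sum>h\<in>J. hdeg h v) + (\<Sum>h\<in>hues - J. waste h v))) \<le>
      (\<Sum>v\<in>V - {w}. excess v + (if v \<in> VJ - good w then 1 else 0))"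
    using excess_loss[OF w] unfolding J_def VJ_def by (intro sum_mono) auto
  also have "\<dots> = (\<Sum>v\<in>V - {w}. excess v) + int (card (VJ - good w))"
  proof -
    have "(\<Sum>v\<in>V - {w}. if v \<in> VJ - good w then 1 else 0) = int (card ((V - {w}) \<inter> (VJ - good w)))"
      using finV by (simp add: sum.If_cases Collect_conj_eq set_diff_eq)
    moreover have "(V - {w}) \<inter> (VJ - good w) = VJ - good w" using VJV wVJ by auto
    ultimately show ?thesis by (simp add: sum.distrib)
  qed
  also have "(\<Sum>v\<in>V - {w}. excess v) = (\<Sum>v\<in>V. excess v) - excess w" using finV w by (simp add: sum_diff1)
  also have "(\<Sum>v\<in>V - {w}. int ((\<Sum>h\<in>J. hdeg h v) + (\<Sum>h\<in>hues - J. waste h v))) =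
      (\<Sum>h\<in>J. 2 * int (card (edges_of h))) + (\<Sum>h\<in>hues - J. \<Sum>v\<in>V - {w}. int (waste h v))"
  proof -
    have "(\<Sum>v\<in>V - {w}. \<Sum>h\<in>J. int (hdeg h v)) = (\<Sum>h\<in>J. \<Sum>v\<in>V - {w}. int (hdeg h v))" by (rule sum.swap)
    also have "\<dots> = (\<Sum>h\<in>J. 2 * int (card (edges_of h)))"
    proof (rule sum.cong)
      fix h assume "h \<in> J"
      then have "hdeg h w = 0" using hdeg_pos_iff[of h w] unfolding J_def missing_def by auto
      then have "(\<Sum>v\<in>V - {w}. int (hdeg h v)) = int (\<Sum>v\<in>V. hdeg h v)" using finV w by (simp add: sum_diff1)
      then show "(\<Sum>v\<in>V - {w}. int (hdeg h v)) = 2 * int (card (edges_of h))" using handshake[of h] by simp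
    qed simp
    moreover have "(\<Sum>v\<in>V - {w}. \<Sum>h\<in>hues - J. int (waste h v)) = (\<Sum>h\<in>hues - J. \<Sum>v\<in>V - {w}. int (waste h v))" by (rule sum.swap)
    ultimately show ?thesis by (simp add: sum.distrib)
  qed
  finally have main: "(\<Sum>h\<in>J. 2 * int (card (edges_of h))) + (\<Sum>h\<in>hues - J. \<Sum>v\<in>V - {w}. int (waste h v)) + excess w
      \<le> (\<Sum>v\<in>V. excess v) + int (card (VJ - good w))" by linarith
  have split: "(\<Sum>h\<in>hues. F h) = (\<Sum>h\<in>J. F h) + (\<Sum>h\<in>hues - J. F h)" for F :: "'h \<Rightarrow> int"
    using Jhs by (metis add.commute finite_hues sum.subset_diff)
  have "int (card (nbhd w)) = (\<Sum>h\<in>hues - J. int (hdeg h w))"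
  proof -
    have "(\<Sum>h\<in>J. int (hdeg h w)) = 0"
      using hdeg_pos_iff[of _ w] unfolding J_def missing_def by (intro sum.neutral) auto
    then show ?thesis unfolding card_nbhd of_nat_sum using split[of "\<lambda>h. int (hdeg h w)"] by simp
  qed
  then have exw: "excess w = (\<Sum>h\<in>hues - J. int (hdeg h w)) - int k" unfolding excess_def by simp
  have T1: "(\<Sum>h\<in>J. slack h w) = (\<Sum>h\<in>J. 2 * int (card (edges_of h)) - int (card (verts_of h)) - 1)"
    by (rule sum.cong) (auto simp: slack_def J_def missing_def)
  have T2: "(\<Sum>h\<in>hues - J. slack h w) = (\<Sum>h\<in>hues - J. int (hdeg h w) + (\<Sum>v\<in>V - {w}. int (waste h v)) - 2)"
    by (rule sum.cong) (auto simp: slack_def J_def missing_def)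
  show ?thesis
    using main loss exw T1 T2 split[of "\<lambda>h. slack h w"] split[of "\<lambda>h. 2 * int (card (edges_of h)) - 2"] sum_excess cost_eq
    by (simp add: sum.distrib sum_subtractf algebra_simps split[of "\<lambda>h. 2 * int (card (edges_of h))"])
qed

corollary slack_bound:
  assumes w: "w \<in> V"
  shows "int k * (int (card V) - 1) + (\<Sum>h\<in>hues. slack h w) \<le> 2 * int cost"
  using cost_lower_bound[OF w order_refl good_reaches[OF _ w]] by simp

end

section \<open>The general upper bound\<close>

lemma card_off_diagonal:
  assumes "finite S"
  shows "card {(a, b). a \<in> S \<and> b \<in> S \<and> a \<noteq> b} = card S * card S - card S"
proof -
  have "{(a, b). a \<in> S \<and> b \<in> S \<and> a \<noteq> b} = S \<times> S - (\<lambda>x. (x, x)) ` S" by auto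
  moreover have "card (S \<times> S - (\<lambda>x. (x, x)) ` S) = card (S \<times> S) - card ((\<lambda>x. (x, x)) ` S)"
    by (rule card_Diff_subset) (use assms in auto)
  moreover have "card ((\<lambda>x. (x, x)) ` S) = card S" by (simp add: card_image inj_on_def)
  ultimately show ?thesis by (simp add: card_cartesian_product)
qed

context linked_colouring
begin

definition cherries :: "'a \<Rightarrow> 'a \<Rightarrow> 'a set" where
  "cherries v u = {y. \<exists>h\<in>hues. v \<in> nbrs h y \<and> u \<in> nbrs h y}"

lemma cherries_subset: "cherries v u \<subseteq> V"
  unfolding cherries_def nbrs_def by auto

text \<open>At least \<open>k - 1\<close> disjoint interiors share \<open>n - 2\<close> vertices,
  and every interior that is not a single vertex takes two. So at least
  \<open>2(k - 1) - (n - 2)\<close> of them are single vertices.\<close>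

lemma card_cherries:
  assumes vu: "v \<in> V" "u \<in> V" "u \<noteq> v"
  shows "2 * k \<le> card V + card (cherries v u)"
proof -
  obtain U I where L: "linkage v u U I" using links vu by blast
  have finI: "finite (I y)" if "y \<in> U" for y
    using linkageD(2)[OF L that] finV by (meson finite_Diff finite_subset)
  have finU: "finite U" by (rule linkage_card(2)[OF L])
  have "(\<Sum>y\<in>U. card (I y)) = card (\<Union>y\<in>U. I y)"
  proof (rule card_UN_disjoint[symmetric])
    show "\<forall>y\<in>U. \<forall>z\<in>U. y \<noteq> z \<longrightarrow> I y \<inter> I z = {}" using linkage_disjoint[OF L] by blast
  qed (use finU finI in auto)
  also have "\<dots> \<le> card (V - {u, v})"
    by (intro card_mono) (use finV linkageD(2)[OF L] in auto)
  also have "\<dots> = card V - 2" using vu by (subst card_Diff_subset) auto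
  finally have s: "(\<Sum>y\<in>U. card (I y)) \<le> card V - 2" .
  have "2 * card U = (\<Sum>y\<in>U. 2)" by simp
  also have "\<dots> \<le> (\<Sum>y\<in>U. card (I y) + (if I y = {y} then 1 else 0))"
  proof (rule sum_mono)
    fix y assume y: "y \<in> U"
    show "2 \<le> card (I y) + (if I y = {y} then 1 else 0)"
    proof (cases "I y = {y}")
      case False
      then obtain x where "x \<in> I y" "x \<noteq> y" using linkageD(1)[OF L y] by blast
      then have "card {x, y} \<le> card (I y)" using linkageD(1)[OF L y] finI[OF y] by (intro card_mono) auto
      then show ?thesis using False \<open>x \<noteq> y\<close> by simp
    qed simp
  qed
  also have "\<dots> = (\<Sum>y\<in>U. card (I y)) + card {y \<in> U. I y = {y}}"
    using finU by (simp add: sum.distrib sum.If_cases Collect_conj_eq)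
  finally have "2 * (k - 1) \<le> card V - 2 + card {y \<in> U. I y = {y}}"
    using s linkage_card(1)[OF L] by linarith
  moreover have "card {y \<in> U. I y = {y}} \<le> card (cherries v u)"
  proof (rule card_mono)
    show "finite (cherries v u)" using cherries_subset finV finite_subset by blast
    show "{y \<in> U. I y = {y}} \<subseteq> cherries v u"
    proof
      fix y assume "y \<in> {y \<in> U. I y = {y}}"
      then have y: "y \<in> U" "I y = {y}" by auto
      then have "y \<in> nbrs (f {v, y}) u" using linkageD(3)[OF L y(1)] by auto
      then show "y \<in> cherries v u" unfolding cherries_def
        using linkageD(5)[OF L y(1)] linkage_used(1)[OF L vu(1) y(1)] nbrs_sym by blast
    qed
  qed
  moreover have "2 \<le> card V" using k2 kV by linarith
  ultimately show ?thesis using k2 by linarith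
qed

lemma sum_card_cherries:
  "(\<Sum>(v, u)\<in>{(v, u). v \<in> V \<and> u \<in> V \<and> v \<noteq> u}. card (cherries v u)) \<le>
    (\<Sum>y\<in>V. \<Sum>h\<in>hues. hdeg h y * hdeg h y - hdeg h y)"
proof -
  define P where "P = {(v, u). v \<in> V \<and> u \<in> V \<and> v \<noteq> u}"
  define Q where "Q h y = {(v, u). v \<in> nbrs h y \<and> u \<in> nbrs h y \<and> v \<noteq> u}" for h y
  have finP: "finite P" by (rule finite_subset[of _ "V \<times> V"]) (use finV in \<open>auto simp: P_def\<close>)
  have finQ: "finite (Q h y)" for h y
    by (rule finite_subset[of _ "nbrs h y \<times> nbrs h y"]) (auto simp: Q_def)
  have finc: "finite (cherries v u)" for v u using cherries_subset finV finite_subset by blast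
  have "(\<Sum>(v, u)\<in>P. card (cherries v u)) = card (SIGMA p:P. cherries (fst p) (snd p))"
    using finP finc by (simp add: case_prod_unfold)
  also have "\<dots> \<le> card (SIGMA y:V. \<Union>h\<in>hues. Q h y)"
  proof (rule card_inj_on_le[of "\<lambda>(p, y). (y, p)"])
    show "finite (SIGMA y:V. \<Union>h\<in>hues. Q h y)" using finV finQ by (intro finite_SigmaI) auto
    show "(\<lambda>(p, y). (y, p)) ` (SIGMA p:P. cherries (fst p) (snd p)) \<subseteq> (SIGMA y:V. \<Union>h\<in>hues. Q h y)"
      using cherries_subset unfolding P_def Q_def cherries_def by fastforce
  qed (auto simp: inj_on_def)
  also have "\<dots> = (\<Sum>y\<in>V. card (\<Union>h\<in>hues. Q h y))" using finV finQ by simp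
  also have "\<dots> \<le> (\<Sum>y\<in>V. \<Sum>h\<in>hues. card (Q h y))"
    by (intro sum_mono card_UN_le) simp
  also have "\<dots> = (\<Sum>y\<in>V. \<Sum>h\<in>hues. hdeg h y * hdeg h y - hdeg h y)"
    unfolding Q_def hdeg_def by (simp add: card_off_diagonal)
  finally show ?thesis unfolding P_def .
qed

text \<open>If the bound fails, each pair of vertices has at least \<open>M + 2\<close> cherries,
  while the slack at each vertex is at most \<open>M\<close>. Slack limits the degrees beyond two
  within a hue and thereby the cherries with a given middle. Double counting contradicts
  \<open>M + 3 \<le> n - 1\<close>, which is \<open>k < n\<close>.\<close>

lemma cost_bound_general:
  "int (k - 1) * int (card V) * int (card V - 1) \<le> 2 * int (card V - 2) * (int cost + 1)"
proof (rule ccontr)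
  assume neg: "\<not> ?thesis"
  define n where "n = int (card V)"
  \<comment> \<open>The room for slack under the negated bound:
    \<open>n(n - 1) = (n - 2)(n + 1) + 2\<close> and \<open>k - 1 \<le> n - 2\<close> turn it into
    \<open>2 cost \<le> (k - 1)(n + 1) - 1\<close>, and \<open>M\<close> is what remains after
    subtracting \<open>k(n - 1)\<close>.\<close>
  define M where "M = 2 * int k - n - 2"
  have nk: "int k + 1 \<le> n" "2 \<le> int k" using kV k2 n_def by auto
  then have conv: "int (k - 1) = int k - 1" "int (card V - 1) = n - 1" "int (card V - 2) = n - 2"
    using k2 kV n_def by auto
  have "2 * (n - 2) * (int cost + 1) < (int k - 1) * n * (n - 1)"
    using neg unfolding conv n_def[symmetric] by simp
  also have "\<dots> = (int k - 1) * ((n - 2) * (n + 1)) + 2 * (int k - 1)" by (simp add: algebra_simps)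
  also have "\<dots> \<le> (int k - 1) * ((n - 2) * (n + 1)) + 2 * (n - 2)" using nk by simp
  finally have "(n - 2) * (2 * (int cost + 1)) < (n - 2) * ((int k - 1) * (n + 1) + 2)"
    by (simp add: algebra_simps)
  then have lt: "2 * (int cost + 1) < (int k - 1) * (n + 1) + 2"
    using nk by (simp add: mult_less_cancel_left)
  have TM: "(\<Sum>h\<in>hues. slack h w) \<le> M" if "w \<in> V" for w
    using slack_bound[OF that] lt unfolding M_def n_def by (simp add: algebra_simps)
  have "V \<noteq> {}" using kV by auto
  then have M0: "0 \<le> M" using TM slack_nonneg by (metis all_not_in_conv order_trans sum_nonneg)
  have per: "(\<Sum>h\<in>hues. int (hdeg h y * hdeg h y - hdeg h y)) \<le> (n - 1) + 2 * M + M * M" if y: "y \<in> V" for y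
  proof -
    \<comment> \<open>The degree beyond two, which the slack at \<open>y\<close> bounds. For a
      degree \<open>d = a + 2\<close> one has \<open>d(d - 1) = d + 2a + a * a\<close>, and the
      degrees at \<open>y\<close> sum to at most \<open>n - 1\<close>.\<close>
    define a where "a h = max 0 (int (hdeg h y) - 2)" for h
    have aT: "a h \<le> slack h y" if "h \<in> hues" for h
    proof (cases "y \<in> verts_of h")
      case True
      have "0 \<le> (\<Sum>v\<in>V - {y}. int (waste h v))" by (simp add: sum_nonneg)
      then show ?thesis using slack_nonneg[OF that y] True unfolding a_def slack_def by auto
    next
      case False
      then have "hdeg h y = 0" using hdeg_pos_iff[of h y] by auto
      then show ?thesis using slack_nonneg[OF that y] unfolding a_def by auto
    qed
    have a0: "0 \<le> a h" for h unfolding a_def by simp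
    have sa: "(\<Sum>h\<in>hues. a h) \<le> M" by (rule order_trans[OF sum_mono[OF aT] TM[OF y]])
    have "(\<Sum>h\<in>hues. a h * a h) \<le> (\<Sum>h\<in>hues. a h * (\<Sum>h\<in>hues. a h))"
      using a0 by (intro sum_mono mult_left_mono member_le_sum) auto
    also have "\<dots> = (\<Sum>h\<in>hues. a h) * (\<Sum>h\<in>hues. a h)" by (simp add: sum_distrib_right)
    also have "\<dots> \<le> M * M" using sa a0 M0 by (intro mult_mono) (auto simp: sum_nonneg)
    finally have saa: "(\<Sum>h\<in>hues. a h * a h) \<le> M * M" .
    have "int (hdeg h y * hdeg h y - hdeg h y) \<le> int (hdeg h y) + 2 * a h + a h * a h" for h
    proof (cases "2 \<le> hdeg h y")
      case True
      then have "int (hdeg h y) = a h + 2" unfolding a_def by simp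
      moreover have "int (hdeg h y * hdeg h y - hdeg h y) = int (hdeg h y) * int (hdeg h y) - int (hdeg h y)"
        using True by (simp add: of_nat_diff)
      ultimately show ?thesis by (simp add: algebra_simps)
    next
      case False
      then have "hdeg h y = 0 \<or> hdeg h y = 1" by linarith
      then show ?thesis unfolding a_def by auto
    qed
    then have "(\<Sum>h\<in>hues. int (hdeg h y * hdeg h y - hdeg h y)) \<le> (\<Sum>h\<in>hues. int (hdeg h y) + 2 * a h + a h * a h)"
      by (rule sum_mono)
    also have "\<dots> = int (card (nbhd y)) + 2 * (\<Sum>h\<in>hues. a h) + (\<Sum>h\<in>hues. a h * a h)"
      unfolding card_nbhd by (simp add: sum.distrib sum_distrib_left)
    also have "\<dots> \<le> (n - 1) + 2 * M + M * M"
      using sa saa card_nbhd_less[OF y] kV unfolding n_def by (simp add: of_nat_diff)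
    finally show ?thesis .
  qed
  define P where "P = {(v, u). v \<in> V \<and> u \<in> V \<and> v \<noteq> u}"
  have "card P = card V * card V - card V" unfolding P_def by (rule card_off_diagonal[OF finV])
  then have "int (card P) = n * n - n" unfolding n_def using kV by (simp add: of_nat_diff)
  then have "(n * n - n) * (M + 2) = (\<Sum>(v, u)\<in>P. M + 2)" by simp
  also have "\<dots> \<le> (\<Sum>(v, u)\<in>P. int (card (cherries v u)))"
  proof (rule sum_mono, clarify)
    fix v u assume "(v, u) \<in> P"
    then show "M + 2 \<le> int (card (cherries v u))" using card_cherries[of v u] unfolding P_def M_def n_def by auto
  qed
  also have "\<dots> = int (\<Sum>(v, u)\<in>P. card (cherries v u))" by (simp add: case_prod_unfold)
  also have "\<dots> \<le> int (\<Sum>y\<in>V. \<Sum>h\<in>hues. hdeg h y * hdeg h y - hdeg h y)"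
    using sum_card_cherries unfolding P_def by linarith
  also have "\<dots> = (\<Sum>y\<in>V. \<Sum>h\<in>hues. int (hdeg h y * hdeg h y - hdeg h y))" by simp
  also have "\<dots> \<le> (\<Sum>y\<in>V. (n - 1) + 2 * M + M * M)" by (rule sum_mono) (rule per)
  also have "\<dots> = n * ((n - 1) + 2 * M + M * M)" unfolding n_def by simp
  finally have "n * ((n - 1) * (M + 2)) \<le> n * ((n - 1) + 2 * M + M * M)" by (simp add: algebra_simps)
  then have "(n - 1) * (M + 2) \<le> (n - 1) + 2 * M + M * M" using nk by (simp add: mult_le_cancel_left)
  moreover have "(M + 3) * (M + 1) \<le> (n - 1) * (M + 1)"
    using nk M0 unfolding M_def by (intro mult_right_mono) auto
  ultimately show False using M0 by (simp add: algebra_simps)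
qed

end

section \<open>Colourings with few saved edges\<close>

context linked_colouring
begin

lemma V_nonempty: "V \<noteq> {}"
  using kV by auto

lemma verts_of_nonempty: "h \<in> hues \<Longrightarrow> verts_of h \<noteq> {}"
  using card_verts_of_ge[of h] by auto

text \<open>Two different supports waste one edge each. A common support has a third neighbour, as
  the hue is connected with four vertices, so the minimum in \<open>waste\<close> is at least two.
  With three vertices this fails: a path with two edges has total waste one.\<close>

lemma two_leaves:
  assumes h: "h \<in> hues" "4 \<le> card (verts_of h)" and l: "hdeg h l = 1" "hdeg h l' = 1" "l \<noteq> l'"
  shows "2 \<le> (\<Sum>v\<in>V. waste h v)"
proof -
  obtain x where x: "nbrs h l = {x}" using l(1) unfolding hdeg_def by (auto simp: card_1_singleton_iff)
  obtain x' where x': "nbrs h l' = {x'}" using l(2) unfolding hdeg_def by (auto simp: card_1_singleton_iff)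
  have leaves_at: "l \<in> leaves_at h x" "l' \<in> leaves_at h x'"
    using x x' l nbrs_sym[of x h l] nbrs_sym[of x' h l'] unfolding leaves_at_def by auto
  have V: "x \<in> V" "x' \<in> V" using x x' nbrs_subset by blast+
  show ?thesis
  proof (cases "x = x'")
    case True
    have "nbrs h x \<noteq> {l, l'}"
    proof
      assume "nbrs h x = {l, l'}"
      then have "verts_of h \<subseteq> {x, l, l'}"
        using x x' True hdeg_pos_iff[of h l] l(1) by (intro connected[OF h(1), of l]) auto
      then have "card (verts_of h) \<le> card {x, l, l'}" by (intro card_mono) auto
      then show False using h(2) by (simp add: card_insert_if split: if_splits)
    qed
    moreover have sub: "{l, l'} \<subseteq> leaves_at h x" using leaves_at True by auto
    ultimately have "{l, l'} \<subset> nbrs h x" unfolding leaves_at_def by auto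
    then have "card {l, l'} < card (nbrs h x)" by (intro psubset_card_mono) auto
    moreover have "card {l, l'} \<le> card (leaves_at h x)"
      using sub by (intro card_mono) (auto simp: leaves_at_def)
    ultimately have "2 \<le> waste h x" using l(3) unfolding waste_def hdeg_def by simp
    also have "waste h x \<le> (\<Sum>v\<in>V. waste h v)" using V finV by (intro member_le_sum) auto
    finally show ?thesis .
  next
    case False
    have "2 \<le> (\<Sum>v\<in>{x, x'}. waste h v)" using False waste_pos[OF h(1) leaves_at(1)] waste_pos[OF h(1) leaves_at(2)] by simp
    also have "\<dots> \<le> (\<Sum>v\<in>V. waste h v)" using V finV by (intro sum_mono2) auto
    finally show ?thesis .
  qed
qed

text \<open>There is at most one leaf, so the degree sum is at least \<open>2n - 1\<close>; being
  even, it is at least \<open>2n\<close>.\<close>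

lemma card_edges_of_ge_if_few_leaves:
  assumes h: "h \<in> hues" "verts_of h = V" "(\<Sum>v\<in>V. waste h v) \<le> 1" "4 \<le> card V"
  shows "card V \<le> card (edges_of h)"
proof -
  have pos: "1 \<le> hdeg h v" if "v \<in> V" for v using hdeg_pos_iff[of h v] h(2) that by auto
  have "2 * card V \<le> 1 + (\<Sum>v\<in>V. hdeg h v)"
  proof (cases "\<exists>l\<in>V. hdeg h l = 1")
    case False
    then have "2 \<le> hdeg h v" if "v \<in> V" for v using pos[OF that] that by (metis Suc_leI le_neq_implies_less one_add_one plus_1_eq_Suc)
    then have "(\<Sum>v\<in>V. 2) \<le> (\<Sum>v\<in>V. hdeg h v)" by (rule sum_mono)
    then show ?thesis by simp
  next
    case True
    then obtain l where l: "l \<in> V" "hdeg h l = 1" by blast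
    have "2 \<le> hdeg h v" if "v \<in> V - {l}" for v
    proof -
      have "hdeg h v \<noteq> 1" using two_leaves[of h l v] h l that by auto
      then show ?thesis using pos[of v] that by auto
    qed
    then have "(\<Sum>v\<in>V - {l}. 2) \<le> (\<Sum>v\<in>V - {l}. hdeg h v)" by (rule sum_mono)
    then show ?thesis using l finV sum.remove[OF finV l(1), of "hdeg h"] h(4) by simp
  qed
  then show ?thesis using handshake[of h] by linarith
qed

lemma spanning_card_edges_of_ge:
  assumes h: "h \<in> hues" "verts_of h = V"
  shows "card V - 1 \<le> card (edges_of h)"
proof -
  obtain r where r: "r \<in> V" using V_nonempty by blast
  have "verts_of h \<subseteq> {x. (r, x) \<in> (link {h})\<^sup>*}"
  proof (rule connected[OF h(1), of r])
    show "nbrs h z \<subseteq> {x. (r, x) \<in> (link {h})\<^sup>*}" if "z \<in> {x. (r, x) \<in> (link {h})\<^sup>*}" for z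
      using that by (auto simp: link_def intro: rtrancl_into_rtrancl)
  qed (use r h(2) in auto)
  then have "\<exists>r0\<in>{r}. (r0, v) \<in> (link {h})\<^sup>*" if "v \<in> V" for v using that h(2) by blast
  then obtain dist :: "'a \<Rightarrow> nat" where dist: "\<And>v. v \<in> V - {r} \<Longrightarrow> \<exists>u. (u, v) \<in> link {h} \<and> dist u < dist v"
    using bfs_layers[of V "{r}" "link {h}"] by blast
  have "\<exists>u. v \<in> nbrs h u \<and> dist u < dist v" if "v \<in> V - {r}" for v
    using dist[OF that] unfolding link_def by auto
  then obtain p where p: "\<And>v. v \<in> V - {r} \<Longrightarrow> v \<in> nbrs h (p v) \<and> dist (p v) < dist v" by metis
  have "card (V - {r}) \<le> card (edges_of h)"
  proof (rule card_inj_on_le[of "\<lambda>v. {v, p v}"])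
    show "inj_on (\<lambda>v. {v, p v}) (V - {r})"
    proof (rule inj_onI)
      fix v v' assume vv: "v \<in> V - {r}" "v' \<in> V - {r}" "{v, p v} = {v', p v'}"
      then show "v = v'" using p[OF vv(1)] p[OF vv(2)] by (auto simp: doubleton_eq_iff)
    qed
    show "(\<lambda>v. {v, p v}) ` (V - {r}) \<subseteq> edges_of h" using p edges_of_doubleton nbrs_sym by blast
  qed simp
  then show ?thesis using r finV by simp
qed

lemma tight_used:
  assumes "linkage v u U I" "v \<in> V" "excess v \<le> 0" "u \<in> nbhd v"
  shows "nbhd v - {u} \<subseteq> U"
proof -
  have "int (card (nbhd v - {u} - U)) \<le> excess v" using unused[OF assms(1,2) order_refl] assms(4) by simp
  then have "card (nbhd v - {u} - U) = 0" using assms(3) by linarith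
  then have "nbhd v - {u} - U = {}" by (simp only: card_0_eq finite_Diff finite_nbhd)
  then show ?thesis by blast
qed

text \<open>The two paths along a Hamiltonian cycle use up all vertices.\<close>

lemma cycle_no_tight:
  assumes h: "h \<in> hues" "verts_of h = V" "\<And>v. v \<in> V \<Longrightarrow> hdeg h v = 2"
    and h': "h' \<in> hues" "verts_of h' = V" "h \<noteq> h'" and k4: "4 \<le> k" and v: "v \<in> V"
  shows "1 \<le> excess v"
proof (rule ccontr)
  assume "\<not> 1 \<le> excess v"
  obtain u where u: "u \<in> nbrs h' v" using v h' unfolding verts_of_def by auto
  then have uN: "u \<in> nbhd v" and uV: "u \<in> V" "u \<noteq> v" using h' nbrs_subset unfolding nbhd_def by auto
  obtain U I where L: "linkage v u U I" using links v uV by blast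
  have "nbhd v - {u} \<subseteq> U" by (rule tight_used[OF L v _ uN]) (use \<open>\<not> 1 \<le> excess v\<close> in simp)
  moreover have "nbrs h v \<subseteq> nbhd v - {u}" using h(1) u h'(3) nbrs_hue_unique unfolding nbhd_def by blast
  ultimately have nbU: "nbrs h v \<subseteq> U" by blast
  obtain y1 y2 where y: "nbrs h v = {y1, y2}" "y1 \<noteq> y2" using h(3)[OF v] unfolding hdeg_def by (auto simp: card_2_iff)
  have yU: "y1 \<in> U" "y2 \<in> U" using y nbU by auto
  have fy: "f {v, y1} = h" "f {v, y2} = h" using y unfolding nbrs_def by auto
  define C where "C = insert u (insert v (I y1 \<union> I y2))"
  have inner: "nbrs h x \<subseteq> insert u (insert v (I y))" if "y \<in> {y1, y2}" "x \<in> I y" for x y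
  proof -
    have yy: "y \<in> U" "f {v, y} = h" using that yU fy by auto
    have xV: "x \<in> V" using linkageD(2)[OF L yy(1)] that by auto
    have "2 \<le> card (nbrs h x \<inter> insert u (insert v (I y)))" using linkageD(7)[OF L yy(1) that(2)] yy by simp
    moreover have "card (nbrs h x) = 2" using h(3)[OF xV] unfolding hdeg_def .
    ultimately have "nbrs h x \<inter> insert u (insert v (I y)) = nbrs h x"
      by (intro card_seteq) auto
    then show ?thesis by blast
  qed
  have "nbrs h u \<subseteq> I y1 \<union> I y2"
  proof -
    obtain z1 where z1: "z1 \<in> I y1" "z1 \<in> nbrs h u" using linkageD(3)[OF L yU(1)] fy by auto
    obtain z2 where z2: "z2 \<in> I y2" "z2 \<in> nbrs h u" using linkageD(3)[OF L yU(2)] fy by auto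
    have "z1 \<noteq> z2" using linkage_disjoint[OF L yU z1(1)] z2 y by auto
    then have "{z1, z2} = nbrs h u"
      using z1 z2 h(3)[OF uV(1)] unfolding hdeg_def by (intro card_seteq) auto
    then show ?thesis using z1 z2 by auto
  qed
  moreover have "nbrs h v \<subseteq> I y1 \<union> I y2" using y linkageD(1)[OF L] yU by auto
  moreover have "nbrs h x \<subseteq> C" if "x \<in> I y1 \<union> I y2" for x
    using that inner[of y1 x] inner[of y2 x] unfolding C_def by auto
  ultimately have "nbrs h x \<subseteq> C" if "x \<in> C" for x using that unfolding C_def by auto
  then have "V \<subseteq> C" using connected[OF h(1), of v C] h(2) v unfolding C_def by auto
  have "3 \<le> card U" using linkage_card(1)[OF L] k4 by linarith
  then have "\<not> U \<subseteq> {y1, y2}" using card_mono[of "{y1, y2}" U] y by auto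
  then obtain y3 where y3: "y3 \<in> U" "y3 \<noteq> y1" "y3 \<noteq> y2" by blast
  then have "y3 \<in> I y3" "y3 \<in> V - {u, v}" using linkageD(1,2)[OF L y3(1)] by auto
  then have "y3 \<in> I y1 \<or> y3 \<in> I y2" using \<open>V \<subseteq> C\<close> unfolding C_def by auto
  then show False using linkage_disjoint[OF L y3(1)] yU \<open>y3 \<in> I y3\<close> y3 by blast
qed

text \<open>A tight vertex has no spare edge: every edge of hue \<open>h\<close> at \<open>v\<close>
  other than \<open>vu\<close> starts a path to \<open>u\<close>, and by \<open>used_le\<close>
  these paths need as many edges of hue \<open>h\<close> at \<open>u\<close>. If \<open>vu\<close>
  has hue \<open>h\<close>, it counts at both ends.\<close>

lemma tight_hdeg_le:
  assumes h: "h \<in> hues" and v: "v \<in> V" "excess v = 0" and u: "u \<in> nbhd v"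
  shows "hdeg h v \<le> hdeg h u"
proof -
  have uV: "u \<in> V" "u \<noteq> v" using u nbhd_subset by auto
  obtain U I where L: "linkage v u U I" using links v uV by blast
  have "nbhd v - {u} \<subseteq> U" using tight_used[OF L] v u by simp
  then have sub: "nbrs h v - {u} \<subseteq> {y \<in> U. f {v, y} = h}" using h unfolding nbhd_def nbrs_def by auto
  have "card (nbrs h v - {u}) \<le> card {y \<in> U. f {v, y} = h}"
    by (rule card_mono[OF _ sub]) (use linkage_card(2)[OF L] in simp)
  also have "\<dots> \<le> card (nbrs h u - {v})" by (rule used_le[OF L])
  finally have le: "card (nbrs h v - {u}) \<le> card (nbrs h u - {v})" .
  show ?thesis
  proof (cases "u \<in> nbrs h v")
    case True
    then have "0 < card (nbrs h u)" using nbrs_sym[of u h v] by (auto simp: card_gt_0_iff)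
    then show ?thesis using le True nbrs_sym[of u h v] unfolding hdeg_def by (simp add: card_Diff_singleton)
  next
    case False
    then show ?thesis using le nbrs_sym[of u h v] unfolding hdeg_def by simp
  qed
qed

end

text \<open>A counterexample to the upper bound in (b). The condition \<open>n7\<close> ensures that
  two hues with three vertices each miss a common vertex.\<close>

locale cheap_colouring = linked_colouring +
  assumes cheap: "2 * int cost \<le> int k * int (card V) - 3"
    and k5: "k \<le> 5" and n7: "k = 5 \<Longrightarrow> 7 \<le> card V"
begin

lemma excess_bound:
  assumes "w \<in> V" "R \<subseteq> good w"
    "\<And>v. v \<in> (\<Union>h\<in>missing w. verts_of h) \<Longrightarrow> \<exists>r\<in>R. (r, v) \<in> (link (missing w))\<^sup>*"
  shows "(\<Sum>h\<in>hues. slack h w) + int (card (good w - R)) \<le> int k - 3"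
  using cost_lower_bound[OF assms] cheap by (simp add: algebra_simps)

lemma slack_sum: "w \<in> V \<Longrightarrow> (\<Sum>h\<in>hues. slack h w) \<le> int k - 3"
  using excess_bound[OF _ order_refl good_reaches] by simp

lemma slack_sum_nonneg: "w \<in> V \<Longrightarrow> 0 \<le> (\<Sum>h\<in>hues. slack h w)"
  using slack_nonneg by (simp add: sum_nonneg)

lemma k3: "3 \<le> k"
proof -
  obtain w where "w \<in> V" using V_nonempty by blast
  then show ?thesis using slack_sum[of w] slack_sum_nonneg[of w] by linarith
qed

lemma n4: "4 \<le> card V"
  using k3 kV by linarith

lemma excess_sum: "(\<Sum>v\<in>V. excess v) \<le> 2 * int (card hues) - 3"
  using cheap unfolding cost_eq sum_excess by (simp add: sum_subtractf)

lemma cluster_reach: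
  assumes "y \<in> cluster w v" "z \<in> cluster w v"
  shows "(y, z) \<in> (link (missing w))\<^sup>*"
proof -
  have "(v, y) \<in> (link (missing w))\<^sup>*" "(v, z) \<in> (link (missing w))\<^sup>*"
    using assms unfolding cluster_def by auto
  then show ?thesis by (meson link_rtrancl_sym rtrancl_trans)
qed

text \<open>One root \<open>z\<close> suffices for the cluster \<open>X\<close>, so its other good
  vertices are a gain, and at most \<open>k - 2\<close> vertices of \<open>X\<close> are good. By
  \<open>cluster_good_card\<close> then all of \<open>X\<close> is good and
  \<open>3 \<le> card X \<le> k - 2 \<le> 3\<close>; equality throughout leaves no room for
  slack.\<close>

lemma nonspanning:
  assumes h: "h \<in> hues" and w: "w \<in> V" "w \<notin> verts_of h"
  shows "k = 5" "card (verts_of h) = 3" "verts_of h \<subseteq> good w" "\<And>v. v \<in> verts_of h \<Longrightarrow> cluster w v = verts_of h"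
    "\<And>h'. h' \<in> hues \<Longrightarrow> slack h' w = 0"
proof -
  have m: "h \<in> missing w" using h w unfolding missing_def by auto
  have key: "k = 5 \<and> card (verts_of h) = 3 \<and> verts_of h \<subseteq> good w \<and> cluster w v = verts_of h \<and> (\<Sum>h\<in>hues. slack h w) = 0"
    if v: "v \<in> verts_of h" for v
  proof -
    define X where "X = cluster w v"
    have vU: "v \<in> (\<Union>h\<in>missing w. verts_of h)" using v m by auto
    have sub: "verts_of h \<subseteq> X" unfolding X_def
      by (rule cluster_closed[OF m _ v]) (rule cluster_missing(2)[OF vU])
    have XV: "X \<subseteq> V" using cluster_missing(1)[OF vU] verts_of_subset unfolding X_def by blast
    have finX: "finite X" using XV finV finite_subset by blast
    have X3: "3 \<le> card X" using card_verts_of_ge[OF h] card_mono[OF finX sub] by linarith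
    have ming: "min (k - 1) (card X) \<le> card (good w \<inter> X)"
      unfolding X_def by (rule cluster_good_card[OF vU w(1)])
    then have g2: "2 \<le> card (good w \<inter> X)" using k3 X3 by (simp add: min_def split: if_splits)
    then have "good w \<inter> X \<noteq> {}" by auto
    then obtain z where z: "z \<in> good w" "z \<in> X" by blast
    define R where "R = good w - (X - {z})"
    have reach: "\<exists>r\<in>R. (r, x) \<in> (link (missing w))\<^sup>*" if x: "x \<in> (\<Union>h\<in>missing w. verts_of h)" for x
    proof -
      obtain g where g: "g \<in> good w" "(g, x) \<in> (link (missing w))\<^sup>*" using good_reaches[OF x w(1)] by blast
      show ?thesis
      proof (cases "g \<in> R")
        case False
        then have "g \<in> X" using g unfolding R_def by auto
        then have "(z, g) \<in> (link (missing w))\<^sup>*"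
          using cluster_reach z(2) unfolding X_def by blast
        then have "(z, x) \<in> (link (missing w))\<^sup>*" using g(2) by (rule rtrancl_trans)
        moreover have "z \<in> R" using z unfolding R_def by simp
        ultimately show ?thesis by blast
      qed (use g in blast)
    qed
    have "good w - R = good w \<inter> X - {z}" unfolding R_def by auto
    then have "card (good w - R) = card (good w \<inter> X) - 1" using z finX by simp
    moreover have "(\<Sum>h\<in>hues. slack h w) + int (card (good w - R)) \<le> int k - 3"
    proof (rule excess_bound[OF w(1)])
      show "R \<subseteq> good w" unfolding R_def by blast
    qed (rule reach)
    ultimately have main: "(\<Sum>h\<in>hues. slack h w) + int (card (good w \<inter> X)) \<le> int k - 2" using g2 by linarith
    then have cg: "int (card (good w \<inter> X)) \<le> int k - 2" using slack_sum_nonneg[OF w(1)] by linarith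
    then have "card X \<le> card (good w \<inter> X)" using ming k3 by (simp add: min_def split: if_splits)
    then have eq: "card (good w \<inter> X) = card X"
      using card_mono[OF finX, of "good w \<inter> X"] by simp
    then have c3: "k = 5" "card X = 3" "(\<Sum>h\<in>hues. slack h w) = 0" using cg X3 k5 main slack_sum_nonneg[OF w(1)] by linarith+
    have "verts_of h = X" by (rule card_seteq[OF finX sub]) (use c3 card_verts_of_ge[OF h] in simp)
    moreover have "good w \<inter> X = X" by (rule card_subset_eq[OF finX _ eq]) simp
    then have "X \<subseteq> good w" by blast
    ultimately show ?thesis using c3 unfolding X_def[symmetric] by simp
  qed
  obtain v where "v \<in> verts_of h" using verts_of_nonempty[OF h] by blast
  then show "k = 5" "card (verts_of h) = 3" "verts_of h \<subseteq> good w" using key by blast+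
  show "\<And>v. v \<in> verts_of h \<Longrightarrow> cluster w v = verts_of h" using key by blast
  have "(\<Sum>h\<in>hues. slack h w) = 0" using key \<open>v \<in> verts_of h\<close> by blast
  then have "\<forall>h'\<in>hues. slack h' w = 0"
    by (subst (asm) sum_nonneg_eq_0_iff) (use slack_nonneg[OF _ w(1)] in auto)
  then show "\<And>h'. h' \<in> hues \<Longrightarrow> slack h' w = 0" by blast
qed

text \<open>If two such hues meet, they have the same three vertices, and a vertex with both edges
  in one hue has none left for the other. If they are disjoint, they form two clusters whose good
  vertices gain \<open>2 + 2\<close>, more than \<open>k - 3 = 2\<close>.\<close>

lemma nonspanning_unique:
  assumes h: "h \<in> hues" "verts_of h \<noteq> V" and h': "h' \<in> hues" "verts_of h' \<noteq> V"
  shows "h = h'"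
proof (rule ccontr)
  assume ne: "h \<noteq> h'"
  obtain a b where ab: "a \<in> V" "a \<notin> verts_of h" "b \<in> V" "b \<notin> verts_of h'"
    using verts_of_subset[of h] verts_of_subset[of h'] h h' by blast
  have k: "k = 5" and c: "card (verts_of h) = 3" "card (verts_of h') = 3"
    using nonspanning(1,2)[OF h(1) ab(1,2)] nonspanning(2)[OF h'(1) ab(3,4)] by blast+
  have "card (verts_of h \<union> verts_of h') \<le> 6" using card_Un_le[of "verts_of h" "verts_of h'"] c by simp
  then have "card (verts_of h \<union> verts_of h') < card V" using n7[OF k] by linarith
  then obtain w where w: "w \<in> V" "w \<notin> verts_of h" "w \<notin> verts_of h'"
    by (metis UnCI finite_UnI finite_verts_of card_mono not_le subsetI)
  note N1 = nonspanning[OF h(1) w(1,2)] and N2 = nonspanning[OF h'(1) w(1,3)]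
  show False
  proof (cases "verts_of h \<inter> verts_of h' = {}")
    case False
    then have eq: "verts_of h = verts_of h'" using N1(4) N2(4) by blast
    obtain v where v: "2 \<le> hdeg h v" using exists_hub[OF h(1)] by blast
    then have vv: "v \<in> verts_of h" using hdeg_pos_iff[of h v] by auto
    have "nbrs h v \<subseteq> verts_of h - {v}" using nbrs_verts_of(1) nbrs_subset by blast
    then have "nbrs h v = verts_of h - {v}" by (rule card_seteq[rotated]) (use v c vv in \<open>auto simp: hdeg_def\<close>)
    moreover obtain y where y: "y \<in> nbrs h' v" using vv eq unfolding verts_of_def by blast
    moreover have "y \<in> verts_of h' - {v}" using y nbrs_verts_of(1)[OF y] nbrs_subset by blast
    ultimately have "y \<in> nbrs h v" using eq by blast
    then show ?thesis using y nbrs_hue_unique ne by blast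
  next
    case True
    obtain a b where a: "a \<in> verts_of h" and b: "b \<in> verts_of h'" using verts_of_nonempty h(1) h'(1) by blast
    define D where "D = (verts_of h - {a}) \<union> (verts_of h' - {b})"
    have "card D = 4" unfolding D_def using True c a b by (subst card_Un_disjoint) auto
    moreover have "good w - (good w - D) = D" using N1(3) N2(3) unfolding D_def by blast
    moreover have "(\<Sum>h\<in>hues. slack h w) + int (card (good w - (good w - D))) \<le> int k - 3"
    proof (rule excess_bound[OF w(1)])
      fix x assume x: "x \<in> (\<Union>h\<in>missing w. verts_of h)"
      obtain g where g: "g \<in> good w" "(g, x) \<in> (link (missing w))\<^sup>*" using good_reaches[OF x w(1)] by blast
      have ar: "(a, y) \<in> (link (missing w))\<^sup>*" if "y \<in> verts_of h" for y using N1(4)[OF a] that unfolding cluster_def by blast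
      have br: "(b, y) \<in> (link (missing w))\<^sup>*" if "y \<in> verts_of h'" for y using N2(4)[OF b] that unfolding cluster_def by blast
      have "a \<in> good w - D" "b \<in> good w - D" using N1(3) N2(3) a b True unfolding D_def by blast+
      then show "\<exists>r\<in>good w - D. (r, x) \<in> (link (missing w))\<^sup>*"
        using g ar br unfolding D_def by (meson DiffI Diff_iff UnE rtrancl_trans)
    qed simp
    ultimately show False using slack_sum_nonneg[OF w(1)] k by simp
  qed
qed

lemma cost_ge:
  assumes "S \<subseteq> hues" "\<And>h. h \<in> S \<Longrightarrow> card V \<le> card (edges_of h)"
  shows "card S * (card V - 1) + (\<Sum>h\<in>hues - S. card (edges_of h) - 1) \<le> cost"
proof -
  have "cost = (\<Sum>h\<in>hues - S. card (edges_of h) - 1) + (\<Sum>h\<in>S. card (edges_of h) - 1)"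
    unfolding cost_def by (rule sum.subset_diff[OF assms(1) finite_hues])
  moreover have "card S * (card V - 1) \<le> (\<Sum>h\<in>S. card (edges_of h) - 1)"
    using sum_mono[of S "\<lambda>_. card V - 1" "\<lambda>h. card (edges_of h) - 1"] assms(2) by (simp add: diff_le_mono)
  ultimately show ?thesis by linarith
qed

text \<open>Three such hues would give cost at least \<open>3(n - 1)\<close>, but
  \<open>6(n - 1) > 5n - 3\<close> for \<open>n \<ge> 4\<close>.\<close>

lemma few_large:
  assumes "S \<subseteq> hues" "\<And>h. h \<in> S \<Longrightarrow> card V \<le> card (edges_of h)"
  shows "card S \<le> 2"
proof (rule ccontr)
  assume "\<not> card S \<le> 2"
  then have "3 * (card V - 1) \<le> card S * (card V - 1)" by (intro mult_right_mono) auto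
  then have "3 * (card V - 1) \<le> cost" using cost_ge[OF assms] by linarith
  moreover have "int k * int (card V) \<le> 5 * int (card V)" using k5 by (intro mult_right_mono) auto
  ultimately show False using cheap n4 by linarith
qed

text \<open>At a vertex \<open>w\<close> missed by a hue all slacks vanish, so every other hue has
  degree at most two at \<open>w\<close> and total waste at most one, hence at least
  \<open>n\<close> edges. By \<open>few_large\<close> there are at most two of them, so
  \<open>w\<close> has at most four neighbours, fewer than \<open>k = 5\<close>.\<close>

lemma spanning: "h \<in> hues \<Longrightarrow> verts_of h = V"
proof (rule ccontr)
  assume h: "h \<in> hues" and ns: "verts_of h \<noteq> V"
  then obtain w where w: "w \<in> V" "w \<notin> verts_of h" using verts_of_subset by blast
  note N1 = nonspanning[OF h w]
  have sp: "verts_of h' = V" if "h' \<in> hues - {h}" for h' using nonspanning_unique[OF h ns, of h'] that by blast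
  have T0: "int (hdeg h' w) + (\<Sum>v\<in>V - {w}. int (waste h' v)) = 2" if "h' \<in> hues - {h}" for h'
    using N1(5)[of h'] sp[OF that] that w unfolding slack_def by auto
  have d2: "hdeg h' w \<le> 2" if "h' \<in> hues - {h}" for h'
  proof -
    have "0 \<le> (\<Sum>v\<in>V - {w}. int (waste h' v))" by (simp add: sum_nonneg)
    then show ?thesis using T0[OF that] by linarith
  qed
  have "card V \<le> card (edges_of h')" if h': "h' \<in> hues - {h}" for h'
  proof (rule card_edges_of_ge_if_few_leaves)
    have "0 < hdeg h' w" using hdeg_pos_iff[of h' w] sp[OF h'] w by simp
    then have "waste h' w + 1 \<le> hdeg h' w" using waste_le[of h' w] by linarith
    moreover have "(\<Sum>v\<in>V. waste h' v) = waste h' w + (\<Sum>v\<in>V - {w}. waste h' v)" by (rule sum.remove[OF finV w(1)])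
    moreover have "hdeg h' w + (\<Sum>v\<in>V - {w}. waste h' v) = 2" using T0[OF h'] by (simp flip: of_nat_sum of_nat_add)
    ultimately show "(\<Sum>v\<in>V. waste h' v) \<le> 1" by linarith
  qed (use h' sp n4 in auto)
  then have c2: "card (hues - {h}) \<le> 2" by (intro few_large) auto
  have "hdeg h w = 0" using hdeg_pos_iff[of h w] w by simp
  then have "card (nbhd w) = (\<Sum>h'\<in>hues - {h}. hdeg h' w)"
    unfolding card_nbhd using sum.remove[OF finite_hues h, of "\<lambda>h. hdeg h w"] by simp
  also have "\<dots> \<le> 2 * card (hues - {h})" using sum_mono[of "hues - {h}" "\<lambda>h'. hdeg h' w" "\<lambda>_. 2"] d2 by simp
  finally have "card (nbhd w) \<le> 4" using c2 by linarith
  then show False using excess_nonneg[OF w(1)] N1(1) unfolding excess_def by simp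
qed

text \<open>For spanning hues with total waste \<open>B h\<close>, summing the slacks at
  \<open>w\<close> gives \<open>(\<Sum>h\<in>hues. 2 - B h) \<ge> 3\<close>. Only hues with
  \<open>B h \<le> 1\<close> contribute positively, and these have at least \<open>n\<close> edges,
  so there are exactly two, with waste at most one together. A third hue would cost at least
  \<open>n - 2\<close> more, which is too much.\<close>

lemma two_hues:
  obtains h1 h2 where "hues = {h1, h2}" "h1 \<noteq> h2" "(\<Sum>v\<in>V. waste h1 v) = 0" "(\<Sum>v\<in>V. waste h2 v) \<le> 1"
    "card V \<le> card (edges_of h1)" "card V \<le> card (edges_of h2)" "4 \<le> k"
proof -
  define B where "B h = (\<Sum>v\<in>V. waste h v)" for h
  define S where "S = {h \<in> hues. B h \<le> 1}"
  have S: "S \<subseteq> hues" "finite S" unfolding S_def by auto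
  have big: "card V \<le> card (edges_of h)" if "h \<in> S" for h
  proof (rule card_edges_of_ge_if_few_leaves)
    show "h \<in> hues" "verts_of h = V" "(\<Sum>v\<in>V. waste h v) \<le> 1" using that spanning unfolding S_def B_def by auto
  qed (rule n4)
  have c2: "card S \<le> 2" by (rule few_large[OF S(1) big])
  obtain w where w: "w \<in> V" using V_nonempty by blast
  have Tw: "slack h w = int (hdeg h w) - int (waste h w) + int (B h) - 2" if "h \<in> hues" for h
  proof -
    have "int (B h) = int (waste h w) + (\<Sum>v\<in>V - {w}. int (waste h v))"
      using sum.remove[OF finV w, of "waste h"] unfolding B_def by simp
    moreover have "w \<in> verts_of h" using spanning[OF that] w by simp
    ultimately show ?thesis unfolding slack_def by simp
  qed
  have "(\<Sum>h\<in>hues. int (hdeg h w)) - (\<Sum>h\<in>hues. int (waste h w)) \<ge> int k"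
    using excess_ge_waste[OF w] unfolding excess_def card_nbhd by simp
  moreover have "(\<Sum>h\<in>hues. slack h w) = (\<Sum>h\<in>hues. int (hdeg h w)) - (\<Sum>h\<in>hues. int (waste h w)) - (\<Sum>h\<in>hues. 2 - int (B h))"
    unfolding sum_subtractf[symmetric] using Tw by (intro sum.cong) auto
  ultimately have "3 \<le> (\<Sum>h\<in>hues. 2 - int (B h))" using slack_sum[OF w] by linarith
  also have "(\<Sum>h\<in>hues. 2 - int (B h)) = (\<Sum>h\<in>hues - S. 2 - int (B h)) + (\<Sum>h\<in>S. 2 - int (B h))"
    by (rule sum.subset_diff[OF S(1) finite_hues])
  also have "(\<Sum>h\<in>hues - S. 2 - int (B h)) \<le> 0" by (rule sum_nonpos) (auto simp: S_def)
  finally have s3: "3 \<le> (\<Sum>h\<in>S. 2 - int (B h))" by simp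
  moreover have "(\<Sum>h\<in>S. 2 - int (B h)) \<le> (\<Sum>h\<in>S. 2)" by (rule sum_mono) simp
  ultimately have "card S = 2" using c2 by simp
  then obtain a b where ab: "S = {a, b}" "a \<noteq> b" by (auto simp: card_2_iff)
  have sab: "3 \<le> (2 - int (B a)) + (2 - int (B b))" using s3 ab by simp
  have cost: "2 * (card V - 1) + (\<Sum>h\<in>hues - S. card (edges_of h) - 1) \<le> cost"
    using cost_ge[OF S(1) big] \<open>card S = 2\<close> by simp
  have k4: "4 \<le> k"
  proof (rule ccontr)
    assume "\<not> 4 \<le> k"
    then have "k = 3" using k3 by linarith
    then show False using cost cheap n4 by simp
  qed
  have "hues = S"
  proof (rule ccontr)
    assume "hues \<noteq> S"
    then obtain h where h: "h \<in> hues - S" using S by blast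
    then have le: "card (edges_of h) - 1 \<le> (\<Sum>h\<in>hues - S. card (edges_of h) - 1)" by (intro member_le_sum) auto
    have f: "card V - 1 \<le> card (edges_of h)" "2 \<le> card (edges_of h)"
      using spanning_card_edges_of_ge spanning h unfolding hues_def by auto
    show False
    proof (cases "k = 4")
      case True
      then show ?thesis using cost le f cheap n4 by simp
    next
      case False
      then have "k = 5" using k4 k5 by linarith
      then show ?thesis using cost le f cheap n7 by simp
    qed
  qed
  then have hsab: "hues = {a, b}" using ab by simp
  show ?thesis
  proof (cases "B a = 0")
    case True
    then show ?thesis using that[of a b] hsab ab big k4 unfolding S_def B_def by auto
  next
    case False
    then have "B b = 0" using sab by linarith
    then show ?thesis using that[of b a] hsab ab big k4 unfolding S_def B_def by auto
  qed
qed

end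

section \<open>Excluding two spanning hues\<close>

context cheap_colouring
begin

lemma nbhd_sym: "u \<in> nbhd v \<longleftrightarrow> v \<in> nbhd u"
  unfolding nbhd_def using nbrs_sym by blast

lemma leafless_hdeg:
  assumes "h \<in> hues" "(\<Sum>v\<in>V. waste h v) = 0" "v \<in> V"
  shows "2 \<le> hdeg h v"
proof (rule ccontr)
  assume "\<not> 2 \<le> hdeg h v"
  moreover have "0 < hdeg h v" using hdeg_pos_iff[of h v] spanning assms by auto
  ultimately have d: "hdeg h v = 1" by linarith
  then obtain x where x: "nbrs h v = {x}" unfolding hdeg_def by (auto simp: card_1_singleton_iff)
  then have "v \<in> leaves_at h x" using d nbrs_sym[of x h v] unfolding leaves_at_def by auto
  then have "1 \<le> waste h x" using waste_pos assms by blast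
  moreover have "x \<in> V" using x nbrs_subset by blast
  ultimately show False using assms(2) finV by auto
qed

lemma excess_total:
  assumes "hues = {a, b}" "a \<noteq> b"
  shows "(\<Sum>v\<in>V. excess v) \<le> 1"
  using excess_sum assms by simp

lemma excess_two:
  assumes "hues = {a, b}" "a \<noteq> b" "x \<in> V" "y \<in> V" "x \<noteq> y"
  shows "excess x + excess y \<le> 1"
proof -
  have "(\<Sum>v\<in>{x, y}. excess v) \<le> (\<Sum>v\<in>V. excess v)"
    by (rule sum_mono2) (use assms finV excess_nonneg in auto)
  then show ?thesis using excess_total[OF assms(1,2)] assms by simp
qed

lemma exists_other: "x \<in> V \<Longrightarrow> \<exists>y\<in>V. y \<noteq> x"
proof (rule ccontr)
  assume "\<not> (\<exists>y\<in>V. y \<noteq> x)"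
  then have "V \<subseteq> {x}" by blast
  then have "card V \<le> card {x}" by (intro card_mono) auto
  then show False using n4 by simp
qed

lemma not_cycle:
  assumes hues: "hues = {a, b}" "a \<noteq> b" and k4: "4 \<le> k"
  shows "\<exists>p\<in>V. hdeg a p \<noteq> 2"
proof (rule ccontr)
  assume "\<not> (\<exists>p\<in>V. hdeg a p \<noteq> 2)"
  then have pos: "1 \<le> excess v" if "v \<in> V" for v
    using cycle_no_tight[of a b v] spanning hues k4 that by blast
  obtain x where x: "x \<in> V" using V_nonempty by blast
  obtain y where y: "y \<in> V" "y \<noteq> x" using exists_other[OF x] by blast
  then show False using excess_two[OF hues y(1) x y(2)] pos[OF x] pos[OF y(1)] by linarith
qed

text \<open>
  At a tight vertex (excess zero) the two degrees are 2 and 3, and by \<open>tight_hdeg_le\<close> tight neighbours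
  have the same degrees; at most one vertex is not tight.
\<close>

lemma one_type_impossible:
  assumes hues: "hues = {a, b}" "a \<noteq> b" and k: "k = 5"
    and d: "\<And>v. v \<in> V \<Longrightarrow> 2 \<le> hdeg a v" "\<And>v. v \<in> V \<Longrightarrow> 2 \<le> hdeg b v"
    and type: "\<And>v. v \<in> V \<Longrightarrow> excess v = 0 \<Longrightarrow> hdeg a v = 2"
  shows False
proof -
  have sum: "int (hdeg a v) + int (hdeg b v) = 5 + excess v" for v
    using hues k unfolding excess_def card_nbhd by simp
  obtain p where p: "p \<in> V" "hdeg a p \<noteq> 2" using not_cycle[OF hues] k by auto
  then have "1 \<le> excess p" using type excess_nonneg[of p] by fastforce
  then have tight: "excess v = 0" if "v \<in> V" "v \<noteq> p" for v
    using excess_two[OF hues _ _ that(2), OF that(1) p(1)] excess_nonneg[OF that(1)] by linarith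
  obtain u where u: "u \<in> V" "u \<noteq> p" using exists_other[OF p(1)] by blast
  then have ep: "excess p = 1" using excess_two[OF hues u(1) p(1) u(2)] tight[OF u] \<open>1 \<le> excess p\<close> by linarith
  \<comment> \<open>Apart from \<open>p\<close> all degrees in \<open>a\<close> are two, so the
    degree of \<open>p\<close> is even. This rules out 3 and pushes the degree of \<open>p\<close>
    in \<open>b\<close> down to at most two, below that of its tight neighbours.\<close>
  have "2 * card (edges_of a) = hdeg a p + (\<Sum>v\<in>V - {p}. hdeg a v)"
    using handshake[of a] sum.remove[OF finV p(1), of "hdeg a"] by simp
  also have "(\<Sum>v\<in>V - {p}. hdeg a v) = (\<Sum>v\<in>V - {p}. 2)" using tight type by (intro sum.cong) auto
  finally have "2 * card (edges_of a) = hdeg a p + 2 * card (V - {p})" by simp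
  then have "hdeg a p = 2 * card (edges_of a) - 2 * card (V - {p})" by linarith
  then have "even (hdeg a p)" by simp
  then have "hdeg a p \<noteq> 3" by auto
  moreover have "3 \<le> hdeg a p" using p d(1)[OF p(1)] by linarith
  ultimately have "4 \<le> hdeg a p" by linarith
  then have bp: "hdeg b p \<le> 2" using sum[of p] ep by linarith
  obtain v where v: "v \<in> nbhd p" using nbhd_nonempty[OF p(1)] by blast
  then have vV: "v \<in> V" "v \<noteq> p" using nbhd_subset by auto
  have "hdeg b v \<le> hdeg b p"
    by (rule tight_hdeg_le) (use hues vV tight[OF vV] v nbhd_sym in auto)
  moreover have "hdeg b v = 3" using sum[of v] tight[OF vV] type[OF vV(1)] by simp
  ultimately show False using bp by simp
qed

text \<open>Both types of tight vertices occur. A path from \<open>x\<close> to \<open>y\<close>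
  leaves the type of \<open>x\<close> at a vertex that is not tight and is not \<open>y\<close>,
  because tight vertices bound the degrees of their neighbours from below. Disjoint paths need
  different such vertices, but there is at most one.\<close>

lemma leafless_pair_impossible:
  assumes hues: "hues = {a, b}" "a \<noteq> b" and k: "k = 5"
    and d: "\<And>v. v \<in> V \<Longrightarrow> 2 \<le> hdeg a v" "\<And>v. v \<in> V \<Longrightarrow> 2 \<le> hdeg b v"
  shows False
proof -
  have sum: "int (hdeg a v) + int (hdeg b v) = 5 + excess v" for v
    using hues k unfolding excess_def card_nbhd by simp
  have types: "hdeg a v = 2 \<and> hdeg b v = 3 \<or> hdeg a v = 3 \<and> hdeg b v = 2" if "v \<in> V" "excess v = 0" for v
    using sum[of v] d[OF that(1)] that(2) by linarith
  obtain y where y: "y \<in> V" "excess y = 0" "hdeg b y = 2"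
    using one_type_impossible[OF hues k d] types by fastforce
  have hs': "hues = {b, a}" "b \<noteq> a" using hues by auto
  obtain x where x: "x \<in> V" "excess x = 0" "hdeg a x = 2"
    using one_type_impossible[OF hs' k d(2,1)] types by fastforce
  define X where "X = {v \<in> V. excess v = 0 \<and> hdeg a v = 2}"
  have xX: "x \<in> X" "y \<notin> X" using x y types[OF y(1,2)] unfolding X_def by auto
  then obtain U I where L: "linkage x y U I" using links x(1) y(1) by blast
  have "\<exists>z. z \<in> I t \<and> z \<in> V \<and> 1 \<le> excess z" if t: "t \<in> U" for t
  proof -
    obtain z z' where z: "z \<in> X" "z' \<in> nbrs (f {x, t}) z" "z' \<in> insert y (I t)" "z' \<notin> X"
      using linkageD(8)[OF L t xX] by blast
    have z'N: "z' \<in> nbhd z" "z' \<in> V" using z linkageD(5)[OF L t] nbrs_subset unfolding nbhd_def by blast+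
    have zV: "z \<in> V" "excess z = 0" "hdeg a z = 2" using z(1) unfolding X_def by auto
    then have "hdeg b z = 3" using types by fastforce
    moreover have "b \<in> hues" using hues by simp
    ultimately have "3 \<le> hdeg b z'" using tight_hdeg_le[OF _ zV(1,2) z'N(1), of b] by simp
    then have "z' \<noteq> y" "excess z' \<noteq> 0" using y types[OF z'N(2)] z(4) z'N(2) unfolding X_def by auto
    then show ?thesis using z(3) z'N(2) excess_nonneg[OF z'N(2)] by force
  qed
  then obtain g where g: "\<And>t. t \<in> U \<Longrightarrow> g t \<in> I t \<and> g t \<in> V \<and> 1 \<le> excess (g t)" by metis
  have "\<not> card U \<le> 1" using linkage_card(1)[OF L] k by linarith
  then obtain s t where st: "s \<in> U" "t \<in> U" "s \<noteq> t"
    using linkage_card(2)[OF L] card_le_Suc0_iff_eq[of U] by auto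
  then have "g s \<noteq> g t" using linkage_disjoint[OF L st(1,2), of "g s"] g by auto
  then show False using excess_two[OF hues, of "g s" "g t"] g[OF st(1)] g[OF st(2)] by linarith
qed

text \<open>The neighbour \<open>x\<close> of the leaf in \<open>b\<close> wastes an edge and is not
  tight. A neighbour \<open>v\<close> of the leaf in \<open>a\<close> is not tight either: its paths
  of hue \<open>b\<close> all arrive through \<open>x\<close>, so at most one of its two or more
  edges in \<open>b\<close> is used. Two such vertices exceed the total excess.\<close>

lemma one_leaf_impossible:
  assumes hues: "hues = {a, b}" "a \<noteq> b"
    and B: "(\<Sum>v\<in>V. waste b v) \<le> 1" and l: "l \<in> V" "hdeg b l = 1"
  shows False
proof -
  have h: "a \<in> hues" "b \<in> hues" using hues by auto
  obtain x where x: "nbrs b l = {x}" using l unfolding hdeg_def by (auto simp: card_1_singleton_iff)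
  then have "l \<in> leaves_at b x" using l nbrs_sym[of x b l] unfolding leaves_at_def by auto
  then have "1 \<le> waste b x" using waste_pos h by blast
  moreover have xV: "x \<in> V" using x nbrs_subset by blast
  moreover have "waste b x \<le> (\<Sum>h\<in>hues. waste h x)" using h by (intro member_le_sum) auto
  ultimately have ex1: "1 \<le> excess x" using excess_ge_waste[OF xV] by linarith
  obtain v where v: "v \<in> nbrs a l" using spanning[OF h(1)] l(1) unfolding verts_of_def by auto
  then have vx: "v \<noteq> x" using x nbrs_hue_unique hues by blast
  have vV: "v \<in> V" "v \<noteq> l" using v nbrs_subset by auto
  have lN: "l \<in> nbhd v" using v nbrs_sym h unfolding nbhd_def by blast
  have "hdeg b v \<noteq> 1"
    using two_leaves[OF h(2) _ l(2), of v] vV B spanning[OF h(2)] n4 by auto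
  moreover have "0 < hdeg b v" using hdeg_pos_iff[of b v] spanning[OF h(2)] vV by simp
  ultimately have d2: "2 \<le> hdeg b v" by linarith
  obtain U I where L: "linkage v l U I" using links vV l(1) by blast
  have "card {y \<in> U. f {v, y} = b} \<le> card (nbrs b l - {v})" by (rule used_le[OF L])
  also have "\<dots> \<le> 1" using x by (simp add: card_Diff_subset_Int)
  finally have u1: "card {y \<in> U. f {v, y} = b} \<le> 1" .
  have "l \<notin> nbrs b v" using v nbrs_sym nbrs_hue_unique hues by blast
  then have "nbrs b v - {y \<in> U. f {v, y} = b} \<subseteq> nbhd v - {l} - U"
    using h(2) unfolding nbhd_def nbrs_def by auto
  then have "int (card (nbrs b v - {y \<in> U. f {v, y} = b})) \<le> excess v" using unused[OF L vV(1)] lN by simp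
  moreover have "hdeg b v - card {y \<in> U. f {v, y} = b} \<le> card (nbrs b v - {y \<in> U. f {v, y} = b})"
    unfolding hdeg_def by (rule diff_card_le_card_Diff) (use linkage_card(2)[OF L] in simp)
  ultimately have "1 \<le> excess v" using u1 d2 by linarith
  then show False using excess_two[OF hues vV(1) xV vx] ex1 by linarith
qed

theorem impossible: False
proof -
  obtain a b where hues: "hues = {a, b}" "a \<noteq> b" and Ba: "(\<Sum>v\<in>V. waste a v) = 0"
    and Bb: "(\<Sum>v\<in>V. waste b v) \<le> 1" and big: "card V \<le> card (edges_of a)" "card V \<le> card (edges_of b)" and k4: "4 \<le> k"
    using two_hues by metis
  have h: "a \<in> hues" "b \<in> hues" using hues by auto
  have da: "2 \<le> hdeg a v" if "v \<in> V" for v using leafless_hdeg[OF h(1) Ba that] .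
  show False
  proof (cases "k = 4")
    case True
    have "2 * int cost = 2 * int (card (edges_of a)) + 2 * int (card (edges_of b)) - 4" unfolding cost_eq using hues by simp
    \<comment> \<open>\<open>2 cost \<le> 4n - 3\<close> and parity allow at most \<open>2n\<close>
      edges in both hues together, so each has exactly \<open>n\<close>. As all degrees in
      \<open>a\<close> are at least two, \<open>a\<close> would be a cycle.\<close>
    then have fa: "card (edges_of a) = card V" using cheap True big by simp
    obtain p where p: "p \<in> V" "hdeg a p \<noteq> 2" using not_cycle[OF hues k4] by blast
    have "(\<Sum>v\<in>V - {p}. 2) \<le> (\<Sum>v\<in>V - {p}. hdeg a v)" using da by (intro sum_mono) auto
    then have "2 * card (V - {p}) + 3 \<le> (\<Sum>v\<in>V. hdeg a v)"
      using sum.remove[OF finV p(1), of "hdeg a"] da[OF p(1)] p(2) by simp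
    then show False using handshake[of a] fa p(1) finV n4 by simp
  next
    case False
    then have k: "k = 5" using k4 k5 by linarith
    show False
    proof (cases "\<exists>l\<in>V. hdeg b l = 1")
      case True
      then show False using one_leaf_impossible[OF hues Bb] by blast
    next
      case False
      have "2 \<le> hdeg b v" if "v \<in> V" for v
      proof -
        have "0 < hdeg b v" using hdeg_pos_iff[of b v] spanning[OF h(2)] that by simp
        moreover have "hdeg b v \<noteq> 1" using False that by blast
        ultimately show ?thesis by linarith
      qed
      then show False using leafless_pair_impossible[OF hues k da] by blast
    qed
  qed
qed

end

section \<open>From edge-colourings to connected hues\<close>

text \<open>A class with \<open>e\<close> edges loses \<open>e - 1\<close> colours against pairwise
  distinct ones; classes with one edge lose nothing, so summing over \<open>hues\<close> is
  enough.\<close>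

lemma (in linked_colouring) card_hues: "card (f ` complete_edges V) + cost = card (complete_edges V)"
proof -
  have "complete_edges V = (\<Union>h\<in>f ` complete_edges V. edges_of h)" unfolding edges_of_def by auto
  then have "card (complete_edges V) = card (\<Union>h\<in>f ` complete_edges V. edges_of h)" by simp
  also have "\<dots> = (\<Sum>h\<in>f ` complete_edges V. card (edges_of h))"
    by (rule card_UN_disjoint) (use finite_edges in \<open>auto simp: edges_of_def\<close>)
  also have "\<dots> = (\<Sum>h\<in>f ` complete_edges V. 1 + (card (edges_of h) - 1))"
  proof (rule sum.cong)
    fix h assume "h \<in> f ` complete_edges V"
    then have "edges_of h \<noteq> {}" unfolding edges_of_def by auto
    then have "0 < card (edges_of h)" by (simp add: card_gt_0_iff)
    then show "card (edges_of h) = 1 + (card (edges_of h) - 1)" by simp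
  qed simp
  also have "\<dots> = card (f ` complete_edges V) + (\<Sum>h\<in>f ` complete_edges V. card (edges_of h) - 1)"
    by (simp only: sum.distrib card_eq_sum)
  also have "(\<Sum>h\<in>f ` complete_edges V. card (edges_of h) - 1) = cost"
    unfolding cost_def
  proof (rule sum.mono_neutral_right)
    show "hues \<subseteq> f ` complete_edges V"
    proof
      fix h assume "h \<in> hues"
      then have "edges_of h \<noteq> {}" unfolding hues_def by auto
      then show "h \<in> f ` complete_edges V" unfolding edges_of_def by auto
    qed
  qed (use finite_edges in \<open>auto simp: hues_def\<close>)
  finally show ?thesis by simp
qed

lemma path_ends:
  assumes "is_path V E v u p"
  shows "p ! 0 = v" "p ! (length p - 1) = u" "2 \<le> length p"
proof -
  have p: "2 \<le> length p" "hd p = v" "last p = u" using assms unfolding is_path_def by auto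
  then have "p \<noteq> []" by auto
  then show "p ! 0 = v" "p ! (length p - 1) = u" "2 \<le> length p"
    using p by (simp_all add: hd_conv_nth last_conv_nth)
qed

lemma interior_nth:
  assumes "is_path V E v u p"
  shows "interior p = {p ! i | i. 0 < i \<and> Suc i < length p}"
proof -
  obtain q where p: "p = v # q" "q \<noteq> []" using assms unfolding is_path_def
    by (cases p) (auto simp: Suc_le_eq)
  have "interior p = {q ! i | i. i < length q - 1}"
    unfolding interior_def using p by (auto simp: butlast_conv_take nth_image[symmetric])
  also have "\<dots> = {p ! i | i. 0 < i \<and> Suc i < length p}"
  proof (intro equalityI subsetI)
    fix x assume "x \<in> {q ! i | i. i < length q - 1}"
    then obtain i where i: "i < length q - 1" "x = q ! i" by blast
    then have "x = p ! Suc i \<and> 0 < Suc i \<and> Suc (Suc i) < length p" using p by auto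
    then show "x \<in> {p ! i | i. 0 < i \<and> Suc i < length p}" by blast
  next
    fix x assume "x \<in> {p ! i | i. 0 < i \<and> Suc i < length p}"
    then obtain i where i: "0 < i" "Suc i < length p" "x = p ! i" by blast
    then have "x = q ! (i - 1) \<and> i - 1 < length q - 1" using p by (auto simp: nth_Cons')
    then show "x \<in> {q ! i | i. i < length q - 1}" by blast
  qed
  finally show ?thesis .
qed

lemma path_interior:
  assumes p: "is_path V E v u p"
  shows "interior p \<subseteq> V - {u, v}" "\<And>i. i < length p \<Longrightarrow> p ! i \<in> insert u (insert v (interior p))"
proof -
  have d: "distinct p" "set p \<subseteq> V" using p unfolding is_path_def by auto
  note e = path_ends[OF p]
  show "interior p \<subseteq> V - {u, v}"
  proof
    fix x assume "x \<in> interior p"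
    then obtain i where i: "0 < i" "Suc i < length p" "x = p ! i" using interior_nth[OF p] by blast
    moreover from i have "p \<noteq> []" by auto
    ultimately have "x \<noteq> p ! 0" "x \<noteq> p ! (length p - 1)"
      using nth_eq_iff_index_eq[OF d(1), of i 0] nth_eq_iff_index_eq[OF d(1), of i "length p - 1"] by auto
    moreover have "x \<in> V" using i d(2) by auto
    ultimately show "x \<in> V - {u, v}" using e by auto
  qed
  fix i assume i: "i < length p"
  consider "i = 0" | "i = length p - 1" | "0 < i" "Suc i < length p" using i by linarith
  then show "p ! i \<in> insert u (insert v (interior p))"
  proof cases
    case 3
    then show ?thesis using interior_nth[OF p] by blast
  qed (use e in auto)
qed

text \<open>The hue of an edge is its colour together with the vertex set of its monochromatic component.\<close>

definition hue_rel :: "'a set \<Rightarrow> ('a set \<Rightarrow> 'c) \<Rightarrow> 'c \<Rightarrow> ('a \<times> 'a) set" where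
  "hue_rel V c col = {(x, y). {x, y} \<in> complete_edges V \<and> c {x, y} = col}"

definition hue :: "'a set \<Rightarrow> ('a set \<Rightarrow> 'c) \<Rightarrow> 'a set \<Rightarrow> 'c \<times> 'a set" where
  "hue V c e = (c e, (hue_rel V c (c e))\<^sup>* `` e)"

lemma sym_hue_rel: "sym (hue_rel V c col)"
  unfolding hue_rel_def sym_def by (simp add: insert_commute)

lemma hue_class_eq:
  assumes "(x, y) \<in> hue_rel V c col"
  shows "(hue_rel V c col)\<^sup>* `` {x} = (hue_rel V c col)\<^sup>* `` {y}"
proof -
  have "(y, x) \<in> hue_rel V c col" using assms sym_hue_rel by (meson symE)
  then show ?thesis using assms by (auto intro: converse_rtrancl_into_rtrancl)
qed

lemma hue_nbrs_iff:
  "y \<in> colouring.nbrs V (hue V c) h v \<longleftrightarrow>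
     (v, y) \<in> hue_rel V c (fst h) \<and> snd h = (hue_rel V c (fst h))\<^sup>* `` {v}"
proof -
  have edge: "{v, y} \<in> complete_edges V \<longleftrightarrow> v \<in> V \<and> y \<in> V \<and> y \<noteq> v"
    unfolding complete_edges_def by (auto simp: doubleton_eq_iff)
  have "(hue_rel V c col)\<^sup>* `` {v, y} = (hue_rel V c col)\<^sup>* `` {v}" if "(v, y) \<in> hue_rel V c col" for col
    using hue_class_eq[OF that] by auto
  then show ?thesis
    unfolding colouring.nbrs_def hue_def using edge by (cases h) (auto simp: hue_rel_def)
qed

lemma hue_connected:
  assumes "x \<in> X" "x \<in> colouring.verts_of V (hue V c) h"
    and closed: "\<And>z. z \<in> X \<Longrightarrow> colouring.nbrs V (hue V c) h z \<subseteq> X"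
  shows "colouring.verts_of V (hue V c) h \<subseteq> X"
proof
  fix y assume y: "y \<in> colouring.verts_of V (hue V c) h"
  have verts_of: "snd h = (hue_rel V c (fst h))\<^sup>* `` {z}" if "z \<in> colouring.verts_of V (hue V c) h" for z
  proof -
    obtain y where "y \<in> colouring.nbrs V (hue V c) h z" using \<open>z \<in> _\<close> unfolding colouring.verts_of_def by auto
    then show ?thesis unfolding hue_nbrs_iff by blast
  qed
  have "y \<in> (hue_rel V c (fst h))\<^sup>* `` {x}" using verts_of[OF y] verts_of[OF assms(2)] by auto
  then have "(x, y) \<in> (hue_rel V c (fst h))\<^sup>*" by simp
  then have "y \<in> X \<and> snd h = (hue_rel V c (fst h))\<^sup>* `` {y}"
  proof (induction rule: rtrancl_induct)
    case base
    then show ?case using assms(1) verts_of[OF assms(2)] by simp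
  next
    case (step z z')
    then have "z' \<in> colouring.nbrs V (hue V c) h z" unfolding hue_nbrs_iff by blast
    then have "z' \<in> X" using closed[of z] step.IH by blast
    then show ?case using step.IH hue_class_eq[OF step.hyps(2)] by simp
  qed
  then show "y \<in> X" by simp
qed

text \<open>A monochromatic path stays in one component of its colour, so all its edges have the hue
  of the first.\<close>

lemma mono_path_nbrs:
  assumes p: "is_path V (complete_edges V) v u p" and mono: "monochromatic c p" and i: "Suc i < length p"
  shows "p ! Suc i \<in> colouring.nbrs V (hue V c) (hue V c {v, p ! 1}) (p ! i)"
proof -
  obtain col where col: "\<And>i. Suc i < length p \<Longrightarrow> c {p ! i, p ! Suc i} = col"
    using mono unfolding monochromatic_def by blast
  have rel: "(p ! i, p ! Suc i) \<in> hue_rel V c col" if "Suc i < length p" for i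
    using p col[OF that] that unfolding is_path_def hue_rel_def by auto
  have p0: "p ! 0 = v" and "2 \<le> length p" using path_ends[OF p] by auto
  then have c0: "c {v, p ! 1} = col" and r0: "(v, p ! 1) \<in> hue_rel V c col" using col[of 0] rel[of 0] by auto
  have "(hue_rel V c col)\<^sup>* `` {v, p ! 1} = (hue_rel V c col)\<^sup>* `` {v}"
    using hue_class_eq[OF r0] by auto
  then have h: "hue V c {v, p ! 1} = (col, (hue_rel V c col)\<^sup>* `` {v})"
    unfolding hue_def using c0 by simp
  have "(hue_rel V c col)\<^sup>* `` {p ! i} = (hue_rel V c col)\<^sup>* `` {v}" if "i < length p" for i
    using that
  proof (induction i)
    case (Suc i)
    then show ?case using hue_class_eq[OF rel[of i]] by simp
  qed (simp add: p0)
  then show ?thesis unfolding hue_nbrs_iff h using rel[OF i] i by simp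
qed

text \<open>At most one of the \<open>k\<close> paths is the direct edge. The others have an inner
  second vertex; by disjointness these vertices are distinct and can index the interiors.\<close>

lemma hue_linkage:
  assumes V: "finite V" "v \<in> V" "u \<in> V" "u \<noteq> v"
    and P: "finite P" "card P = k" "\<And>p. p \<in> P \<Longrightarrow> is_path V (complete_edges V) v u p \<and> monochromatic c p"
      "\<And>p q. p \<in> P \<Longrightarrow> q \<in> P \<Longrightarrow> p \<noteq> q \<Longrightarrow> interior p \<inter> interior q = {}"
  shows "\<exists>U I. colouring.linkage V (hue V c) k v u U I"
proof -
  define P0 where "P0 = {p \<in> P. 3 \<le> length p}"
  have fin0: "finite P0" unfolding P0_def using P by simp
  have "p = [v, u]" if "p \<in> P - P0" for p
  proof -
    have "is_path V (complete_edges V) v u p" using that P(3) unfolding P0_def by blast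
    moreover have "length p < 3" using that unfolding P0_def by auto
    ultimately have "length p = 2" "hd p = v" "last p = u" unfolding is_path_def by auto
    then show ?thesis by (cases p; cases "tl p") (auto split: if_splits)
  qed
  then have "P \<subseteq> insert [v, u] P0" by blast
  then have "card P \<le> card (insert [v, u] P0)" using fin0 by (intro card_mono) auto
  then have card0: "k - 1 \<le> card P0" using P(2) card_insert_le_m1[of "card P0 + 1"] fin0
    by (simp add: card_insert_if split: if_splits)
  have path: "is_path V (complete_edges V) v u p" "monochromatic c p" "3 \<le> length p" if "p \<in> P0" for p
    using that P(3) unfolding P0_def by auto
  have second: "p ! 1 \<in> interior p" if "p \<in> P0" for p
    using interior_nth[OF path(1)[OF that]] path(3)[OF that] by (auto intro!: exI[of _ 1])
  have inj: "inj_on (\<lambda>p. p ! 1) P0"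
  proof (rule inj_onI, rule ccontr)
    fix p q assume pq: "p \<in> P0" "q \<in> P0" "p ! 1 = q ! 1" "p \<noteq> q"
    then have "interior p \<inter> interior q = {}" using P(4) unfolding P0_def by auto
    then show False using second[OF pq(1)] second[OF pq(2)] pq(3) by auto
  qed
  define U where "U = (\<lambda>p. p ! 1) ` P0"
  define I where "I y = interior (inv_into P0 (\<lambda>p. p ! 1) y)" for y
  have I: "I (p ! 1) = interior p" if "p \<in> P0" for p
    unfolding I_def using inv_into_f_f[OF inj that] by simp
  have "colouring.linkage V (hue V c) k v u U I"
    unfolding colouring.linkage_def
  proof (intro conjI ballI allI impI)
    show "U \<subseteq> V" using second path_interior(1)[OF path(1)] unfolding U_def by blast
    show "k - 1 \<le> card U" unfolding U_def using card0 inj by (simp add: card_image)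
    show "I y \<inter> I z = {}" if yz: "y \<in> U" "z \<in> U" "y \<noteq> z" for y z
    proof -
      obtain p q where "p \<in> P0" "y = p ! 1" "q \<in> P0" "z = q ! 1" using yz unfolding U_def by blast
      then show ?thesis using I P(4)[of p q] yz(3) unfolding P0_def by auto
    qed
    fix y assume "y \<in> U"
    then obtain p where p: "p \<in> P0" "y = p ! 1" unfolding U_def by blast
    note pp = path[OF p(1)] and Ip = I[OF p(1), folded p(2)]
    note nbrs = mono_path_nbrs[OF pp(1,2), folded p(2)]
    note mem = path_interior(2)[OF pp(1), folded Ip]
    have sym: "a \<in> colouring.nbrs V (hue V c) h b \<Longrightarrow> b \<in> colouring.nbrs V (hue V c) h a" for a b h
      unfolding colouring.nbrs_def by (auto simp: insert_commute)
    show "y \<in> I y" "I y \<subseteq> V - {u, v}" using second[OF p(1)] path_interior(1)[OF pp(1)] p(2) Ip by auto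
    show "I y \<inter> colouring.nbrs V (hue V c) (hue V c {v, y}) u \<noteq> {}"
    proof -
      have l: "Suc (length p - 2) = length p - 1" "Suc (length p - 2) < length p" using pp(3) by auto
      have "u \<in> colouring.nbrs V (hue V c) (hue V c {v, y}) (p ! (length p - 2))"
        using nbrs[OF l(2)] l(1) path_ends(2)[OF pp(1)] by simp
      moreover have "p ! (length p - 2) \<in> I y"
        unfolding Ip interior_nth[OF pp(1)] using pp(3) l(2) by (intro CollectI exI[of _ "length p - 2"]) auto
      ultimately show ?thesis using sym by blast
    qed
    show "2 \<le> card (colouring.nbrs V (hue V c) (hue V c {v, y}) x \<inter> insert u (insert v (I y)))" if x: "x \<in> I y" for x
    proof -
      obtain i where i: "0 < i" "Suc i < length p" "x = p ! i" using x interior_nth[OF pp(1)] unfolding Ip by blast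
      have "p ! (i - 1) \<in> colouring.nbrs V (hue V c) (hue V c {v, y}) x"
        using nbrs[of "i - 1"] i sym by simp
      moreover have "p ! Suc i \<in> colouring.nbrs V (hue V c) (hue V c {v, y}) x" using nbrs[of i] i by simp
      ultimately have "{p ! (i - 1), p ! Suc i} \<subseteq>
          colouring.nbrs V (hue V c) (hue V c {v, y}) x \<inter> insert u (insert v (I y))"
        using mem[of "i - 1"] mem[of "Suc i"] i by auto
      moreover have "p ! (i - 1) \<noteq> p ! Suc i"
        using pp(1) i unfolding is_path_def by (simp add: nth_eq_iff_index_eq)
      moreover have "finite (colouring.nbrs V (hue V c) (hue V c {v, y}) x)"
        by (rule finite_subset[OF _ V(1)]) (auto simp: colouring.nbrs_def)
      ultimately show ?thesis using card_mono[of "colouring.nbrs V (hue V c) (hue V c {v, y}) x \<inter> insert u (insert v (I y))" "{p ! (i - 1), p ! Suc i}"]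
        by simp
    qed
    show "\<exists>z\<in>X \<inter> insert v (I y). colouring.nbrs V (hue V c) (hue V c {v, y}) z \<inter> insert u (I y) - X \<noteq> {}"
      if X: "v \<in> X" "u \<notin> X" for X
    proof -
      \<comment> \<open>The first position outside \<open>X\<close>; the vertex just before it is
        the crossing point.\<close>
      define Q where "Q j \<longleftrightarrow> j < length p \<and> p ! j \<notin> X" for j
      have "Q (length p - 1)" unfolding Q_def using path_ends[OF pp(1)] X pp(3) by auto
      then have Qj: "Q (Least Q)" by (rule LeastI)
      define j where "j = Least Q"
      have "j \<noteq> 0" using Qj X path_ends(1)[OF pp(1)] unfolding Q_def j_def by metis
      then obtain i where i: "j = Suc i" by (cases j) auto
      have "\<not> Q i" using not_less_Least[of i Q] i unfolding j_def by simp
      then have iX: "p ! i \<in> X" "Suc i < length p" "p ! Suc i \<notin> X" using Qj i unfolding Q_def j_def by auto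
      have "p ! i \<noteq> u" "p ! Suc i \<noteq> v" using iX X by auto
      then have "p ! i \<in> insert v (I y)" "p ! Suc i \<in> insert u (I y)"
        using mem[of i] mem[of "Suc i"] iX by auto
      then show ?thesis using nbrs[OF iX(2)] iX by blast
    qed
  qed
  then show ?thesis by blast
qed

lemma hue_linked_colouring:
  assumes "2 \<le> k" "k < n" and c: "mono_k_connected k (Kn_V n) (Kn_E n) c"
  shows "linked_colouring {0..<n} (hue {0..<n} c) k"
proof
  show "finite {0..<n}" "2 \<le> k" "k < card {0..<n}" using assms by auto
  show "colouring.verts_of {0..<n} (hue {0..<n} c) h \<subseteq> X"
    if "x \<in> X" "x \<in> colouring.verts_of {0..<n} (hue {0..<n} c) h"
      "\<And>z. z \<in> X \<Longrightarrow> colouring.nbrs {0..<n} (hue {0..<n} c) h z \<subseteq> X" for h x X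
    by (rule hue_connected[OF that])
  show "\<exists>U I. colouring.linkage {0..<n} (hue {0..<n} c) k v u U I"
    if vu: "v \<in> {0..<n}" "u \<in> {0..<n}" "u \<noteq> v" for v u
  proof -
    obtain P where "finite P" "card P = k"
      "\<forall>p\<in>P. is_path {0..<n} (complete_edges {0..<n}) v u p \<and> monochromatic c p"
      "\<forall>p\<in>P. \<forall>q\<in>P. p \<noteq> q \<longrightarrow> interior p \<inter> interior q = {}"
      using c[unfolded mono_k_connected_def Kn_V_def Kn_E_def, rule_format, OF vu(1,2) vu(3)[symmetric]] by blast
    then show ?thesis by (intro hue_linkage[of "{0..<n}" v u P k c]) (use vu in auto)
  qed
qed

lemma mc_Kn_upper:
  assumes k: "2 \<le> k" "k < n"
  obtains cost where "mc k (Kn_V n) (Kn_E n) + cost \<le> n choose 2"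
    "int (k - 1) * int n * int (n - 1) \<le> 2 * int (n - 2) * (int cost + 1)"
    "k \<le> 5 \<Longrightarrow> (k = 5 \<Longrightarrow> 7 \<le> n) \<Longrightarrow> int k * int n - 2 \<le> 2 * int cost"
proof -
  have fin: "finite (Kn_E n)" unfolding Kn_E_def by (simp add: finite_complete_edges)
  obtain c where c: "mono_k_connected k (Kn_V n) (Kn_E n) c"
    and mc: "mc k (Kn_V n) (Kn_E n) = card (c ` Kn_E n)"
    using mc_bounds(2)[OF fin] mc_Kn_lower(2)[OF k] by blast
  interpret L: linked_colouring "{0..<n}" "hue {0..<n} c" k by (rule hue_linked_colouring[OF k c])
  have "c ` Kn_E n = fst ` hue {0..<n} c ` complete_edges {0..<n}"
    unfolding Kn_E_def image_image hue_def by simp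
  then have "card (c ` Kn_E n) \<le> card (hue {0..<n} c ` complete_edges {0..<n})"
    using L.finite_edges by (simp add: card_image_le)
  then have 1: "mc k (Kn_V n) (Kn_E n) + L.cost \<le> n choose 2"
    using L.card_hues card_complete_edges[of "{0..<n}"] mc by simp
  have 3: "int k * int n - 2 \<le> 2 * int L.cost" if "k \<le> 5" "k = 5 \<Longrightarrow> 7 \<le> n"
  proof (rule ccontr)
    assume "\<not> ?thesis"
    then have "cheap_colouring {0..<n} (hue {0..<n} c) k"
      using that by unfold_locales auto
    then show False by (rule cheap_colouring.impossible)
  qed
  show ?thesis using that[OF 1 _ 3] L.cost_bound_general by simp
qed

section \<open>Passing to the ceilings of the statement\<close>

lemma mc_Kn_ge:
  assumes k: "2 \<le> k" "k < n"
  shows "int (n choose 2) - \<lceil>real (k * n) / 2\<rceil> + 1 \<le> int (mc k (Kn_V n) (Kn_E n))"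
proof -
  have "2 * card (harary n k) \<le> k * n + 1" by (rule card_harary)
  then have "2 * real (card (harary n k)) \<le> real (k * n) + 1" by linarith
  then have "of_int (int (card (harary n k)) - 1) < real (k * n) / 2" by simp
  then have "int (card (harary n k)) - 1 < \<lceil>real (k * n) / 2\<rceil>" by (simp only: less_ceiling_iff)
  then show ?thesis using mc_Kn_lower(1)[OF k] by linarith
qed

lemma mc_Kn_le:
  assumes k: "2 \<le> k" "k < n"
  shows "int (mc k (Kn_V n) (Kn_E n)) \<le>
    int (n choose 2) - \<lceil>real ((k - 1) * n * (n - 1)) / (2 * real (n - 2))\<rceil> + 1"
proof -
  obtain cost where c: "mc k (Kn_V n) (Kn_E n) + cost \<le> n choose 2"
    "int (k - 1) * int n * int (n - 1) \<le> 2 * int (n - 2) * (int cost + 1)"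
    using mc_Kn_upper[OF k] by metis
  have "int ((k - 1) * n * (n - 1)) \<le> int (2 * (n - 2) * (cost + 1))"
    using c(2) by (simp only: of_nat_mult of_nat_add of_nat_1 of_nat_numeral)
  then have "(k - 1) * n * (n - 1) \<le> 2 * (n - 2) * (cost + 1)" by (simp only: of_nat_le_iff)
  then have "real ((k - 1) * n * (n - 1)) \<le> real (2 * (n - 2) * (cost + 1))" by (simp only: of_nat_le_iff)
  also have "\<dots> = of_int (int cost + 1) * (2 * real (n - 2))"
    by (simp only: of_nat_mult of_nat_add of_nat_1 of_nat_numeral of_int_add of_int_1 of_int_of_nat_eq mult.commute)
  finally have "real ((k - 1) * n * (n - 1)) / (2 * real (n - 2)) \<le> of_int (int cost + 1)"
    using k by (subst pos_divide_le_eq) auto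
  then have "\<lceil>real ((k - 1) * n * (n - 1)) / (2 * real (n - 2))\<rceil> \<le> int cost + 1" by (simp only: ceiling_le_iff)
  then show ?thesis using c(1) by linarith
qed

lemma mc_Kn_le_small:
  assumes k: "2 \<le> k" "k < n" "k \<le> 5"
  shows "int (mc k (Kn_V n) (Kn_E n)) \<le> int (n choose 2) - \<lceil>real (k * n) / 2\<rceil> + 1"
proof (cases "k = 5 \<and> n = 6")
  \<comment> \<open>Here both ceilings equal 15, so the upper bound of (a) suffices.\<close>
  case True
  then show ?thesis using mc_Kn_le[OF k(1,2)] by simp
next
  case False
  then have n7: "k = 5 \<Longrightarrow> 7 \<le> n" using k by linarith
  obtain cost where c: "mc k (Kn_V n) (Kn_E n) + cost \<le> n choose 2"
    "int k * int n - 2 \<le> 2 * int cost"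
    using mc_Kn_upper[OF k(1,2)] k(3) n7 by metis
  have "real_of_int (int k * int n - 2) \<le> real_of_int (2 * int cost)" using c(2) by (simp only: of_int_le_iff)
  then have "real (k * n) / 2 \<le> of_int (int cost + 1)" by simp
  then have "\<lceil>real (k * n) / 2\<rceil> \<le> int cost + 1" by (simp only: ceiling_le_iff)
  then show ?thesis using c(1) by linarith
qed

theorem theorem4p2:
  shows "(\<forall>n k::nat. n > k \<and> k \<ge> 2 \<longrightarrow>
            int (n choose 2) - \<lceil>real (k * n) / 2\<rceil> + 1 \<le> int (mc k (Kn_V n) (Kn_E n)) \<and>
            int (mc k (Kn_V n) (Kn_E n)) \<le>
              int (n choose 2) - \<lceil>real ((k - 1) * n * (n - 1)) / (2 * real (n - 2))\<rceil> + 1)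
       \<and> (\<forall>n k::nat. n > k \<and> k \<in> {2, 3, 4, 5} \<longrightarrow>
            int (mc k (Kn_V n) (Kn_E n)) = int (n choose 2) - \<lceil>real (k * n) / 2\<rceil> + 1)"
proof (intro conjI allI impI)
  fix n k :: nat
  assume "k < n \<and> 2 \<le> k"
  then have k: "2 \<le> k" "k < n" by auto
  show "int (n choose 2) - \<lceil>real (k * n) / 2\<rceil> + 1 \<le> int (mc k (Kn_V n) (Kn_E n))" by (rule mc_Kn_ge[OF k])
  show "int (mc k (Kn_V n) (Kn_E n)) \<le>
      int (n choose 2) - \<lceil>real ((k - 1) * n * (n - 1)) / (2 * real (n - 2))\<rceil> + 1" by (rule mc_Kn_le[OF k])
next
  fix n k :: nat
  assume "k < n \<and> k \<in> {2, 3, 4, 5}"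
  then have k: "2 \<le> k" "k < n" "k \<le> 5" by auto
  show "int (mc k (Kn_V n) (Kn_E n)) = int (n choose 2) - \<lceil>real (k * n) / 2\<rceil> + 1"
    using mc_Kn_ge[OF k(1,2)] mc_Kn_le_small[OF k] by linarith
qed

end
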